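(* For $i=0,1,\dots,k$ let $\mu_i$ be a probability measure on $([0,1],\mathcal{B})$ and $T_i:[0,1]\to[0,1]$ a $\mu_i$-preserving ergodic transformation such that (1) for each $i$ there is a partition $\mathcal{A}_i$ with $(T_i,\mu_i,\mathcal{A}_i)\in\mathcal{T}$; (2) for $i=1,\dots,k$, $(T_i,\mu_i,\mathcal{A}_i)$ is $\alpha$-mixing. Let $h(T_i)<\infty$ be the entropy of $T_i$ and for each $i$ let $(a_n^{(i)})_n$ be an increasing sequence of natural numbers. Assume there is $\epsilon_0>0$ such that for $i=0,\dots,k-1$, $\lim_{n\to\infty}\big(a_n^{(i+1)}(h(T_{i+1})-\epsilon_0)-a_n^{(i)}(h(T_i)+\epsilon_0)\big)=\infty$. If $T_0$ is strongly mixing, then for every probability measure $\nu$ equivalent to Lebesgue measure $\lambda$ and all $B,A_0,\dots,A_k\in\mathcal{B}$, $\lim_{n\to\infty}\nu(B\cap T_0^{-a_n^{(0)}}A_0\cap T_1^{-a_n^{(1)}}A_1\cap\cdots\cap T_k^{-a_n^{(k)}}A_k)=\nu(B)\prod_{i=0}^k\mu_i(A_i)$.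
   Context: Let $X=[0,1]$, $\mathcal{B}$ Borel, $\lambda$ Lebesgue. A partition of $[0,1]$ is a finite or countable family of intervals with nonempty pairwise disjoint interiors covering $[0,1]$ up to a $\lambda$-null set. The class $\mathcal{T}$ consists of triples $(T,\mu,\mathcal{A})$ where $\mu$ is a Borel probability measure with $\frac1c\mu\le\lambda\le c\mu$ for some $c\ge1$, $T:[0,1]\to[0,1]$ is $\mu$-preserving and ergodic, and $\mathcal{A}$ is a partition such that $T|_{\mathrm{int}(I)}$ is continuous and strictly monotone for each $I\in\mathcal{A}$, $\bigvee_{j\ge0}T^{-j}\sigma(\mathcal{A})=\mathcal{B}$ mod $\lambda$, and $-\sum_{I\in\mathcal{A}}\mu(I)\log\mu(I)<\infty$. Write $\mathcal{A}^l=\bigvee_{j=0}^{l-1}T^{-j}\mathcal{A}$. $(T,\mu,\mathcal{A})\in\mathcal{T}$ is $\alpha$-mixing if there are nonnegative reals $\alpha(n)\to0$ such that for every $l\in\mathbb{N}$, integer $n\ge0$, $A\in\sigma(\mathcal{A}^l)$, $B\in\mathcal{B}$: $|\mu(A\cap T^{-(n+l)}B)-\mu(A)\mu(B)|\le\alpha(n)$. *)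

theory Defs
  imports "HOL-Probability.Probability"
begin

definition borel01 :: "real measure" where
  "borel01 = restrict_space borel {0..1}"

definition leb01 :: "real measure" where
  "leb01 = restrict_space lborel {0..1}"

definition preim :: "(real \<Rightarrow> real) \<Rightarrow> nat \<Rightarrow> real set \<Rightarrow> real set" where
  "preim T n A = (T ^^ n) -` A \<inter> {0..1}"

definition measure_preserving01 :: "real measure \<Rightarrow> (real \<Rightarrow> real) \<Rightarrow> bool" where
  "measure_preserving01 \<mu> T \<longleftrightarrow> T \<in> {0..1} \<rightarrow> {0..1} \<and> T \<in> measurable \<mu> \<mu> \<and> distr \<mu> \<mu> T = \<mu>"

definition ergodic01 :: "real measure \<Rightarrow> (real \<Rightarrow> real) \<Rightarrow> bool" where
  "ergodic01 \<mu> T \<longleftrightarrow> (\<forall>A \<in> sets \<mu>. preim T 1 A = A \<longrightarrow> measure \<mu> A = 0 \<or> measure \<mu> A = 1)"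

definition strongly_mixing01 :: "real measure \<Rightarrow> (real \<Rightarrow> real) \<Rightarrow> bool" where
  "strongly_mixing01 \<mu> T \<longleftrightarrow> (\<forall>A \<in> sets \<mu>. \<forall>B \<in> sets \<mu>.
      (\<lambda>n. measure \<mu> (A \<inter> preim T n B)) \<longlonglongrightarrow> measure \<mu> A * measure \<mu> B)"

definition prob01 :: "real measure \<Rightarrow> bool" where
  "prob01 \<mu> \<longleftrightarrow> prob_space \<mu> \<and> sets \<mu> = sets borel01"

definition equiv_lebesgue01 :: "real measure \<Rightarrow> bool" where
  "equiv_lebesgue01 \<nu> \<longleftrightarrow> (\<forall>S \<in> sets borel01. measure \<nu> S = 0 \<longleftrightarrow> measure leb01 S = 0)"

definition finite_meas_partition :: "real measure \<Rightarrow> real set set \<Rightarrow> bool" where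
  "finite_meas_partition \<mu> Q \<longleftrightarrow> finite Q \<and> Q \<subseteq> sets \<mu> \<and> disjoint Q \<and> \<Union>Q = space \<mu>"

definition part_entropy :: "real measure \<Rightarrow> real set set \<Rightarrow> real" where
  "part_entropy \<mu> Q = (\<Sum>C\<in>Q. - measure \<mu> C * ln (measure \<mu> C))"

definition join_part :: "(real \<Rightarrow> real) \<Rightarrow> real set set \<Rightarrow> nat \<Rightarrow> real set set" where
  "join_part T Q n = {(\<Inter>j<n. preim T j (f j)) | f. \<forall>j<n. f j \<in> Q}"

definition entropy_part :: "real measure \<Rightarrow> (real \<Rightarrow> real) \<Rightarrow> real set set \<Rightarrow> real" where
  "entropy_part \<mu> T Q = lim (\<lambda>n. part_entropy \<mu> (join_part T Q (Suc n)) / real (Suc n))"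

definition ks_entropy :: "real measure \<Rightarrow> (real \<Rightarrow> real) \<Rightarrow> ereal" where
  "ks_entropy \<mu> T = (SUP Q \<in> {Q. finite_meas_partition \<mu> Q}. ereal (entropy_part \<mu> T Q))"

definition interval_partition01 :: "real set set \<Rightarrow> bool" where
  "interval_partition01 P \<longleftrightarrow> countable P \<and>
     (\<forall>I\<in>P. is_interval I \<and> I \<subseteq> {0..1} \<and> interior I \<noteq> {}) \<and>
     (\<forall>I\<in>P. \<forall>J\<in>P. I \<noteq> J \<longrightarrow> interior I \<inter> interior J = {}) \<and>
     emeasure lborel ({0..1} - \<Union>P) = 0"

definition gen_sigma :: "(real \<Rightarrow> real) \<Rightarrow> real set set \<Rightarrow> real set set" where
  "gen_sigma T P = sigma_sets {0..1} {preim T j I | j I. I \<in> P}"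

definition in_class_T :: "(real \<Rightarrow> real) \<Rightarrow> real measure \<Rightarrow> real set set \<Rightarrow> bool" where
  "in_class_T T \<mu> P \<longleftrightarrow>
     prob01 \<mu> \<and>
     (\<exists>c::real. c \<ge> 1 \<and> (\<forall>S \<in> sets borel01.
        measure \<mu> S / c \<le> measure leb01 S \<and> measure leb01 S \<le> c * measure \<mu> S)) \<and>
     measure_preserving01 \<mu> T \<and> ergodic01 \<mu> T \<and>
     interval_partition01 P \<and>
     (\<forall>I\<in>P. continuous_on (interior I) T \<and>
        (strict_mono_on (interior I) T \<or> strict_antimono_on (interior I) T)) \<and>
     (\<forall>B \<in> sets borel01. \<exists>C \<in> gen_sigma T P. measure leb01 ((B - C) \<union> (C - B)) = 0) \<and>
     (\<lambda>I. - measure \<mu> I * ln (measure \<mu> I)) summable_on P"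

definition sigma_join :: "(real \<Rightarrow> real) \<Rightarrow> real set set \<Rightarrow> nat \<Rightarrow> real set set" where
  "sigma_join T P l = sigma_sets {0..1} (join_part T P l)"

definition alpha_mixing :: "(real \<Rightarrow> real) \<Rightarrow> real measure \<Rightarrow> real set set \<Rightarrow> bool" where
  "alpha_mixing T \<mu> P \<longleftrightarrow> in_class_T T \<mu> P \<and>
     (\<exists>\<alpha> :: nat \<Rightarrow> real. (\<forall>n. \<alpha> n \<ge> 0) \<and> \<alpha> \<longlonglongrightarrow> 0 \<and>
        (\<forall>l \<ge> 1. \<forall>n. \<forall>A \<in> sigma_join T P l. \<forall>B \<in> sets borel01.
           \<bar>measure \<mu> (A \<inter> preim T (n + l) B) - measure \<mu> A * measure \<mu> B\<bar> \<le> \<alpha> n))"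

end

theory Submission
  imports Defs
begin

text \<open>
  All systems are mixing, so Chebyshev's inequality already gives convergence in probability of
  Birkhoff averages. From it one obtains by counting the two halves of the Shannon-McMillan theorem
  in the form needed here: most points lie in at most \<open>exp (n (h + \<epsilon>))\<close> cylinders of length \<open>n\<close>, and no
  \<open>exp (n (h - \<epsilon>))\<close> cylinders of length \<open>n\<close> carry much mass.

  Cylinders are intervals. Hence \<open>B\<close> intersected with the preimages under the maps with index below \<open>k\<close>
  is close to a set with so few endpoints that, by the growth condition, the cylinders of \<open>T k\<close> of
  length slightly below \<open>a k n\<close> containing such an endpoint have small total mass. The set is
  therefore close to a union of cylinders, from which \<open>\<alpha>\<close>-mixing splits off the last factor.
  The rest is induction on \<open>k\<close>, passing from \<open>\<mu> k\<close> to \<open>\<nu>\<close> by absolute continuity.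
\<close>

section \<open>Itineraries and averages in mixing systems\<close>

text \<open>Entropy is a supremum over finite partitions, whereas the cylinders that are intervals
  belong to the possibly infinite \<open>P\<close>. The rates are therefore proved for finite labels
  and carried over to \<open>P\<close>, in both directions, by conditional codes: if one label is
  determined by another up to little average information, Markov's inequality bounds how many words
  of the first can accompany a single word of the second. From finite labels to \<open>P\<close>
  this costs a tail of the entropy series of \<open>P\<close>; back from \<open>P\<close> it rests
  on generation. Rates in measure suffice because sets are only ever replaced up to small measure.
  Each preimage is approximated in the measure of its own map; comparability with Lebesgue measure
  makes the error small for \<open>\<mu> k\<close> as well, and the number of cuts refers to no
  measure at all. \<alpha>-mixing requires a gap between the cylinder length and the time. A gap
  that does not depend on \<open>n\<close> is enough, and its constant factor is swallowed by the
  growth condition. The induction runs over all measures equivalent to Lebesgue measure at once,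
  since the step to the next map uses the previous result for the invariant measure of that
  map.\<close>

primrec itin :: "('a \<Rightarrow> 'a) \<Rightarrow> ('a \<Rightarrow> 'b) \<Rightarrow> nat \<Rightarrow> 'a \<Rightarrow> 'b list" where
  "itin T q 0 x = []"
| "itin T q (Suc n) x = q x # itin T q n (T x)"

lemma length_itin [simp]: "length (itin T q n x) = n"
  by (induction n arbitrary: x) auto

lemma nth_itin: "j < n \<Longrightarrow> itin T q n x ! j = q ((T ^^ j) x)"
proof (induction n arbitrary: x j)
  case (Suc n)
  then show ?case by (cases j) (auto simp: funpow_swap1)
qed simp

lemma itin_add: "itin T q (m + n) x = itin T q m x @ itin T q n ((T ^^ m) x)"
  by (induction m arbitrary: x) (auto simp: funpow_swap1)

lemma take_itin: "m \<le> n \<Longrightarrow> take m (itin T q n x) = itin T q m x"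
  using itin_add[of T q m "n - m" x] by simp

lemma drop_itin: "drop m (itin T q n x) = itin T q (n - m) ((T ^^ m) x)"
proof (cases "m \<le> n")
  case True
  then show ?thesis using itin_add[of T q m "n - m" x] by simp
qed simp

text \<open>A countable range keeps the discrete sigma-algebra usable: pairs of labels, and hence
  itineraries, are again measurable into a discrete space.\<close>

definition labelling :: "'a measure \<Rightarrow> ('a \<Rightarrow> 'b) \<Rightarrow> bool" where
  "labelling M q \<longleftrightarrow> q \<in> measurable M (count_space UNIV) \<and> countable (q ` space M)"

lemma labellingI:
  assumes "countable L" "q \<in> space M \<rightarrow> L" "\<And>l. l \<in> L \<Longrightarrow> {x \<in> space M. q x = l} \<in> sets M"
  shows "labelling M q"
proof -
  have "q -` W \<inter> space M \<in> sets M" for W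
  proof -
    have "q -` W \<inter> space M = (\<Union>l\<in>W \<inter> L. {x \<in> space M. q x = l})" using assms(2) by auto
    moreover have "\<dots> \<in> sets M" using assms by (intro sets.countable_UN') auto
    ultimately show ?thesis by simp
  qed
  moreover have "countable (q ` space M)"
    using assms(1,2) by (metis countable_subset image_subset_iff_funcset)
  ultimately show ?thesis unfolding labelling_def by (auto simp: measurable_def)
qed

lemma labelling_sets:
  assumes "labelling M q" shows "{x \<in> space M. q x \<in> W} \<in> sets M"
proof -
  have "q -` W \<inter> space M \<in> sets M"
    using assms unfolding labelling_def by (auto intro: measurable_sets)
  moreover have "q -` W \<inter> space M = {x \<in> space M. q x \<in> W}" by auto
  ultimately show ?thesis by simp
qed

lemma labelling_comp:
  assumes "labelling M q" shows "labelling M (\<lambda>x. f (q x))"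
proof -
  have "(\<lambda>x. f (q x)) \<in> measurable M (count_space UNIV)"
    using assms unfolding labelling_def by (auto intro: measurable_compose)
  moreover have "(\<lambda>x. f (q x)) ` space M = f ` q ` space M" by auto
  ultimately show ?thesis using assms unfolding labelling_def by auto
qed

lemma labelling_pair:
  assumes "labelling M q" "labelling M r"
  shows "labelling M (\<lambda>x. (q x, r x))"
proof (rule labellingI[of "q ` space M \<times> r ` space M"])
  show "countable (q ` space M \<times> r ` space M)" using assms by (auto simp: labelling_def)
  show "{x \<in> space M. (q x, r x) = l} \<in> sets M" for l
  proof -
    have "{x \<in> space M. (q x, r x) = l} = {x \<in> space M. q x \<in> {fst l}} \<inter> {x \<in> space M. r x \<in> {snd l}}"
      by auto
    moreover have "\<dots> \<in> sets M"
      by (intro sets.Int labelling_sets[OF assms(1)] labelling_sets[OF assms(2)])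
    ultimately show ?thesis by simp
  qed
qed auto

lemma labelling_borel: "labelling M q \<Longrightarrow> (\<lambda>x. f (q x)) \<in> borel_measurable M"
  unfolding labelling_def by (rule measurable_compose[of q M "count_space UNIV"]) auto

section \<open>Measure-preserving maps and their itineraries\<close>

locale pmp = prob_space M for M :: "'a measure" +
  fixes T :: "'a \<Rightarrow> 'a"
  assumes T_meas [measurable]: "T \<in> measurable M M"
    and T_inv: "distr M M T = M"
begin

lemma Tn_meas [measurable]: "T ^^ n \<in> measurable M M"
proof (induction n)
  case (Suc n)
  show ?case unfolding funpow.simps by (rule measurable_comp[OF Suc T_meas])
qed (simp add: id_def)

lemma Tn_inv: "distr M M (T ^^ n) = M"
proof (induction n)
  case 0
  show ?case by (rule measure_eqI) (auto simp: emeasure_distr id_def sets.Int_space_eq2)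
next
  case (Suc n)
  have "distr M M (T ^^ Suc n) = distr (distr M M (T ^^ n)) M T"
    unfolding funpow.simps by (rule distr_distr[symmetric]) auto
  then show ?case unfolding Suc T_inv .
qed

lemma Tn_space: "x \<in> space M \<Longrightarrow> (T ^^ n) x \<in> space M"
  using measurable_space[OF Tn_meas] .

lemma prob_Tn:
  assumes "A \<in> sets M" shows "prob ((T ^^ n) -` A \<inter> space M) = prob A"
  using measure_distr[OF Tn_meas assms, of n] Tn_inv by simp

lemma prob_Tn_Collect:
  assumes "{x \<in> space M. Q x} \<in> sets M" shows "prob {x \<in> space M. Q ((T ^^ n) x)} = prob {x \<in> space M. Q x}"
proof -
  have "{x \<in> space M. Q ((T ^^ n) x)} = (T ^^ n) -` {x \<in> space M. Q x} \<inter> space M"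
    using Tn_space by auto
  then show ?thesis using prob_Tn[OF assms] by simp
qed

lemma integral_Tn:
  assumes "f \<in> borel_measurable M"
  shows "(\<integral>x. f ((T ^^ n) x) \<partial>M) = (\<integral>x. (f x :: real) \<partial>M)"
  using integral_distr[OF Tn_meas, of f n] assms Tn_inv by simp

lemma integrable_Tn:
  assumes "integrable M f"
  shows "integrable M (\<lambda>x. f ((T ^^ n) x) :: real)"
  using integrable_distr[OF Tn_meas, of n f] assms Tn_inv by simp

lemma AE_Tn:
  assumes "AE x in M. Q x" shows "AE x in M. Q ((T ^^ n) x)"
proof -
  have "AE x in distr M M (T ^^ n). Q x" unfolding Tn_inv by fact
  then show ?thesis using AE_distrD[OF Tn_meas] by auto
qed

lemma AE_all_Tn:
  assumes "AE x in M. Q x" shows "AE x in M. \<forall>n. Q ((T ^^ n) x)"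
  using AE_Tn[OF assms] by (simp add: AE_all_countable)

lemma labelling_itin:
  assumes q: "labelling M q" shows "labelling M (itin T q n)"
proof (induction n)
  case 0
  show ?case by (rule labellingI[of "{[]}"]) auto
next
  case (Suc n)
  have "labelling M (\<lambda>x. itin T q n (T x))"
    using Suc measurable_space[OF T_meas] unfolding labelling_def
    by (auto intro!: measurable_compose[OF T_meas] intro: countable_subset[of _ "itin T q n ` space M"])
  from labelling_comp[OF labelling_pair[OF q this], of "\<lambda>(a, b). a # b"]
  show ?case by simp
qed

lemma itin_sets: "labelling M q \<Longrightarrow> {x \<in> space M. itin T q n x \<in> W} \<in> sets M"
  using labelling_sets[OF labelling_itin] .

lemma itin_sets_eq: "labelling M q \<Longrightarrow> {x \<in> space M. itin T q n x = w} \<in> sets M"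
  using itin_sets[of q n "{w}"] by simp

end

section \<open>A weak law of large numbers for mixing maps\<close>

locale mixing_pmp = pmp +
  assumes mix: "\<And>A B. A \<in> sets M \<Longrightarrow> B \<in> sets M \<Longrightarrow>
    (\<lambda>n. prob (A \<inter> ((T ^^ n) -` B \<inter> space M))) \<longlonglongrightarrow> prob A * prob B"
begin

text \<open>Stationarity: both preimages are pulled back from time \<open>i\<close>, so the
  correlation depends on the lag alone.\<close>

lemma prob_Int_Tn:
  assumes "C \<in> sets M" "i \<le> j"
  shows "prob (((T ^^ i) -` C \<inter> space M) \<inter> ((T ^^ j) -` C \<inter> space M))
       = prob (C \<inter> ((T ^^ (j - i)) -` C \<inter> space M))"
proof -
  have eq: "(T ^^ j) x = (T ^^ (j - i)) ((T ^^ i) x)" for x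
    by (metis assms(2) comp_apply funpow_add le_add_diff_inverse2)
  have "((T ^^ i) -` C \<inter> space M) \<inter> ((T ^^ j) -` C \<inter> space M)
      = (T ^^ i) -` (C \<inter> ((T ^^ (j - i)) -` C \<inter> space M)) \<inter> space M"
    using Tn_space by (auto simp: eq)
  then show ?thesis using prob_Tn[of "C \<inter> ((T ^^ (j - i)) -` C \<inter> space M)" i] assms(1)
    by (simp add: measurable_sets[OF Tn_meas])
qed

text \<open>Mixing makes the covariances tend to 0 with the lag, at whatever speed, so the variance
  of the sum is of smaller order than the square of \<open>n\<close> and Chebyshev's inequality
  applies.\<close>

lemma birkhoff_indicator:
  assumes C: "C \<in> sets M" and \<epsilon>: "\<epsilon> > 0"
  shows "(\<lambda>n. prob {x \<in> space M. \<epsilon> * real n \<le> \<bar>(\<Sum>j<n. indicat_real C ((T ^^ j) x)) - real n * prob C\<bar>}) \<longlonglongrightarrow> 0"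
proof -
  define p where "p = prob C"
  define c where "c d = \<bar>prob (C \<inter> ((T ^^ d) -` C \<inter> space M)) - p\<^sup>2\<bar>" for d
  define S where "S n x = (\<Sum>j<n. indicat_real C ((T ^^ j) x))" for n x
  define Cj where "Cj j = (T ^^ j) -` C \<inter> space M" for j
  have Cj[measurable]: "Cj j \<in> sets M" for j unfolding Cj_def using C by (simp add: measurable_sets[OF Tn_meas])
  have prCj: "prob (Cj j) = p" for j unfolding Cj_def p_def using C by (rule prob_Tn)
  have S_eq: "S n x = (\<Sum>j<n. indicat_real (Cj j) x)" if "x \<in> space M" for n x
    using that unfolding S_def Cj_def by (intro sum.cong) (auto simp: indicator_def)
  have S_meas[measurable]: "S n \<in> borel_measurable M" for n
    using C unfolding S_def by measurable
  have S_bd: "\<bar>S n x\<bar> \<le> n" for n x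
    unfolding S_def by (rule order_trans[OF sum_abs]) (use sum_bounded_above[of "{..<n}" "\<lambda>j. \<bar>indicat_real C ((T ^^ j) x)\<bar>" 1] in \<open>auto simp: indicator_def\<close>)
  have S2: "integrable M (\<lambda>x. (S n x)\<^sup>2)" for n
    by (rule integrable_const_bound[of _ "(real n)\<^sup>2"]) (use S_bd[of n] in \<open>auto simp: abs_le_square_iff[symmetric]\<close>)
  have S1: "integrable M (S n)" for n
    by (rule integrable_const_bound[of _ n]) (use S_bd[of n] in auto)
  have ES: "expectation (S n) = n * p" for n
  proof -
    have "expectation (S n) = expectation (\<lambda>x. \<Sum>j<n. indicat_real (Cj j) x)"
      by (intro Bochner_Integration.integral_cong) (auto simp: S_eq)
    also have "\<dots> = (\<Sum>j<n. prob (Cj j))"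
      by (subst Bochner_Integration.integral_sum) (auto intro!: integrable_real_indicator simp: less_top[symmetric])
    finally show ?thesis by (simp add: prCj)
  qed
  have ES2: "expectation (\<lambda>x. (S n x)\<^sup>2) = (\<Sum>i<n. \<Sum>j<n. prob (Cj i \<inter> Cj j))" for n
  proof -
    have "expectation (\<lambda>x. (S n x)\<^sup>2) = expectation (\<lambda>x. \<Sum>i<n. \<Sum>j<n. indicat_real (Cj i \<inter> Cj j) x)"
      by (intro Bochner_Integration.integral_cong) (auto simp: S_eq power2_eq_square sum_product indicator_inter_arith)
    also have "\<dots> = (\<Sum>i<n. expectation (\<lambda>x. \<Sum>j<n. indicat_real (Cj i \<inter> Cj j) x))"
      by (intro Bochner_Integration.integral_sum Bochner_Integration.integrable_sum integrable_real_indicator)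
         (auto simp: less_top[symmetric])
    also have "\<dots> = (\<Sum>i<n. \<Sum>j<n. prob (Cj i \<inter> Cj j))"
      by (intro sum.cong refl, subst Bochner_Integration.integral_sum)
         (auto intro!: integrable_real_indicator simp: less_top[symmetric])
    finally show ?thesis .
  qed
  have corr: "\<bar>prob (Cj i \<inter> Cj j) - p\<^sup>2\<bar> = c (if i \<le> j then j - i else i - j)" for i j
    using prob_Int_Tn[OF C, of i j] prob_Int_Tn[OF C, of j i] unfolding c_def Cj_def p_def
    by (auto simp: Int_commute)
  have c1: "c d \<le> 1" for d
  proof -
    have "p\<^sup>2 \<le> 1" "0 \<le> p\<^sup>2" unfolding p_def by (auto intro: power_le_one)
    then show ?thesis unfolding c_def
      using prob_le_1[of "C \<inter> ((T ^^ d) -` C \<inter> space M)"] measure_nonneg[of M "C \<inter> ((T ^^ d) -` C \<inter> space M)"] by linarith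
  qed
  have clim: "c \<longlonglongrightarrow> 0"
    unfolding c_def using mix[OF C C] unfolding p_def
    by (intro tendsto_rabs_zero) (simp add: LIM_zero_iff power2_eq_square)
  \<comment> \<open>In each row of the covariance matrix at most \<open>2 * D\<close> entries have
    lag at most \<open>D\<close>; these are bounded by 1 and all others by \<open>e\<close>.\<close>
  have var: "variance (S n) \<le> n * (2 * real D + n * e)" if D: "\<And>d. d \<ge> D \<Longrightarrow> c d \<le> e" and e: "e \<ge> 0" for n D e
  proof -
    have row: "(\<Sum>j<n. \<bar>prob (Cj i \<inter> Cj j) - p\<^sup>2\<bar>) \<le> 2 * real D + n * e" for i
    proof -
      have "(\<Sum>j<n. \<bar>prob (Cj i \<inter> Cj j) - p\<^sup>2\<bar>) \<le> (\<Sum>j<n. (if j \<in> {i..<i + D} then 1 else 0) + (if j \<in> {i - D..<i} then 1 else 0) + e)"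
      proof (intro sum_mono)
        fix j
        show "\<bar>prob (Cj i \<inter> Cj j) - p\<^sup>2\<bar> \<le> (if j \<in> {i..<i + D} then 1 else 0) + (if j \<in> {i - D..<i} then 1 else 0) + e"
        proof (cases "j \<in> {i..<i + D} \<union> {i - D..<i}")
          case True
          then have "(1::real) \<le> (if j \<in> {i..<i + D} then 1 else 0) + (if j \<in> {i - D..<i} then 1 else 0) + e"
            using e by auto
          then show ?thesis unfolding corr by (rule order_trans[OF c1])
        next
          case False
          then have "D \<le> (if i \<le> j then j - i else i - j)" by auto
          from D[OF this] False show ?thesis unfolding corr by auto
        qed
      qed
      also have "\<dots> = real (card ({i..<i + D} \<inter> {..<n})) + real (card ({i - D..<i} \<inter> {..<n})) + n * e"
        by (simp add: sum.distrib sum.If_cases Int_commute atLeastLessThan_def atLeast_def lessThan_def Int_def conj_ac)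
      also have "\<dots> \<le> real D + real D + n * e"
        using card_mono[of "{i..<i + D}" "{i..<i + D} \<inter> {..<n}"] card_mono[of "{i - D..<i}" "{i - D..<i} \<inter> {..<n}"] by simp
      finally show ?thesis by simp
    qed
    have "variance (S n) = expectation (\<lambda>x. (S n x)\<^sup>2) - (expectation (S n))\<^sup>2"
      using S1 S2 by (rule variance_eq)
    also have "\<dots> = (\<Sum>i<n. \<Sum>j<n. prob (Cj i \<inter> Cj j) - p\<^sup>2)"
      unfolding ES ES2 by (simp add: sum_subtractf power2_eq_square algebra_simps)
    also have "\<dots> \<le> (\<Sum>i<n. \<Sum>j<n. \<bar>prob (Cj i \<inter> Cj j) - p\<^sup>2\<bar>)" by (intro sum_mono) auto
    also have "\<dots> \<le> (\<Sum>i<n. 2 * real D + n * e)" by (intro sum_mono row)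
    finally show ?thesis by simp
  qed
  have cheb: "prob {x \<in> space M. \<epsilon> * n \<le> \<bar>S n x - n * p\<bar>} \<le> variance (S n) / (\<epsilon> * n)\<^sup>2" if "n > 0" for n :: nat
    using Chebyshev_inequality[OF S_meas S2, of "\<epsilon> * n" n] that \<epsilon> by (simp add: ES)
  have "(\<lambda>n. prob {x \<in> space M. \<epsilon> * n \<le> \<bar>S n x - n * p\<bar>}) \<longlonglongrightarrow> 0"
  proof (rule LIMSEQ_I)
    fix r :: real assume r: "r > 0"
    \<comment> \<open>Once \<open>2 * D < n * e\<close>, the variance is at most twice the square of
      \<open>n\<close> times \<open>e\<close>; division by the square of
      \<open>\<epsilon> * n\<close> then leaves \<open>r / 2\<close>.\<close>
    define e where "e = r * \<epsilon>\<^sup>2 / 4"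
    have e: "e > 0" using r \<epsilon> by (simp add: e_def)
    obtain D where D: "\<And>d. d \<ge> D \<Longrightarrow> c d \<le> e"
      using LIMSEQ_D[OF clim e] by (fastforce simp: c_def)
    obtain N where N: "real N > 2 * real D / e" using reals_Archimedean2 by blast
    have "norm (prob {x \<in> space M. \<epsilon> * n \<le> \<bar>S n x - n * p\<bar>} - 0) < r" if n: "n \<ge> Suc N" for n
    proof -
      have "real n > 2 * real D / e" using n N by linarith
      then have nD: "2 * real D < n * e" using e by (simp add: divide_less_eq)
      have n0: "n > 0" using n by simp
      have "prob {x \<in> space M. \<epsilon> * n \<le> \<bar>S n x - n * p\<bar>} \<le> variance (S n) / (\<epsilon> * n)\<^sup>2" using n0 by (rule cheb)
      also have "\<dots> \<le> (n * (2 * real D + n * e)) / (\<epsilon> * n)\<^sup>2" using var[of D e n] D e by (intro divide_right_mono) auto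
      also have "\<dots> \<le> (n * (n * e + n * e)) / (\<epsilon> * n)\<^sup>2" using nD by (intro divide_right_mono mult_left_mono) (auto simp: mult.commute)
      also have "\<dots> = r / 2" using n0 \<epsilon> by (simp add: e_def power2_eq_square field_simps)
      finally show ?thesis using r by simp
    qed
    then show "\<exists>no. \<forall>n\<ge>no. norm (prob {x \<in> space M. \<epsilon> * n \<le> \<bar>S n x - n * p\<bar>} - 0) < r" by blast
  qed
  then show ?thesis unfolding S_def p_def .
qed

text \<open>\<open>f\<close> is a finite combination of indicators of its level sets, and the law of
  large numbers is applied to each of them with the same tolerance \<open>e\<close>.\<close>

lemma birkhoff_simple:
  fixes f :: "'a \<Rightarrow> real"
  assumes f: "f \<in> borel_measurable M" "finite (f ` space M)" and c: "expectation f < c" and \<delta>: "\<delta> > 0"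
  shows "\<forall>\<^sub>F n in sequentially. prob {x \<in> space M. (\<Sum>j<n. f ((T ^^ j) x)) \<ge> c * real n} < \<delta>"
proof -
  define V where "V = f ` space M"
  have V: "finite V" using f by (simp add: V_def)
  define C where "C v = f -` {v} \<inter> space M" for v
  have C[measurable]: "C v \<in> sets M" for v unfolding C_def using f(1) by (intro measurable_sets) auto
  have fC: "f x = (\<Sum>v\<in>V. v * indicat_real (C v) x)" if "x \<in> space M" for x
  proof -
    have "(\<Sum>v\<in>V. v * indicat_real (C v) x) = (\<Sum>v\<in>V. if v = f x then v else 0)"
      using that by (intro sum.cong) (auto simp: C_def)
    then show ?thesis using that V by (simp add: V_def)
  qed
  have Ef: "expectation f = (\<Sum>v\<in>V. v * prob (C v))"
  proof -
    have "expectation f = expectation (\<lambda>x. \<Sum>v\<in>V. v * indicat_real (C v) x)"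
      by (intro Bochner_Integration.integral_cong) (auto simp: fC)
    also have "\<dots> = (\<Sum>v\<in>V. expectation (\<lambda>x. v * indicat_real (C v) x))"
      by (intro Bochner_Integration.integral_sum integrable_mult_right integrable_real_indicator) (auto simp: less_top[symmetric])
    finally show ?thesis by simp
  qed
  \<comment> \<open>The summand 1 keeps \<open>K\<close> positive when \<open>f\<close> vanishes and
    makes the final comparison strict.\<close>
  define K where "K = (\<Sum>v\<in>V. \<bar>v\<bar>) + 1"
  have K: "K > 0" unfolding K_def by (simp add: add_nonneg_pos sum_nonneg)
  define e where "e = (c - expectation f) / K"
  have e: "e > 0" using c K by (simp add: e_def)
  define bad where "bad n v = {x \<in> space M. e * real n \<le> \<bar>(\<Sum>j<n. indicat_real (C v) ((T ^^ j) x)) - real n * prob (C v)\<bar>}" for n v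
  have bad[measurable]: "bad n v \<in> sets M" for n v unfolding bad_def by measurable
  have lim: "(\<lambda>n. \<Sum>v\<in>V. prob (bad n v)) \<longlonglongrightarrow> (\<Sum>v\<in>V. 0)"
    unfolding bad_def by (intro tendsto_sum birkhoff_indicator C e)
  have ev: "\<forall>\<^sub>F n in sequentially. (\<Sum>v\<in>V. prob (bad n v)) < \<delta>"
    using order_tendstoD(2)[OF lim] \<delta> by simp
  show ?thesis using ev eventually_gt_at_top[of 0]
  proof eventually_elim
    case (elim n)
    have sub: "{x \<in> space M. (\<Sum>j<n. f ((T ^^ j) x)) \<ge> c * real n} \<subseteq> (\<Union>v\<in>V. bad n v)"
    proof (rule ccontr)
      assume "\<not> ?thesis"
      then obtain x where x: "x \<in> space M" "(\<Sum>j<n. f ((T ^^ j) x)) \<ge> c * n" "\<And>v. v \<in> V \<Longrightarrow> x \<notin> bad n v"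
        by blast
      have good: "\<bar>(\<Sum>j<n. indicat_real (C v) ((T ^^ j) x)) - n * prob (C v)\<bar> \<le> e * n" if "v \<in> V" for v
        using x(1) x(3)[OF that] unfolding bad_def by auto
      have "(\<Sum>j<n. f ((T ^^ j) x)) = (\<Sum>j<n. \<Sum>v\<in>V. v * indicat_real (C v) ((T ^^ j) x))"
        using x(1) Tn_space by (intro sum.cong) (auto intro!: fC)
      also have "\<dots> = (\<Sum>v\<in>V. v * (\<Sum>j<n. indicat_real (C v) ((T ^^ j) x)))"
        by (subst sum.swap) (simp add: sum_distrib_left)
      finally have eq: "(\<Sum>j<n. f ((T ^^ j) x)) = (\<Sum>v\<in>V. v * (\<Sum>j<n. indicat_real (C v) ((T ^^ j) x)))" .
      have "(\<Sum>j<n. f ((T ^^ j) x)) - n * expectation f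
          = (\<Sum>v\<in>V. v * ((\<Sum>j<n. indicat_real (C v) ((T ^^ j) x)) - n * prob (C v)))"
        unfolding eq Ef by (simp add: sum_subtractf right_diff_distrib sum_distrib_left algebra_simps)
      also have "\<dots> \<le> (\<Sum>v\<in>V. \<bar>v\<bar> * (e * n))"
      proof (intro sum_mono)
        fix v assume "v \<in> V"
        from good[OF this] have "\<bar>v\<bar> * \<bar>(\<Sum>j<n. indicat_real (C v) ((T ^^ j) x)) - n * prob (C v)\<bar> \<le> \<bar>v\<bar> * (e * n)"
          by (intro mult_left_mono) auto
        then show "v * ((\<Sum>j<n. indicat_real (C v) ((T ^^ j) x)) - n * prob (C v)) \<le> \<bar>v\<bar> * (e * n)"
          unfolding abs_mult[symmetric] by (rule order_trans[OF abs_ge_self])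
      qed
      also have "\<dots> = (K - 1) * (e * n)" by (simp add: K_def sum_distrib_right)
      also have "\<dots> < K * (e * n)" using e elim by (intro mult_strict_right_mono) auto
      also have "\<dots> = (c - expectation f) * n" using K by (simp add: e_def)
      finally show False using x(2) by (simp add: algebra_simps)
    qed
    have "prob {x \<in> space M. (\<Sum>j<n. f ((T ^^ j) x)) \<ge> c * real n} \<le> prob (\<Union>v\<in>V. bad n v)"
      using sub V bad by (intro finite_measure_mono sets.finite_UN) blast+
    also have "\<dots> \<le> (\<Sum>v\<in>V. prob (bad n v))"
      using V bad by (intro finite_measure_subadditive_finite) blast+
    finally show ?case using elim by simp
  qed
qed

end

section \<open>Counting words\<close>

definition words :: "'b set \<Rightarrow> nat \<Rightarrow> 'b list set" where
  "words L n = {w. set w \<subseteq> L \<and> length w = n}"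

lemma finite_words: "finite L \<Longrightarrow> finite (words L n)"
  unfolding words_def by (rule finite_lists_length_eq)

lemma card_words: "finite L \<Longrightarrow> card (words L n) = card L ^ n"
  unfolding words_def by (rule card_lists_length_eq)

lemma words_Suc: "words L (Suc n) = (\<lambda>(a, w). a # w) ` (L \<times> words L n)"
proof -
  have "w \<in> (\<lambda>(a, w). a # w) ` (L \<times> words L n)" if "w \<in> words L (Suc n)" for w
    using that by (cases w) (auto simp: words_def)
  then show ?thesis by (auto simp: words_def)
qed

lemma sum_words_Suc: "(\<Sum>w\<in>words L (Suc n). f w) = (\<Sum>a\<in>L. \<Sum>w\<in>words L n. f (a # w))"
proof -
  have "inj_on (\<lambda>(a, w). a # w) (L \<times> words L n)" by (auto simp: inj_on_def)
  then show ?thesis unfolding words_Suc by (subst sum.reindex) (auto simp: sum.cartesian_product case_prod_beta)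
qed

lemma itin_words: "(\<And>j. j < n \<Longrightarrow> q ((T ^^ j) x) \<in> L) \<Longrightarrow> itin T q n x \<in> words L n"
  by (auto simp: words_def in_set_conv_nth nth_itin)

text \<open>This is \<open>ln t \<le> t - 1\<close> at \<open>t = exp (- b) / p\<close>.\<close>

lemma entropy_term_le:
  fixes p b :: real assumes "p \<ge> 0" shows "- p * ln p \<le> p * b + exp (- b)"
proof (cases "p = 0")
  case False
  then have p: "p > 0" using assms by simp
  have "ln (exp (- b) / p) \<le> exp (- b) / p - 1" using p by (intro ln_le_minus_one) auto
  then have "- b - ln p \<le> exp (- b) / p - 1" using p by (simp add: ln_div)
  then have "p * (- b - ln p) \<le> p * (exp (- b) / p - 1)" using p by (intro mult_left_mono) auto
  then show ?thesis using p by (simp add: algebra_simps)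
qed simp

text \<open>At most \<open>exp b\<close> terms \<open>exp (- b)\<close> add up to at most 1. The
  total mass is left arbitrary so that the bound can be applied separately to pieces of a
  distribution.\<close>

lemma entropy_sum_le:
  fixes p :: "'b \<Rightarrow> real"
  assumes "\<And>w. w \<in> W \<Longrightarrow> p w \<ge> 0" "real (card W) \<le> exp b"
  shows "(\<Sum>w\<in>W. - p w * ln (p w)) \<le> (\<Sum>w\<in>W. p w) * b + 1"
proof -
  have "(\<Sum>w\<in>W. - p w * ln (p w)) \<le> (\<Sum>w\<in>W. p w * b + exp (- b))"
    using assms(1) by (intro sum_mono entropy_term_le) auto
  also have "\<dots> = (\<Sum>w\<in>W. p w) * b + card W * exp (- b)" by (simp add: sum.distrib sum_distrib_right)
  also have "card W * exp (- b) \<le> exp b * exp (- b)" using assms(2) by (intro mult_right_mono) auto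
  finally show ?thesis by (simp add: exp_minus)
qed

context pmp begin

text \<open>The entropy is the threshold between the two rates.\<close>
definition upper_rate :: "('a \<Rightarrow> 'b) \<Rightarrow> real \<Rightarrow> bool" where
  "upper_rate q c \<longleftrightarrow> (\<forall>\<delta>>0. \<forall>\<^sub>F n in sequentially. \<exists>W. finite W \<and> real (card W) \<le> exp (real n * c) \<and>
     prob {x \<in> space M. itin T q n x \<notin> W} \<le> \<delta>)"

definition lower_rate :: "('a \<Rightarrow> 'b) \<Rightarrow> real \<Rightarrow> bool" where
  "lower_rate q c \<longleftrightarrow> (\<forall>\<delta>>0. \<forall>\<^sub>F n in sequentially. \<forall>W. finite W \<and> real (card W) \<le> exp (real n * c) \<longrightarrow>
     prob {x \<in> space M. itin T q n x \<in> W} \<le> \<delta>)"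

definition wp :: "('a \<Rightarrow> 'b) \<Rightarrow> 'b list \<Rightarrow> real" where
  "wp q w = prob {x \<in> space M. itin T q (length w) x = w}"

definition word_entropy :: "('a \<Rightarrow> 'b) \<Rightarrow> nat \<Rightarrow> real" where
  "word_entropy q n = (\<Sum>w\<in>words (q ` space M) n. - wp q w * ln (wp q w))"

lemma wp_nonneg [simp]: "wp q w \<ge> 0" by (simp add: wp_def)

lemma wp_le_1 [simp]: "wp q w \<le> 1" by (simp add: wp_def)

lemma itin_in_words: "x \<in> space M \<Longrightarrow> itin T q n x \<in> words (q ` space M) n"
  using Tn_space by (intro itin_words) auto

lemma prob_itin_sum:
  assumes q: "labelling M q" and W: "finite W" "W \<subseteq> {w. length w = n}"
  shows "prob {x \<in> space M. itin T q n x \<in> W} = (\<Sum>w\<in>W. wp q w)"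
proof -
  have "prob (\<Union>w\<in>W. {x \<in> space M. itin T q n x = w}) = (\<Sum>w\<in>W. prob {x \<in> space M. itin T q n x = w})"
    using W itin_sets_eq[OF q] by (intro finite_measure_finite_Union) (auto simp: disjoint_family_on_def)
  also have "\<dots> = (\<Sum>w\<in>W. wp q w)" using W by (intro sum.cong) (auto simp: wp_def)
  also have "(\<Union>w\<in>W. {x \<in> space M. itin T q n x = w}) = {x \<in> space M. itin T q n x \<in> W}" by auto
  finally show ?thesis .
qed

text \<open>Summing out the first letter yields the preimage under \<open>T\<close> of the cylinder
  of \<open>w\<close>, so this is invariance of the measure. It is the reason why
  \<open>markov\<close> conditions a letter on its future.\<close>

lemma sum_wp_Cons:
  assumes q: "labelling M q" and L: "finite (q ` space M)"
  shows "(\<Sum>a\<in>q ` space M. wp q (a # w)) = wp q w"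
proof -
  let ?n = "length w"
  have "{x \<in> space M. itin T q (Suc ?n) x \<in> (\<lambda>a. a # w) ` q ` space M}
      = {x \<in> space M. itin T q ?n ((T ^^ 1) x) = w}"
    by auto
  moreover have "prob {x \<in> space M. itin T q (Suc ?n) x \<in> (\<lambda>a. a # w) ` q ` space M}
      = (\<Sum>v\<in>(\<lambda>a. a # w) ` q ` space M. wp q v)"
    using L by (intro prob_itin_sum q) auto
  moreover have "\<dots> = (\<Sum>a\<in>q ` space M. wp q (a # w))"
    by (subst sum.reindex) (auto simp: inj_on_def)
  moreover have "prob {x \<in> space M. itin T q ?n ((T ^^ 1) x) = w} = wp q w"
    unfolding wp_def by (intro prob_Tn_Collect itin_sets_eq q)
  ultimately show ?thesis by simp
qed

lemma expectation_itin:
  fixes g :: "'b list \<Rightarrow> real"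
  assumes q: "labelling M q" and L: "finite (q ` space M)"
  shows "integrable M (\<lambda>x. g (itin T q n x))"
    and "expectation (\<lambda>x. g (itin T q n x)) = (\<Sum>w\<in>words (q ` space M) n. wp q w * g w)"
proof -
  let ?Ws = "words (q ` space M) n"
  have eq: "g (itin T q n x) = (\<Sum>w\<in>?Ws. g w * indicat_real {x \<in> space M. itin T q n x = w} x)"
    if x: "x \<in> space M" for x
  proof -
    have "(\<Sum>w\<in>?Ws. g w * indicat_real {x \<in> space M. itin T q n x = w} x)
        = (\<Sum>w\<in>?Ws. if w = itin T q n x then g w else 0)"
      using x by (intro sum.cong) auto
    also have "\<dots> = g (itin T q n x)"
      using itin_in_words[OF x, of q n] finite_words[OF L, of n] by (subst sum.delta) auto
    finally show ?thesis by simp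
  qed
  have int: "integrable M (\<lambda>x. g w * indicat_real {x \<in> space M. itin T q n x = w} x)" for w
    using itin_sets_eq[OF q]
    by (intro integrable_mult_right integrable_real_indicator) (auto simp: less_top[symmetric])
  have "integrable M (\<lambda>x. \<Sum>w\<in>?Ws. g w * indicat_real {x \<in> space M. itin T q n x = w} x)"
    by (intro Bochner_Integration.integrable_sum int)
  then show "integrable M (\<lambda>x. g (itin T q n x))"
    by (rule Bochner_Integration.integrable_cong[THEN iffD2, OF refl, rotated]) (rule eq)
  have "expectation (\<lambda>x. g (itin T q n x))
      = expectation (\<lambda>x. \<Sum>w\<in>?Ws. g w * indicat_real {x \<in> space M. itin T q n x = w} x)"
    by (intro Bochner_Integration.integral_cong refl eq)
  also have "\<dots> = (\<Sum>w\<in>?Ws. expectation (\<lambda>x. g w * indicat_real {x \<in> space M. itin T q n x = w} x))"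
    by (intro Bochner_Integration.integral_sum int)
  also have "\<dots> = (\<Sum>w\<in>?Ws. wp q w * g w)"
    using itin_sets_eq[OF q] by (intro sum.cong) (auto simp: wp_def words_def)
  finally show "expectation (\<lambda>x. g (itin T q n x)) = (\<Sum>w\<in>?Ws. wp q w * g w)" .
qed

lemma AE_wp_pos:
  assumes q: "labelling M q" and L: "finite (q ` space M)"
  shows "AE x in M. wp q (itin T q n x) > 0"
proof -
  have "AE x in M. \<forall>w\<in>words (q ` space M) n. itin T q n x = w \<longrightarrow> wp q w > 0"
  proof (rule AE_finite_allI)
    fix w assume w: "w \<in> words (q ` space M) n"
    show "AE x in M. itin T q n x = w \<longrightarrow> wp q w > 0"
    proof (cases "wp q w > 0")
      case False
      then have "wp q w = 0" using wp_nonneg[of q w] by linarith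
      then have "prob {x \<in> space M. itin T q n x = w} = 0" using w by (simp add: wp_def words_def)
      then have "AE x in M. x \<notin> {x \<in> space M. itin T q n x = w}"
        using prob_eq_0[OF itin_sets_eq[OF q]] by blast
      then show ?thesis by (rule AE_mp) (auto intro!: AE_I2)
    qed simp
  qed (use L in \<open>simp add: finite_words\<close>)
  then show ?thesis by (rule AE_mp) (use itin_in_words in \<open>auto intro!: AE_I2\<close>)
qed

text \<open>The weight of a word under the \<open>N\<close>-step Markov approximation of the label process, without the
  factor for the final \<open>N\<close> letters.\<close>
primrec markov :: "('a \<Rightarrow> 'b) \<Rightarrow> nat \<Rightarrow> nat \<Rightarrow> 'b list \<Rightarrow> real" where
  "markov q N 0 w = 1"
| "markov q N (Suc n) w = wp q (take (Suc N) w) / wp q (tl (take (Suc N) w)) * markov q N n (tl w)"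

lemma markov_nonneg: "markov q N n w \<ge> 0"
  by (induction n arbitrary: w) auto

text \<open>Summing out the first letter replaces its factor by
  \<open>wp q (take N v) / wp q (take N v)\<close>, which is 1, or 0 when the denominator vanishes.
  What remains in the end is one unit for each choice of the last \<open>N\<close> letters.\<close>

lemma sum_markov:
  assumes q: "labelling M q" and L: "finite (q ` space M)"
  shows "(\<Sum>w\<in>words (q ` space M) (n + N). markov q N n w) \<le> real (card (q ` space M)) ^ N"
proof (induction n)
  case 0
  show ?case by (simp add: card_words[OF L])
next
  case (Suc n)
  let ?L = "q ` space M"
  have "(\<Sum>w\<in>words ?L (Suc n + N). markov q N (Suc n) w)
      = (\<Sum>a\<in>?L. \<Sum>v\<in>words ?L (n + N). wp q (a # take N v) / wp q (take N v) * markov q N n v)"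
    by (simp add: sum_words_Suc)
  also have "\<dots> = (\<Sum>v\<in>words ?L (n + N). \<Sum>a\<in>?L. wp q (a # take N v) / wp q (take N v) * markov q N n v)"
    by (rule sum.swap)
  also have "\<dots> = (\<Sum>v\<in>words ?L (n + N). wp q (take N v) / wp q (take N v) * markov q N n v)"
    by (simp only: sum_distrib_right[symmetric] sum_divide_distrib[symmetric] sum_wp_Cons[OF q L])
  also have "\<dots> \<le> (\<Sum>v\<in>words ?L (n + N). markov q N n v)"
    by (intro sum_mono) (auto simp: markov_nonneg)
  finally show ?case using Suc by simp
qed

text \<open>Along an orbit the product of conditional weights is the exponential of a Birkhoff sum
  of conditional information; positivity of the weights makes the logarithms faithful.\<close>

lemma markov_itin:
  assumes "\<And>j. wp q (itin T q (Suc N) ((T ^^ j) x)) > 0" "\<And>j. wp q (itin T q N ((T ^^ Suc j) x)) > 0"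
  shows "markov q N n (itin T q (n + N) x)
       = exp (- (\<Sum>j<n. ln (wp q (itin T q N ((T ^^ Suc j) x))) - ln (wp q (itin T q (Suc N) ((T ^^ j) x)))))"
  using assms
proof (induction n arbitrary: x)
  case (Suc n)
  have p: "wp q (itin T q (Suc N) x) > 0" "wp q (itin T q N (T x)) > 0"
    using Suc.prems(1)[of 0] Suc.prems(2)[of 0] by auto
  have sh: "(T ^^ j) (T x) = (T ^^ Suc j) x" for j by (simp add: funpow_swap1)
  have IH: "markov q N n (itin T q (n + N) (T x))
       = exp (- (\<Sum>j<n. ln (wp q (itin T q N ((T ^^ Suc (Suc j)) x))) - ln (wp q (itin T q (Suc N) ((T ^^ Suc j) x)))))"
    using Suc.IH[of "T x"] Suc.prems(1)[of "Suc _"] Suc.prems(2)[of "Suc _"] by (simp only: sh)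
  have tk: "take (Suc N) (itin T q (Suc n + N) x) = itin T q (Suc N) x"
    by (rule take_itin) simp
  have "markov q N (Suc n) (itin T q (Suc n + N) x)
      = wp q (itin T q (Suc N) x) / wp q (itin T q N (T x)) * markov q N n (itin T q (n + N) (T x))"
    unfolding markov.simps tk by simp
  also have "wp q (itin T q (Suc N) x) / wp q (itin T q N (T x))
      = exp (ln (wp q (itin T q (Suc N) x)) - ln (wp q (itin T q N (T x))))"
    using p by (simp add: exp_diff)
  finally show ?case
    unfolding IH sum.lessThan_Suc_shift by (simp add: exp_add[symmetric] exp_diff exp_minus field_simps del: itin.simps)
qed simp

lemma word_entropy_eq_expectation:
  assumes q: "labelling M q" and L: "finite (q ` space M)"
  shows "expectation (\<lambda>x. - ln (wp q (itin T q n x))) = word_entropy q n"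
  unfolding word_entropy_def expectation_itin(2)[OF q L, of "\<lambda>w. - ln (wp q w)"] by simp

end

text \<open>The conditional information of a letter given the next \<open>N\<close> has the entropy
  increment as its mean. By the weak law most orbits have Markov weight at least
  \<open>exp (- (c' * n))\<close>, and since the weights have a bounded sum, only about
  \<open>exp (c' * n)\<close> words can be that heavy.\<close>

lemma (in mixing_pmp) upper_rate_of_increment:
  assumes q: "labelling M q" and L: "finite (q ` space M)"
    and c: "word_entropy q (Suc N) - word_entropy q N < c"
  shows "upper_rate q c"
  unfolding upper_rate_def
proof (intro allI impI)
  fix \<delta> :: real assume \<delta>: "\<delta> > 0"
  define h where "h = word_entropy q (Suc N) - word_entropy q N"
  define c' where "c' = (h + c) / 2"
  have c': "h < c'" "c' < c" using c by (auto simp: c'_def h_def)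
  let ?L = "q ` space M"
  \<comment> \<open>Its mean is the increment because, by invariance, \<open>T x\<close> can be
    replaced by \<open>x\<close> in the first term.\<close>
  define f where "f x = ln (wp q (itin T q N (T x))) - ln (wp q (itin T q (Suc N) x))" for x
  have f_alt: "f x = (\<lambda>w. ln (wp q (tl w)) - ln (wp q w)) (itin T q (Suc N) x)" for x
    by (simp add: f_def)
  have f_meas[measurable]: "f \<in> borel_measurable M"
    unfolding f_alt by (rule labelling_borel[OF labelling_itin[OF q]])
  have "f ` space M \<subseteq> (\<lambda>w. ln (wp q (tl w)) - ln (wp q w)) ` words ?L (Suc N)"
    unfolding f_alt using itin_in_words by blast
  then have f_fin: "finite (f ` space M)" using finite_words[OF L] by (meson finite_imageI finite_subset)
  have bm: "(\<lambda>x. ln (wp q (itin T q N x))) \<in> borel_measurable M"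
    by (rule labelling_borel[OF labelling_itin[OF q]])
  have i1: "integrable M (\<lambda>x. ln (wp q (itin T q n x)))" for n
    by (rule expectation_itin(1)[OF q L])
  have e1: "expectation (\<lambda>x. ln (wp q (itin T q n x))) = - word_entropy q n" for n
    using word_entropy_eq_expectation[OF q L, of n] by simp
  have i2: "integrable M (\<lambda>x. ln (wp q (itin T q N (T x))))"
    using integrable_Tn[OF i1[of N], of 1] by simp
  have e2: "expectation (\<lambda>x. ln (wp q (itin T q N (T x)))) = - word_entropy q N"
    using integral_Tn[OF bm, of 1] e1[of N] by simp
  have Ef: "expectation f = h"
    unfolding f_def using i1[of "Suc N"] i2 e1[of "Suc N"] e2 by (simp add: h_def del: itin.simps)
  have ev1: "\<forall>\<^sub>F n in sequentially. prob {x \<in> space M. (\<Sum>j<n. f ((T ^^ j) x)) \<ge> c' * real n} < \<delta>"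
    using birkhoff_simple[OF f_meas f_fin _ \<delta>] Ef c' by simp
  have Lpos: "card ?L > 0" using L not_empty by (simp add: card_gt_0_iff)
  \<comment> \<open>From \<open>n0\<close> on, the gap between \<open>c'\<close> and
    \<open>c\<close> absorbs the factor \<open>card ?L ^ N\<close> and the difference between the
    lengths \<open>n\<close> and \<open>n + N\<close>.\<close>
  obtain n0 :: nat where n0: "real n0 * (c - c') > N * ln (card ?L) - N * c"
    using c' ex_less_of_nat_mult by (metis diff_gt_0_iff_gt)
  have ev2: "\<forall>\<^sub>F n in sequentially. real n * (c - c') > N * ln (card ?L) - N * c"
    using eventually_ge_at_top[of n0]
  proof eventually_elim
    case (elim n)
    have "real n0 * (c - c') \<le> real n * (c - c')" using elim c' by (intro mult_right_mono) auto
    then show ?case using n0 by linarith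
  qed
  have "\<forall>\<^sub>F n in sequentially. \<exists>W. finite W \<and> real (card W) \<le> exp (real (n + N) * c) \<and>
     prob {x \<in> space M. itin T q (n + N) x \<notin> W} \<le> \<delta>"
    using ev1 ev2
  proof eventually_elim
    case (elim n)
    define W where "W = {w \<in> words ?L (n + N). markov q N n w \<ge> exp (- (c' * n))}"
    have W: "finite W" unfolding W_def using finite_words[OF L] by simp
    have "card W * exp (- (c' * n)) \<le> (\<Sum>w\<in>W. markov q N n w)"
      using sum_bounded_below[of W "exp (- (c' * n))"] by (auto simp: W_def)
    also have "\<dots> \<le> (\<Sum>w\<in>words ?L (n + N). markov q N n w)"
      using finite_words[OF L] by (intro sum_mono2) (auto simp: W_def markov_nonneg)
    also have "\<dots> \<le> real (card ?L) ^ N" by (rule sum_markov[OF q L])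
    also have "\<dots> = exp (N * ln (card ?L))" using Lpos by (simp add: exp_of_nat_mult)
    finally have "card W \<le> exp (N * ln (card ?L)) * exp (c' * n)"
      by (simp add: exp_minus field_simps)
    also have "\<dots> = exp (N * ln (card ?L) + c' * n)" by (simp add: exp_add)
    also have "\<dots> \<le> exp (real (n + N) * c)" using elim(2) by (simp add: algebra_simps)
    finally have cardW: "card W \<le> exp (real (n + N) * c)" .
    have wpos: "AE x in M. \<forall>j. wp q (itin T q k ((T ^^ j) x)) > 0" for k
      by (rule AE_all_Tn[OF AE_wp_pos[OF q L]])
    have ae: "AE x in M. x \<in> {x \<in> space M. itin T q (n + N) x \<notin> W} \<longrightarrow> x \<in> {x \<in> space M. (\<Sum>j<n. f ((T ^^ j) x)) \<ge> c' * real n}"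
      using wpos[of N] wpos[of "Suc N"] AE_space
    proof eventually_elim
      case (elim x)
      have eq: "markov q N n (itin T q (n + N) x) = exp (- (\<Sum>j<n. f ((T ^^ j) x)))"
        by (subst markov_itin[OF elim(2)[rule_format] elim(1)[rule_format]]) (simp add: f_def del: itin.simps)
      have "\<not> exp (- (c' * n)) \<le> markov q N n (itin T q (n + N) x)" if "itin T q (n + N) x \<notin> W"
        using that itin_in_words[OF elim(3)] by (auto simp: W_def)
      then show ?case using elim(3) unfolding eq by auto
    qed
    have fm: "(\<lambda>x. \<Sum>j<n. f ((T ^^ j) x)) \<in> borel_measurable M"
      by (intro borel_measurable_sum measurable_compose[OF Tn_meas f_meas])
    have "prob {x \<in> space M. itin T q (n + N) x \<notin> W} \<le> prob {x \<in> space M. (\<Sum>j<n. f ((T ^^ j) x)) \<ge> c' * real n}"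
      using fm by (intro finite_measure_mono_AE ae) measurable
    then show ?case using elim(1) W cardW by auto
  qed
  then show "\<forall>\<^sub>F n in sequentially. \<exists>W. finite W \<and> real (card W) \<le> exp (real n * c) \<and>
     prob {x \<in> space M. itin T q n x \<notin> W} \<le> \<delta>"
    by (subst (asm) eventually_sequentially_seg)
qed

context pmp begin

text \<open>Mass \<open>sW\<close> on at most \<open>exp (n * c)\<close> words contributes only
  about \<open>sW * n * c\<close> to an entropy of at least \<open>n * h\<close>. The remaining mass
  lies mostly on about \<open>exp (n * h)\<close> words and cannot make up the deficit unless
  \<open>sW\<close> is small.\<close>

lemma lower_rate_of_entropy:
  assumes q: "labelling M q" and L: "finite (q ` space M)"
    and up: "\<And>c'. c' > h \<Longrightarrow> upper_rate q c'" and H: "\<And>n. real n * h \<le> word_entropy q n"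
    and h: "h \<ge> 0" and c: "c < h"
  shows "lower_rate q c"
  unfolding lower_rate_def
proof (intro allI impI)
  fix \<delta> :: real assume \<delta>: "\<delta> > 0"
  let ?L = "q ` space M"
  have Lpos: "card ?L > 0" using L not_empty by (simp add: card_gt_0_iff)
  define K where "K = ln (card ?L)"
  have K: "K \<ge> 0" using Lpos by (simp add: K_def)
  define d where "d = h - c"
  have d: "d > 0" using c by (simp add: d_def)
  \<comment> \<open>Three errors of at most \<open>\<delta> * d / 4\<close> each will arise: the
    excess of \<open>c'\<close> over \<open>h\<close>, the entropy of the atypical words, and the
    additive constants of the three entropy bounds divided by \<open>n\<close>. The 1 added to
    \<open>K\<close> in \<open>\<delta>'\<close> covers a one-letter alphabet, where
    \<open>K = 0\<close>.\<close>
  define c' where "c' = h + \<delta> * d / 4"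
  have c'h: "c' > h" using \<delta> d by (simp add: c'_def)
  define \<delta>' where "\<delta>' = \<delta> * d / (4 * (K + 1))"
  have \<delta>': "\<delta>' > 0" using \<delta> d K by (simp add: \<delta>'_def)
  have \<delta>'K: "\<delta>' * K \<le> \<delta> * d / 4"
  proof -
    have "\<delta>' * K \<le> \<delta>' * (K + 1)" using \<delta>' by (intro mult_left_mono) auto
    also have "\<dots> = \<delta> * d / 4" using K by (simp add: \<delta>'_def divide_simps)
    finally show ?thesis .
  qed
  obtain n0 :: nat where n0: "real n0 * (\<delta> * d / 4) > 3"
    using \<delta> d ex_less_of_nat_mult[of "\<delta> * d / 4" 3] by auto
  have "\<forall>\<^sub>F n in sequentially. \<exists>W. finite W \<and> real (card W) \<le> exp (real n * c') \<and>
     prob {x \<in> space M. itin T q n x \<notin> W} \<le> \<delta>'"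
    using up[OF c'h] \<delta>' unfolding upper_rate_def by blast
  then show "\<forall>\<^sub>F n in sequentially. \<forall>W. finite W \<and> real (card W) \<le> exp (real n * c) \<longrightarrow>
     prob {x \<in> space M. itin T q n x \<in> W} \<le> \<delta>"
    using eventually_ge_at_top[of n0] eventually_gt_at_top[of 0]
  proof eventually_elim
    case (elim n)
    obtain G where G: "finite G" "card G \<le> exp (real n * c')" "prob {x \<in> space M. itin T q n x \<notin> G} \<le> \<delta>'"
      using elim(1) by blast
    show ?case
    proof (intro allI impI)
      fix W :: "'b list set" assume W: "finite W \<and> real (card W) \<le> exp (real n * c)"
      let ?A = "words ?L n"
      let ?W = "W \<inter> ?A" and ?G = "(G - W) \<inter> ?A" and ?R = "?A - W - G"
      have fin: "finite ?A" by (rule finite_words[OF L])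
      have pr: "prob {x \<in> space M. itin T q n x \<in> V} = (\<Sum>w\<in>V \<inter> ?A. wp q w)" for V
      proof -
        have "{x \<in> space M. itin T q n x \<in> V} = {x \<in> space M. itin T q n x \<in> V \<inter> ?A}"
          using itin_in_words by auto
        then show ?thesis using fin by (simp only:) (intro prob_itin_sum[OF q], auto simp: words_def)
      qed
      define sW where "sW = (\<Sum>w\<in>?W. wp q w)"
      define sG where "sG = (\<Sum>w\<in>?G. wp q w)"
      define sR where "sR = (\<Sum>w\<in>?R. wp q w)"
      have split: "(\<Sum>w\<in>?A. g w) = (\<Sum>w\<in>?W. g w) + (\<Sum>w\<in>?G. g w) + (\<Sum>w\<in>?R. g w)" for g :: "'b list \<Rightarrow> real"
      proof -
        have "?A = ?W \<union> (?G \<union> ?R)" by auto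
        then have "sum g ?A = sum g (?W \<union> (?G \<union> ?R))" by simp
        also have "\<dots> = sum g ?W + sum g (?G \<union> ?R)" using fin by (intro sum.union_disjoint) auto
        also have "sum g (?G \<union> ?R) = sum g ?G + sum g ?R" using fin by (intro sum.union_disjoint) auto
        finally show ?thesis by simp
      qed
      have tot: "sW + sG + sR = 1"
        using pr[of UNIV] split[of "wp q"] prob_space by (simp add: sW_def sG_def sR_def)
      have nn: "sW \<ge> 0" "sG \<ge> 0" "sR \<ge> 0" by (auto simp: sW_def sG_def sR_def sum_nonneg)
      have sR: "sR \<le> \<delta>'"
      proof -
        have "sR \<le> (\<Sum>w\<in>- G \<inter> ?A. wp q w)" unfolding sR_def using fin by (intro sum_mono2) auto
        also have "\<dots> = prob {x \<in> space M. itin T q n x \<notin> G}" using pr[of "- G"] by simp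
        finally show ?thesis using G by simp
      qed
      have cW: "card ?W \<le> exp (real n * c)"
        using W card_mono[of W ?W] by (meson Int_lower1 of_nat_mono order_trans)
      have cG: "card ?G \<le> exp (real n * c')"
        using G card_mono[of G ?G] by (meson Diff_subset Int_lower1 of_nat_mono order_trans)
      have "real (card ?R) \<le> real (card ?A)" using card_mono[OF fin, of ?R] by auto
      also have "\<dots> = exp (real n * K)" using Lpos by (simp add: card_words[OF L] K_def exp_of_nat_mult)
      finally have cR: "card ?R \<le> exp (real n * K)" .
      have "real n * h \<le> word_entropy q n" by (rule H)
      also have "\<dots> \<le> (sW * (n * c) + 1) + (sG * (n * c') + 1) + (sR * (n * K) + 1)"
        unfolding word_entropy_def split sW_def sG_def sR_def
        by (intro add_mono entropy_sum_le cW cG cR) auto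
      finally have 1: "real n * h \<le> n * (sW * c + sG * c' + sR * K) + 3" by (simp add: algebra_simps)
      have 2: "3 \<le> n * (\<delta> * d / 4)"
      proof -
        have "real n0 * (\<delta> * d / 4) \<le> real n * (\<delta> * d / 4)" using elim \<delta> d by (intro mult_right_mono) auto
        then show ?thesis using n0 by linarith
      qed
      have "real n * h \<le> n * (sW * c + sG * c' + sR * K + \<delta> * d / 4)"
        using 1 2 by (simp add: algebra_simps)
      then have 3: "h \<le> sW * c + sG * c' + sR * K + \<delta> * d / 4"
        using elim(3) by simp
      have "sG * c' \<le> (1 - sW) * c'" using tot nn h c'h by (intro mult_right_mono) auto
      moreover have "sR * K \<le> \<delta> * d / 4" using sR K \<delta>'K by (meson mult_right_mono order_trans)
      ultimately have 4: "h \<le> sW * c + (1 - sW) * c' + \<delta> * d / 2" using 3 by simp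
      have "sW * d \<le> sW * (c' - c)" using nn c'h by (intro mult_left_mono) (auto simp: d_def)
      also have "\<dots> \<le> c' - h + \<delta> * d / 2" using 4 by (simp add: algebra_simps)
      also have "\<dots> \<le> \<delta> * d" using \<delta> d by (simp add: c'_def)
      finally have "sW \<le> \<delta>" using d by simp
      then show "prob {x \<in> space M. itin T q n x \<in> W} \<le> \<delta>" unfolding pr sW_def .
    qed
  qed
qed

end

section \<open>Refining the labels\<close>

text \<open>The likelihood of the output \<open>s\<close> for the input \<open>r\<close> of a
  memoryless channel with transition weights \<open>w\<close>.\<close>

primrec path_weight :: "('b \<Rightarrow> 'c \<Rightarrow> real) \<Rightarrow> 'b list \<Rightarrow> 'c list \<Rightarrow> real" where
  "path_weight w [] s = 1"
| "path_weight w (a # r) s = w a (hd s) * path_weight w r (tl s)"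

lemma path_weight_nonneg: "(\<And>a b. w a b \<ge> 0) \<Longrightarrow> path_weight w r s \<ge> 0"
  by (induction r arbitrary: s) auto

text \<open>The weights factor over the letters. The output alphabet may be infinite, hence the
  formulation with finite sets \<open>V\<close>.\<close>

lemma sum_path_weight:
  assumes w0: "\<And>a b. w a b \<ge> 0" and w1: "\<And>a F. finite F \<Longrightarrow> (\<Sum>b\<in>F. w a b) \<le> 1"
  shows "finite V \<Longrightarrow> V \<subseteq> {s. length s = length r} \<Longrightarrow> (\<Sum>s\<in>V. path_weight w r s) \<le> 1"
proof (induction r arbitrary: V)
  case Nil
  then have "V \<subseteq> {[]}" by auto
  then have "V = {} \<or> V = {[]}" by blast
  then show ?case by auto
next
  case (Cons a r)
  let ?F = "hd ` V" and ?V = "tl ` V"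
  have fin: "finite ?F" "finite ?V" using Cons.prems by auto
  have IH: "(\<Sum>s\<in>?V. path_weight w r s) \<le> 1" using Cons.prems by (intro Cons.IH) auto
  \<comment> \<open>Enlarging \<open>V\<close> to the product of its first letters and its tails
    makes the sum factor.\<close>
  have sub: "V \<subseteq> (\<lambda>(b, s). b # s) ` (?F \<times> ?V)"
  proof
    fix s assume s: "s \<in> V"
    then have "s = hd s # tl s" using Cons.prems(2) by (cases s) auto
    then show "s \<in> (\<lambda>(b, s). b # s) ` (?F \<times> ?V)" using s by (auto intro!: image_eqI[of _ _ "(hd s, tl s)"])
  qed
  have "(\<Sum>s\<in>V. path_weight w (a # r) s) \<le> (\<Sum>s\<in>(\<lambda>(b, s). b # s) ` (?F \<times> ?V). path_weight w (a # r) s)"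
    using sub fin w0 path_weight_nonneg[of w, OF w0] by (intro sum_mono2) (auto simp del: path_weight.simps)
  also have "\<dots> = (\<Sum>(b, s)\<in>?F \<times> ?V. w a b * path_weight w r s)"
    by (subst sum.reindex) (auto simp: inj_on_def intro!: sum.cong)
  also have "\<dots> = (\<Sum>b\<in>?F. w a b) * (\<Sum>s\<in>?V. path_weight w r s)"
    by (simp add: sum_product sum.cartesian_product)
  also have "\<dots> \<le> 1 * 1" using IH w1[OF fin(1)] path_weight_nonneg[of w, OF w0] w0
    by (intro mult_mono) (auto intro: sum_nonneg)
  finally show ?case by simp
qed

text \<open>Weights of at least \<open>exp (- t)\<close> with sum at most 1 leave room for
  \<open>exp t\<close> words. Finiteness is part of the conclusion: an infinite set would contain
  finite subsets that are too large.\<close>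

lemma card_path_weight_ge:
  assumes w0: "\<And>a b. w a b \<ge> 0" and w1: "\<And>a F. finite F \<Longrightarrow> (\<Sum>b\<in>F. w a b) \<le> 1"
    and V: "V \<subseteq> {s. length s = length r}" "\<And>s. s \<in> V \<Longrightarrow> path_weight w r s \<ge> exp (- t)"
  shows "finite V \<and> real (card V) \<le> exp t"
proof -
  have *: "real (card F) \<le> exp t" if F: "finite F" "F \<subseteq> V" for F
  proof -
    have "card F * exp (- t) \<le> (\<Sum>s\<in>F. path_weight w r s)"
      using sum_bounded_below[of F "exp (- t)"] V(2) F by auto
    also have "\<dots> \<le> 1" using F V(1) by (intro sum_path_weight w0 w1) auto
    finally show ?thesis by (simp add: exp_minus field_simps)
  qed
  have "finite V"
  proof (rule ccontr)
    assume "infinite V"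
    then obtain F where F: "finite F" "F \<subseteq> V" "card F = Suc (nat \<lceil>exp t\<rceil>)"
      using infinite_arbitrarily_large by metis
    then show False using *[OF F(1,2)] by linarith
  qed
  then show ?thesis using * by auto
qed

context pmp begin

text \<open>Conditional weights \<open>w\<close> of the label \<open>S\<close> given the label \<open>R\<close>, of average information at most \<open>\<eta>\<close>.\<close>
definition cond_code :: "('a \<Rightarrow> 'b) \<Rightarrow> ('a \<Rightarrow> 'c) \<Rightarrow> ('b \<Rightarrow> 'c \<Rightarrow> real) \<Rightarrow> real \<Rightarrow> bool" where
  "cond_code R S w \<eta> \<longleftrightarrow> (\<forall>r s. w r s \<ge> 0) \<and> (\<forall>r F. finite F \<longrightarrow> (\<Sum>s\<in>F. w r s) \<le> 1) \<and>
     (AE x in M. w (R x) (S x) > 0) \<and> integrable M (\<lambda>x. - ln (w (R x) (S x))) \<and>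
     expectation (\<lambda>x. - ln (w (R x) (S x))) \<le> \<eta>"

text \<open>By invariance the Birkhoff sum of the conditional information has mean at most
  \<open>n * \<eta>\<close>. Markov's inequality keeps it below \<open>n * \<delta>\<close> off a
  set of measure \<open>\<eta> / \<delta>\<close>, where the outputs are heavy enough to be counted.
  The bound on the exceptional set is the same for all \<open>n\<close>.\<close>

lemma cond_code_count:
  assumes R: "labelling M R" and S: "labelling M S" and code: "cond_code R S w \<eta>"
    and \<delta>: "\<delta> > 0" and n: "n > 0"
  shows "\<exists>G\<in>sets M. prob (space M - G) \<le> \<eta> / \<delta> \<and>
    (\<forall>r. finite {itin T S n x | x. x \<in> G \<and> itin T R n x = r} \<and>
         real (card {itin T S n x | x. x \<in> G \<and> itin T R n x = r}) \<le> exp (real n * \<delta>))"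
proof -
  have w0: "w r s \<ge> 0" for r s using code by (simp add: cond_code_def)
  have w1: "(\<Sum>s\<in>F. w r s) \<le> 1" if "finite F" for r F using code that by (simp add: cond_code_def)
  have w_le1: "w r s \<le> 1" for r s using w1[of "{s}" r] by simp
  define f where "f x = - ln (w (R x) (S x))" for x
  have f_alt: "f x = (\<lambda>(r, s). - ln (w r s)) (R x, S x)" for x by (simp add: f_def)
  have f_meas[measurable]: "f \<in> borel_measurable M"
    unfolding f_alt by (rule labelling_borel[OF labelling_pair[OF R S]])
  have f0: "f x \<ge> 0" for x
    using w0[of "R x" "S x"] w_le1[of "R x" "S x"] unfolding f_def
    by (cases "w (R x) (S x) = 0") (auto intro!: ln_ge_zero simp: ln_le_zero_iff)
  have f_int: "integrable M f" using code unfolding cond_code_def f_def by blast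
  have Ef: "expectation f \<le> \<eta>" using code unfolding cond_code_def f_def by blast
  have AE0: "AE x in M. \<forall>j. w (R ((T ^^ j) x)) (S ((T ^^ j) x)) > 0"
    using code by (intro AE_all_Tn) (simp add: cond_code_def)
  \<comment> \<open>As \<open>ln 0 = 0\<close>, a vanishing weight would pass for zero information;
    such orbits have to be removed explicitly.\<close>
  define P where "P = {x \<in> space M. \<forall>j<n. w (R ((T ^^ j) x)) (S ((T ^^ j) x)) > 0}"
  have P: "P \<in> sets M"
  proof -
    have "(\<lambda>x. w (R x) (S x)) \<in> borel_measurable M"
      using labelling_borel[OF labelling_pair[OF R S], of "\<lambda>(r, s). w r s"] by simp
    then have "(\<lambda>x. w (R ((T ^^ j) x)) (S ((T ^^ j) x))) \<in> borel_measurable M" for j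
      by (rule measurable_compose[OF Tn_meas])
    then show ?thesis unfolding P_def by measurable
  qed
  define F where "F x = (\<Sum>j<n. f ((T ^^ j) x))" for x
  have F_meas[measurable]: "F \<in> borel_measurable M" unfolding F_def by measurable
  have F_int: "integrable M F" unfolding F_def by (intro Bochner_Integration.integrable_sum integrable_Tn f_int)
  have EF: "expectation F = n * expectation f"
    unfolding F_def by (subst Bochner_Integration.integral_sum) (auto intro: integrable_Tn f_int simp: integral_Tn)
  define G where "G = {x \<in> P. F x < n * \<delta>}"
  have G: "G \<in> sets M"
  proof -
    have "G = P \<inter> {x \<in> space M. F x < n * \<delta>}" by (auto simp: G_def P_def)
    also have "\<dots> \<in> sets M" using P by measurable
    finally show ?thesis .
  qed
  have "prob (space M - G) \<le> prob {x \<in> space M. F x \<ge> n * \<delta>}"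
  proof (rule finite_measure_mono_AE)
    show "AE x in M. x \<in> space M - G \<longrightarrow> x \<in> {x \<in> space M. F x \<ge> n * \<delta>}"
      using AE0 AE_space by eventually_elim (auto simp: G_def P_def)
  qed measurable
  also have "\<dots> \<le> expectation F / (n * \<delta>)"
  proof -
    have "prob {x \<in> space M. F x \<ge> n * \<delta>} \<le> (\<integral>x. F x \<partial>M) / (n * \<delta>)"
      by (rule integral_Markov_inequality_measure[OF F_int sets.empty_sets])
         (use f0 \<delta> n in \<open>auto simp: F_def sum_nonneg\<close>)
    then show ?thesis .
  qed
  also have "\<dots> = expectation f / \<delta>" using n by (simp add: EF)
  also have "\<dots> \<le> \<eta> / \<delta>" using Ef \<delta> by (intro divide_right_mono) auto
  finally have pG: "prob (space M - G) \<le> \<eta> / \<delta>" .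
  have pw: "path_weight w (itin T R m x) (itin T S m x) = exp (- (\<Sum>j<m. f ((T ^^ j) x)))"
    if "\<forall>j<m. w (R ((T ^^ j) x)) (S ((T ^^ j) x)) > 0" for m x
    using that
  proof (induction m arbitrary: x)
    case (Suc m)
    have 0: "w (R x) (S x) > 0" using Suc.prems by (metis funpow_0 zero_less_Suc)
    have "\<forall>j<m. w (R ((T ^^ j) (T x))) (S ((T ^^ j) (T x))) > 0"
      using Suc.prems by (metis Suc_less_eq comp_apply funpow_Suc_right)
    from Suc.IH[OF this] show ?case
      unfolding sum.lessThan_Suc_shift using 0 by (simp add: exp_add exp_diff exp_minus f_def funpow_swap1 field_simps)
  qed simp
  have cnt: "finite {itin T S n x | x. x \<in> G \<and> itin T R n x = r} \<and>
         real (card {itin T S n x | x. x \<in> G \<and> itin T R n x = r}) \<le> exp (real n * \<delta>)" for r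
  proof (cases "length r = n")
    case True
    show ?thesis
    proof (rule card_path_weight_ge[OF w0 w1])
      show "{itin T S n x | x. x \<in> G \<and> itin T R n x = r} \<subseteq> {s. length s = length r}" using True by auto
    next
      fix s assume "s \<in> {itin T S n x | x. x \<in> G \<and> itin T R n x = r}"
      then obtain x where x: "x \<in> G" "r = itin T R n x" "s = itin T S n x" by blast
      have "path_weight w r s = exp (- F x)" unfolding x F_def using x(1) by (intro pw) (auto simp: G_def P_def)
      then show "exp (- (real n * \<delta>)) \<le> path_weight w r s" using x(1) by (simp add: G_def)
    qed auto
  next
    case False
    then have none: "{itin T S n x | x. x \<in> G \<and> itin T R n x = r} = {}" by auto
    show ?thesis unfolding none by simp
  qed
  show ?thesis using G pG cnt by blast
qed

text \<open>Few typical words of \<open>R\<close>, each accompanied by at most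
  \<open>exp (n * d)\<close> words of \<open>S\<close>, give few words of \<open>S\<close>. The
  choice \<open>\<eta> = \<delta> * d / 2\<close> limits the exceptional set to measure
  \<open>\<delta> / 2\<close>; \<open>R\<close> may vary with \<open>\<eta>\<close>, but its rate
  \<open>c\<close> may not.\<close>

lemma upper_rate_refine:
  assumes S: "labelling M S" and c: "c < c'"
    and code: "\<And>\<eta>. \<eta> > 0 \<Longrightarrow> \<exists>(R :: 'a \<Rightarrow> 'b) w. labelling M R \<and> upper_rate R c \<and> cond_code R S w \<eta>"
  shows "upper_rate S c'"
  unfolding upper_rate_def
proof (intro allI impI)
  fix \<delta> :: real assume \<delta>: "\<delta> > 0"
  define d where "d = c' - c"
  have d: "d > 0" using c by (simp add: d_def)
  obtain R :: "'a \<Rightarrow> 'b" and w where R: "labelling M R" "upper_rate R c" "cond_code R S w (\<delta> * d / 2)"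
    using code[of "\<delta> * d / 2"] \<delta> d by auto
  have "\<forall>\<^sub>F n in sequentially. \<exists>W. finite W \<and> real (card W) \<le> exp (real n * c) \<and>
     prob {x \<in> space M. itin T R n x \<notin> W} \<le> \<delta> / 2"
    using R(2)[unfolded upper_rate_def, rule_format, of "\<delta> / 2"] \<delta> by simp
  then show "\<forall>\<^sub>F n in sequentially. \<exists>W. finite W \<and> real (card W) \<le> exp (real n * c') \<and>
     prob {x \<in> space M. itin T S n x \<notin> W} \<le> \<delta>"
    using eventually_gt_at_top[of 0]
  proof eventually_elim
    case (elim n)
    obtain V where V: "finite V" "card V \<le> exp (real n * c)" "prob {x \<in> space M. itin T R n x \<notin> V} \<le> \<delta> / 2"
      using elim(1) by blast
    define A where "A G r = {itin T S n x | x. x \<in> G \<and> itin T R n x = r}" for G r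
    obtain G where G: "G \<in> sets M" "prob (space M - G) \<le> \<delta> * d / 2 / d"
        "\<And>r. finite (A G r)" "\<And>r. card (A G r) \<le> exp (real n * d)"
      using cond_code_count[OF R(1) S R(3) d elim(2)] unfolding A_def by blast
    define W where "W = (\<Union>r\<in>V. A G r)"
    have W: "finite W" using V G by (auto simp: W_def)
    have "real (card W) \<le> (\<Sum>r\<in>V. real (card (A G r)))"
      unfolding W_def of_nat_sum[symmetric] of_nat_le_iff by (rule card_UN_le[OF V(1)])
    also have "\<dots> \<le> (\<Sum>r\<in>V. exp (real n * d))" by (intro sum_mono G)
    also have "\<dots> \<le> exp (real n * c) * exp (real n * d)" using V by simp
    also have "\<dots> = exp (real n * c')" by (simp add: d_def exp_add[symmetric] algebra_simps)
    finally have cW: "card W \<le> exp (real n * c')" .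
    have ms: "{x \<in> space M. itin T R n x \<notin> V} \<in> sets M" using itin_sets[OF R(1), of n "- V"] by simp
    have "prob {x \<in> space M. itin T S n x \<notin> W} \<le> prob ({x \<in> space M. itin T R n x \<notin> V} \<union> (space M - G))"
      using ms G by (intro finite_measure_mono) (auto simp: W_def A_def)
    also have "\<dots> \<le> prob {x \<in> space M. itin T R n x \<notin> V} + prob (space M - G)"
      using ms G by (intro measure_Un_le) auto
    also have "\<dots> \<le> \<delta>" using V G d by simp
    finally show ?case using W cW by blast
  qed
qed

text \<open>A small set of words of \<open>P\<close> determines a small set of words of the block
  label \<open>R\<close>, and these allow only a small set of words of \<open>S\<close>, which has
  little mass by assumption.\<close>

lemma lower_rate_refine:
  assumes S: "labelling M S" and P: "labelling M P" and c: "c' < c" and low: "lower_rate S c"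
    and code: "\<And>\<eta>. \<eta> > 0 \<Longrightarrow> \<exists>m (\<psi> :: 'b list \<Rightarrow> 'd) w. cond_code (\<lambda>x. \<psi> (itin T P m x)) S w \<eta>"
  shows "lower_rate P c'"
  unfolding lower_rate_def
proof (intro allI impI)
  fix \<delta> :: real assume \<delta>: "\<delta> > 0"
  \<comment> \<open>One half of the gap pays for the code, the other for the \<open>m\<close> extra
    letters that the blocks need.\<close>
  define d where "d = (c - c') / 2"
  have d: "d > 0" using c by (simp add: d_def)
  obtain m and \<psi> :: "'b list \<Rightarrow> 'd" and w where w: "cond_code (\<lambda>x. \<psi> (itin T P m x)) S w (\<delta> * d / 2)"
    using code[of "\<delta> * d / 2"] \<delta> d by auto
  define R where "R = (\<lambda>x. \<psi> (itin T P m x))"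
  have R: "labelling M R" unfolding R_def by (rule labelling_comp[OF labelling_itin[OF P]])
  \<comment> \<open>Sliding block code: \<open>n\<close> letters of \<open>R\<close> can be read off
    \<open>n + m\<close> letters of \<open>P\<close>.\<close>
  define F where "F n v = map (\<lambda>j. \<psi> (take m (drop j v))) [0..<n]" for n v
  have F: "itin T R n x = F n (itin T P (n + m) x)" for n x
    by (rule nth_equalityI) (auto simp: F_def nth_itin R_def drop_itin take_itin)
  obtain n0 :: nat where n0: "real n0 * d > m * c'"
    using d ex_less_of_nat_mult by blast
  have "\<forall>\<^sub>F n in sequentially. \<forall>W. finite W \<and> real (card W) \<le> exp (real n * c) \<longrightarrow>
     prob {x \<in> space M. itin T S n x \<in> W} \<le> \<delta> / 2"
    using low[unfolded lower_rate_def, rule_format, of "\<delta> / 2"] \<delta> by simp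
  then have "\<forall>\<^sub>F n in sequentially. \<forall>W. finite W \<and> real (card W) \<le> exp (real (n + m) * c') \<longrightarrow>
     prob {x \<in> space M. itin T P (n + m) x \<in> W} \<le> \<delta>"
    using eventually_gt_at_top[of 0] eventually_ge_at_top[of n0]
  proof eventually_elim
    case (elim n)
    define A where "A G r = {itin T S n x | x. x \<in> G \<and> itin T R n x = r}" for G r
    obtain G where G: "G \<in> sets M" "prob (space M - G) \<le> \<delta> * d / 2 / d"
        "\<And>r. finite (A G r)" "\<And>r. card (A G r) \<le> exp (real n * d)"
      using cond_code_count[OF R S w[folded R_def] d elim(2)] unfolding A_def by blast
    show ?case
    proof (intro allI impI)
      fix W :: "'b list set" assume W: "finite W \<and> real (card W) \<le> exp (real (n + m) * c')"
      define V where "V = (\<Union>v\<in>W. A G (F n v))"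
      have V: "finite V" using W G by (auto simp: V_def)
      have "real (card V) \<le> (\<Sum>v\<in>W. real (card (A G (F n v))))"
        unfolding V_def of_nat_sum[symmetric] of_nat_le_iff using W by (intro card_UN_le) simp
      also have "\<dots> \<le> (\<Sum>v\<in>W. exp (real n * d))" by (intro sum_mono G)
      also have "\<dots> \<le> exp (real (n + m) * c') * exp (real n * d)" using W by simp
      also have "\<dots> = exp (real (n + m) * c' + real n * d)" by (simp add: exp_add)
      also have "\<dots> \<le> exp (real n * c)"
      proof -
        have "real n0 * d \<le> real n * d" using elim d by (intro mult_right_mono) auto
        then have "m * c' \<le> real n * d" using n0 by linarith
        moreover have "real n * c = real n * c' + 2 * (real n * d)" by (simp add: d_def field_simps)
        ultimately show ?thesis by (simp add: algebra_simps)
      qed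
      finally have cV: "card V \<le> exp (real n * c)" .
      have ms: "{x \<in> space M. itin T S n x \<in> V} \<in> sets M" by (rule itin_sets[OF S])
      have "prob {x \<in> space M. itin T P (n + m) x \<in> W} \<le> prob ({x \<in> space M. itin T S n x \<in> V} \<union> (space M - G))"
        using ms G by (intro finite_measure_mono) (auto simp: V_def A_def F)
      also have "\<dots> \<le> prob {x \<in> space M. itin T S n x \<in> V} + prob (space M - G)"
        using ms G by (intro measure_Un_le) auto
      also have "\<dots> \<le> \<delta> / 2 + \<delta> / 2" using elim(1) V cV G d by (intro add_mono) auto
      finally show "prob {x \<in> space M. itin T P (n + m) x \<in> W} \<le> \<delta>" by simp
    qed
  qed
  then show "\<forall>\<^sub>F n in sequentially. \<forall>W. finite W \<and> real (card W) \<le> exp (real n * c') \<longrightarrow>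
     prob {x \<in> space M. itin T P n x \<in> W} \<le> \<delta>"
    by (subst (asm) eventually_sequentially_seg)
qed

text \<open>A label \<open>R\<close> that seldom errs about the finite label \<open>S\<close> encodes it by the weight \<open>1 - \<kappa>\<close> on
  agreement and \<open>\<kappa>\<close> spread evenly over the labels.\<close>
lemma cond_code_of_error:
  assumes S: "labelling M S" "finite (S ` space M)" and \<eta>: "\<eta> > 0"
  shows "\<exists>\<epsilon>>0. \<forall>R. labelling M R \<and> prob {x \<in> space M. R x \<noteq> S x} < \<epsilon> \<longrightarrow> (\<exists>w. cond_code R S w \<eta>)"
proof -
  let ?L = "S ` space M"
  have Lpos: "card ?L > 0" using S(2) not_empty by (simp add: card_gt_0_iff)
  \<comment> \<open>With this \<kappa> an agreement costs at most \<open>\<eta> / 2\<close>. A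
    disagreement costs \<open>K\<close>, and an error probability below
    \<open>\<eta> / (2 * (K + 1))\<close> keeps its average cost within the other
    \<open>\<eta> / 2\<close>.\<close>
  define \<kappa> where "\<kappa> = 1 - exp (- min (\<eta> / 2) 1)"
  have \<kappa>: "0 < \<kappa>" "\<kappa> < 1" using \<eta> by (auto simp: \<kappa>_def)
  have ln\<kappa>: "- ln (1 - \<kappa>) \<le> \<eta> / 2" by (simp add: \<kappa>_def)
  define K where "K = - ln (\<kappa> / card ?L)"
  have K: "K \<ge> 0" unfolding K_def using \<kappa> Lpos by (simp add: divide_le_eq ln_le_zero_iff)
  define w where "w r s = (if s = r then 1 - \<kappa> else 0) + (if s \<in> ?L then \<kappa> / card ?L else 0)" for r s
  have w0: "w r s \<ge> 0" for r s using \<kappa> by (simp add: w_def)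
  have w1: "(\<Sum>s\<in>F. w r s) \<le> 1" if F: "finite F" for r F
  proof -
    have "(\<Sum>s\<in>F. w r s) = (if r \<in> F then 1 - \<kappa> else 0) + (\<Sum>s\<in>F. if s \<in> ?L then \<kappa> / card ?L else 0)"
      using F by (simp add: w_def sum.distrib)
    also have "(\<Sum>s\<in>F. if s \<in> ?L then \<kappa> / card ?L else 0) = (\<Sum>s\<in>F \<inter> ?L. \<kappa> / card ?L)"
      by (rule sum.inter_restrict[OF F, symmetric])
    also have "\<dots> \<le> (\<Sum>s\<in>?L. \<kappa> / card ?L)" using S \<kappa> by (intro sum_mono2) auto
    also have "\<dots> = \<kappa>" using Lpos by simp
    finally show ?thesis using \<kappa> by (simp split: if_splits)
  qed
  show ?thesis
  proof (intro exI[of _ "\<eta> / (2 * (K + 1))"] conjI allI impI)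
    show "\<eta> / (2 * (K + 1)) > 0" using \<eta> K by simp
    fix R assume R: "labelling M R \<and> prob {x \<in> space M. R x \<noteq> S x} < \<eta> / (2 * (K + 1))"
    then have RL: "labelling M R" by simp
    define E where "E = {x \<in> space M. R x \<noteq> S x}"
    have E: "E \<in> sets M"
      using labelling_sets[OF labelling_pair[OF RL S(1)], of "{(a, b). a \<noteq> b}"] by (simp add: E_def)
    have pos: "w (R x) (S x) > 0" if "x \<in> space M" for x
      using that \<kappa> Lpos by (auto simp: w_def intro!: add_nonneg_pos divide_pos_pos)
    have wge: "- ln (w (R x) (S x)) \<le> \<eta> / 2 + K * indicat_real E x" if x: "x \<in> space M" for x
    proof (cases "R x = S x")
      case True
      have "1 - \<kappa> \<le> w (R x) (S x)" using True x \<kappa> by (simp add: w_def)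
      then have "ln (1 - \<kappa>) \<le> ln (w (R x) (S x))" using \<kappa> by (intro ln_mono) auto
      then show ?thesis using ln\<kappa> K by (simp add: indicator_def)
    next
      case False
      have "w (R x) (S x) = \<kappa> / card ?L" using False x by (auto simp: w_def)
      then show ?thesis using False x \<eta> by (simp add: K_def E_def)
    qed
    have w_le1: "w r s \<le> 1" for r s using w1[of "{s}" r] by simp
    have nn: "0 \<le> - ln (w (R x) (S x))" if x: "x \<in> space M" for x
      using pos[OF x] w_le1 by (simp add: ln_le_zero_iff)
    have meas: "(\<lambda>x. - ln (w (R x) (S x))) \<in> borel_measurable M"
      using labelling_borel[OF labelling_pair[OF RL S(1)], of "\<lambda>(r, s). - ln (w r s)"] by simp
    have i1: "integrable M (\<lambda>x. \<eta> / 2 + K * indicat_real E x)"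
      using E by (auto intro!: integrable_real_indicator simp: less_top[symmetric])
    have i2: "integrable M (\<lambda>x. - ln (w (R x) (S x)))"
      by (rule Bochner_Integration.integrable_bound[OF i1 meas]) (use nn wge K \<eta> in \<open>auto intro!: AE_I2 order_trans[OF _ abs_ge_self]\<close>)
    have "expectation (\<lambda>x. - ln (w (R x) (S x))) \<le> expectation (\<lambda>x. \<eta> / 2 + K * indicat_real E x)"
      by (intro integral_mono i1 i2 wge)
    also have "\<dots> = \<eta> / 2 + K * prob E"
      using E by (subst Bochner_Integration.integral_add)
         (auto intro!: integrable_real_indicator simp: less_top[symmetric] prob_space)
    also have "K * prob E \<le> (K + 1) * (\<eta> / (2 * (K + 1)))"
      using R K by (intro mult_mono) (auto simp: E_def)
    also have "\<dots> = \<eta> / 2" using K by (simp add: divide_simps)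
    finally have "expectation (\<lambda>x. - ln (w (R x) (S x))) \<le> \<eta>" by simp
    then have "cond_code R S w \<eta>"
      unfolding cond_code_def using w0 w1 i2 pos by (auto intro!: AE_I2)
    then show "\<exists>w. cond_code R S w \<eta>" by blast
  qed
qed

end

section \<open>Entropy of finite partitions\<close>

text \<open>The limit is the infimum of the quotients, which yields the bound for every
  \<open>n\<close> along with the convergence. The proof divides \<open>n\<close> with remainder by
  a nearly optimal length.\<close>

lemma fekete:
  fixes H :: "nat \<Rightarrow> real"
  assumes H0: "\<And>n. H n \<ge> 0" and sub: "\<And>m n. H (m + n) \<le> H m + H n"
  obtains h where "h \<ge> 0" "(\<lambda>n. H (Suc n) / real (Suc n)) \<longlonglongrightarrow> h" "\<And>n. real n * h \<le> H n"
proof -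
  define X where "X = range (\<lambda>n. H (Suc n) / real (Suc n))"
  define h where "h = Inf X"
  have bdd: "bdd_below X" unfolding X_def by (rule bdd_belowI[of _ 0]) (use H0 in auto)
  have h_le: "h \<le> H (Suc n) / real (Suc n)" for n
    unfolding h_def X_def by (rule cInf_lower) (use bdd in \<open>auto simp: X_def\<close>)
  have h0: "h \<ge> 0" unfolding h_def X_def by (rule cInf_greatest) (use H0 in auto)
  have low: "real n * h \<le> H n" for n
  proof (cases n)
    case (Suc k)
    then show ?thesis using h_le[of k] by (simp add: pos_le_divide_eq mult.commute)
  qed (use H0 in auto)
  have mult: "H (k * m + r) \<le> k * H m + H r" for k m r
  proof (induction k)
    case (Suc k)
    have "H (Suc k * m + r) \<le> H m + H (k * m + r)" using sub[of m "k * m + r"] by (simp add: add.assoc)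
    then show ?case using Suc by (simp add: algebra_simps)
  qed simp
  have "(\<lambda>n. H (Suc n) / real (Suc n)) \<longlonglongrightarrow> h"
  proof (rule LIMSEQ_I)
    fix e :: real assume e: "e > 0"
    have "\<exists>x\<in>X. x < h + e / 2"
      unfolding h_def using cInf_lessD[of X "Inf X + e / 2"] e by (auto simp: X_def)
    then obtain k where k: "H (Suc k) / real (Suc k) < h + e / 2" by (auto simp: X_def)
    define m where "m = Suc k"
    \<comment> \<open>Bounds the contribution of every remainder modulo \<open>m\<close>.\<close>
    define C where "C = (\<Sum>r<m. H r)"
    have C: "H r \<le> C" if "r < m" for r
      unfolding C_def using that H0 by (intro member_le_sum) auto
    obtain N :: nat where N: "real N * (e / 2) > C" using e ex_less_of_nat_mult[of "e / 2" C] by auto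
    have "norm (H (Suc n) / real (Suc n) - h) < e" if n: "n \<ge> N" for n
    proof -
      have "H (Suc n) = H (Suc n div m * m + Suc n mod m)" by simp
      also have "\<dots> \<le> (Suc n div m) * H m + H (Suc n mod m)" by (rule mult)
      also have "\<dots> \<le> real (Suc n) / m * H m + C"
        by (intro add_mono mult_right_mono H0 C of_nat_div_le_of_nat) (auto simp: m_def)
      also have "real (Suc n) / m * H m = real (Suc n) * (H m / m)" by simp
      finally have 1: "H (Suc n) \<le> real (Suc n) * (H m / m) + C" .
      have "real N * (e / 2) \<le> real (Suc n) * (e / 2)" using n e by (intro mult_right_mono) auto
      then have "C < real (Suc n) * (e / 2)" using N by linarith
      moreover have "real (Suc n) * (H m / m) \<le> real (Suc n) * (h + e / 2)"
        using k by (intro mult_left_mono) (auto simp: m_def)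
      ultimately have "H (Suc n) < real (Suc n) * (h + e / 2) + real (Suc n) * (e / 2)" using 1 by linarith
      also have "\<dots> = (h + e) * real (Suc n)" by (simp add: algebra_simps)
      finally have "H (Suc n) / real (Suc n) < h + e" by (simp add: divide_less_eq)
      then show ?thesis using h_le[of n] by simp
    qed
    then show "\<exists>no. \<forall>n\<ge>no. norm (H (Suc n) / real (Suc n) - h) < e" by blast
  qed
  then show ?thesis using that h0 low by blast
qed

text \<open>Nonnegativity of mutual information. Each term is compared by
  \<open>ln t \<le> t - 1\<close> at \<open>t = pa a * pb b / p a b\<close>, and the corrections
  \<open>pa a * pb b - p a b\<close> sum to \<open>1 - 1\<close>.\<close>

lemma joint_entropy_le:
  fixes p :: "'b \<Rightarrow> 'c \<Rightarrow> real"
  assumes A: "finite A" and B: "finite B" and p0: "\<And>a b. a \<in> A \<Longrightarrow> b \<in> B \<Longrightarrow> p a b \<ge> 0"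
    and pA: "\<And>a. a \<in> A \<Longrightarrow> (\<Sum>b\<in>B. p a b) = pa a" and pB: "\<And>b. b \<in> B \<Longrightarrow> (\<Sum>a\<in>A. p a b) = pb b"
    and tot: "(\<Sum>a\<in>A. pa a) = 1"
  shows "(\<Sum>a\<in>A. \<Sum>b\<in>B. - p a b * ln (p a b)) \<le> (\<Sum>a\<in>A. - pa a * ln (pa a)) + (\<Sum>b\<in>B. - pb b * ln (pb b))"
proof -
  have pa_ge: "p a b \<le> pa a" if "a \<in> A" "b \<in> B" for a b
    unfolding pA[OF that(1), symmetric] using that B p0 by (intro member_le_sum) auto
  have pb_ge: "p a b \<le> pb b" if "a \<in> A" "b \<in> B" for a b
    unfolding pB[OF that(2), symmetric] using that A p0 by (intro member_le_sum) auto
  have totB: "(\<Sum>b\<in>B. pb b) = 1"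
  proof -
    have "(\<Sum>b\<in>B. pb b) = (\<Sum>b\<in>B. \<Sum>a\<in>A. p a b)" using pB by simp
    also have "\<dots> = (\<Sum>a\<in>A. \<Sum>b\<in>B. p a b)" by (rule sum.swap)
    finally show ?thesis using pA tot by simp
  qed
  have term_le: "- p a b * ln (p a b) \<le> - p a b * ln (pa a) - p a b * ln (pb b) + (pa a * pb b - p a b)"
    if ab: "a \<in> A" "b \<in> B" for a b
  proof (cases "p a b = 0")
    case True
    then show ?thesis using pa_ge[OF ab] pb_ge[OF ab] by simp
  next
    case False
    then have p: "p a b > 0" using p0[OF ab] by simp
    then have q: "pa a > 0" "pb b > 0" using pa_ge[OF ab] pb_ge[OF ab] by auto
    have "ln (pa a * pb b / p a b) \<le> pa a * pb b / p a b - 1" using p q by (intro ln_le_minus_one) auto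
    then have "ln (pa a) + ln (pb b) - ln (p a b) \<le> pa a * pb b / p a b - 1"
      using p q by (simp add: ln_div ln_mult)
    then have "p a b * (ln (pa a) + ln (pb b) - ln (p a b)) \<le> p a b * (pa a * pb b / p a b - 1)"
      using p by (intro mult_left_mono) auto
    then show ?thesis using p by (simp add: algebra_simps)
  qed
  have "(\<Sum>a\<in>A. \<Sum>b\<in>B. - p a b * ln (p a b))
      \<le> (\<Sum>a\<in>A. \<Sum>b\<in>B. - p a b * ln (pa a) - p a b * ln (pb b) + (pa a * pb b - p a b))"
    by (intro sum_mono term_le)
  also have "\<dots> = (\<Sum>a\<in>A. \<Sum>b\<in>B. - p a b * ln (pa a)) - (\<Sum>a\<in>A. \<Sum>b\<in>B. p a b * ln (pb b))
      + ((\<Sum>a\<in>A. \<Sum>b\<in>B. pa a * pb b) - (\<Sum>a\<in>A. \<Sum>b\<in>B. p a b))"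
    by (simp add: sum.distrib sum_subtractf)
  also have "(\<Sum>a\<in>A. \<Sum>b\<in>B. pa a * pb b) = 1"
    using tot totB by (simp add: sum_product[symmetric])
  also have "(\<Sum>a\<in>A. \<Sum>b\<in>B. p a b) = 1" using pA tot by simp
  also have "(\<Sum>a\<in>A. \<Sum>b\<in>B. - p a b * ln (pa a)) = (\<Sum>a\<in>A. - pa a * ln (pa a))"
    by (intro sum.cong refl) (simp add: sum_negf sum_distrib_right[symmetric] pA)
  also have "(\<Sum>a\<in>A. \<Sum>b\<in>B. p a b * ln (pb b)) = (\<Sum>b\<in>B. pb b * ln (pb b))"
    by (subst sum.swap, intro sum.cong refl) (simp add: sum_distrib_right[symmetric] pB)
  finally show ?thesis by (simp add: sum_negf)
qed

lemma words_add: "words L (m + n) = (\<lambda>(u, v). u @ v) ` (words L m \<times> words L n)"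
proof (intro set_eqI iffI)
  fix w assume "w \<in> words L (m + n)"
  then have "take m w \<in> words L m" "drop m w \<in> words L n" "w = take m w @ drop m w"
    by (auto simp: words_def dest: in_set_takeD in_set_dropD)
  then show "w \<in> (\<lambda>(u, v). u @ v) ` (words L m \<times> words L n)"
    by (intro image_eqI[of _ _ "(take m w, drop m w)"]) auto
qed (auto simp: words_def)

context pmp begin

lemma word_entropy_nonneg: "word_entropy q n \<ge> 0"
proof -
  have "0 \<le> - wp q w * ln (wp q w)" for w
    using wp_nonneg[of q w] wp_le_1[of q w]
    by (cases "wp q w = 0") (auto intro!: mult_nonneg_nonpos simp: ln_le_zero_iff less_le)
  then show ?thesis unfolding word_entropy_def by (intro sum_nonneg)
qed

text \<open>The word of length \<open>m + n\<close> is the pair of its initial and final parts; that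
  the final part is distributed like a word of length \<open>n\<close> is invariance.\<close>

lemma word_entropy_subadd:
  assumes q: "labelling M q" and L: "finite (q ` space M)"
  shows "word_entropy q (m + n) \<le> word_entropy q m + word_entropy q n"
proof -
  let ?W = "words (q ` space M)"
  have fin: "finite (?W n)" for n by (rule finite_words[OF L])
  have inj: "inj_on (\<lambda>(u, v). u @ v) (?W m \<times> ?W n)" by (auto simp: inj_on_def words_def)
  have "word_entropy q (m + n) = (\<Sum>u\<in>?W m. \<Sum>v\<in>?W n. - wp q (u @ v) * ln (wp q (u @ v)))"
    unfolding word_entropy_def words_add
    by (subst sum.reindex[OF inj]) (simp add: sum.cartesian_product case_prod_beta)
  also have "\<dots> \<le> (\<Sum>u\<in>?W m. - wp q u * ln (wp q u)) + (\<Sum>v\<in>?W n. - wp q v * ln (wp q v))"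
  proof (rule joint_entropy_le[OF fin fin])
    fix u assume u: "u \<in> ?W m"
    have "(\<Sum>v\<in>?W n. wp q (u @ v)) = (\<Sum>w\<in>(\<lambda>v. u @ v) ` ?W n. wp q w)"
      by (subst sum.reindex) (auto simp: inj_on_def)
    also have "\<dots> = prob {x \<in> space M. itin T q (m + n) x \<in> (\<lambda>v. u @ v) ` ?W n}"
      using u fin by (intro prob_itin_sum[symmetric] q) (auto simp: words_def)
    also have "{x \<in> space M. itin T q (m + n) x \<in> (\<lambda>v. u @ v) ` ?W n} = {x \<in> space M. itin T q m x = u}"
      using u itin_in_words[OF Tn_space, of _ q n m] by (auto simp: itin_add words_def intro!: imageI)
    finally show "(\<Sum>v\<in>?W n. wp q (u @ v)) = wp q u" using u by (simp add: wp_def words_def)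
  next
    fix v assume v: "v \<in> ?W n"
    have "(\<Sum>u\<in>?W m. wp q (u @ v)) = (\<Sum>w\<in>(\<lambda>u. u @ v) ` ?W m. wp q w)"
      by (subst sum.reindex) (auto simp: inj_on_def)
    also have "\<dots> = prob {x \<in> space M. itin T q (m + n) x \<in> (\<lambda>u. u @ v) ` ?W m}"
      using v fin by (intro prob_itin_sum[symmetric] q) (auto simp: words_def)
    also have "{x \<in> space M. itin T q (m + n) x \<in> (\<lambda>u. u @ v) ` ?W m} = {x \<in> space M. itin T q n ((T ^^ m) x) = v}"
      using v itin_in_words[of _ q m] by (auto simp: itin_add words_def intro!: imageI)
    also have "prob \<dots> = prob {x \<in> space M. itin T q n x = v}"
      by (intro prob_Tn_Collect itin_sets_eq q)
    finally show "(\<Sum>u\<in>?W m. wp q (u @ v)) = wp q v" using v by (simp add: wp_def words_def)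
  next
    have "(\<Sum>u\<in>?W m. wp q u) = prob {x \<in> space M. itin T q m x \<in> ?W m}"
      using fin by (intro prob_itin_sum[symmetric] q) (auto simp: words_def)
    also have "{x \<in> space M. itin T q m x \<in> ?W m} = space M" using itin_in_words by auto
    finally show "(\<Sum>u\<in>?W m. wp q u) = 1" using prob_space by simp
  qed simp
  finally show ?thesis by (simp add: word_entropy_def)
qed

end

text \<open>If \<open>c\<close> exceeds the limit \<open>h\<close>, some increment of the word
  entropy is below \<open>c\<close>: otherwise telescoping would give entropies of at least
  \<open>n * c\<close>. One such increment suffices for the upper rate.\<close>

lemma (in mixing_pmp) entropy_rates:
  assumes q: "labelling M q" and L: "finite (q ` space M)"
  obtains h where "h \<ge> 0" "(\<lambda>n. word_entropy q (Suc n) / real (Suc n)) \<longlonglongrightarrow> h"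
    "\<And>c. c > h \<Longrightarrow> upper_rate q c" "\<And>c. c < h \<Longrightarrow> lower_rate q c"
proof -
  obtain h where h: "h \<ge> 0" "(\<lambda>n. word_entropy q (Suc n) / real (Suc n)) \<longlonglongrightarrow> h"
      "\<And>n. real n * h \<le> word_entropy q n"
    using fekete[of "word_entropy q", OF word_entropy_nonneg word_entropy_subadd[OF q L]] by blast
  have up: "upper_rate q c" if c: "c > h" for c
  proof -
    have "\<exists>N. word_entropy q (Suc N) - word_entropy q N < c"
    proof (rule ccontr)
      assume "\<not> ?thesis"
      then have inc: "word_entropy q N + c \<le> word_entropy q (Suc N)" for N
        by (metis add.commute le_diff_eq linorder_not_less)
      have "real n * c \<le> word_entropy q n" for n
      proof (induction n)
        case (Suc n)
        then show ?case using inc[of n] by (simp add: algebra_simps)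
      qed (simp add: word_entropy_nonneg)
      then have "c \<le> word_entropy q (Suc n) / real (Suc n)" for n
        by (simp add: pos_le_divide_eq mult.commute del: of_nat_Suc)
      then have "c \<le> h" using h(2) by (intro LIMSEQ_le_const) auto
      then show False using c by simp
    qed
    then show ?thesis using upper_rate_of_increment[OF q L] by blast
  qed
  show ?thesis
    using that[OF h(1,2) up] lower_rate_of_entropy[OF q L up h(3) h(1)] by blast
qed

section \<open>Cells of a finite partition as labels\<close>

definition cell :: "'a set set \<Rightarrow> 'a \<Rightarrow> 'a set" where
  "cell Q x = (THE C. C \<in> Q \<and> x \<in> C)"

lemma cell_eq: "disjoint Q \<Longrightarrow> C \<in> Q \<Longrightarrow> x \<in> C \<Longrightarrow> cell Q x = C"
  unfolding cell_def by (intro the_equality) (auto simp: disjoint_def)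

lemma finite_meas_partition_cell:
  assumes "finite_meas_partition M Q"
  shows "x \<in> space M \<Longrightarrow> cell Q x \<in> Q" "labelling M (cell Q)" "finite (cell Q ` space M)"
    and "x \<in> space M \<Longrightarrow> C \<in> Q \<Longrightarrow> cell Q x = C \<longleftrightarrow> x \<in> C"
proof -
  have Q: "finite Q" "Q \<subseteq> sets M" "disjoint Q" "\<Union>Q = space M"
    using assms by (auto simp: finite_meas_partition_def)
  have ex: "\<exists>C\<in>Q. x \<in> C \<and> cell Q x = C" if "x \<in> space M" for x
    using that Q(4) cell_eq[OF Q(3)] by blast
  show 1: "x \<in> space M \<Longrightarrow> cell Q x \<in> Q" for x using ex by blast
  show 2: "x \<in> space M \<Longrightarrow> C \<in> Q \<Longrightarrow> cell Q x = C \<longleftrightarrow> x \<in> C" for x C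
    using ex cell_eq[OF Q(3)] by metis
  show "labelling M (cell Q)"
  proof (rule labellingI[of Q])
    show "countable Q" using Q by (simp add: countable_finite)
    show "cell Q \<in> space M \<rightarrow> Q" using 1 by auto
    fix C assume C: "C \<in> Q"
    have "{x \<in> space M. cell Q x = C} = C" using 2[OF _ C] C Q by auto
    then show "{x \<in> space M. cell Q x = C} \<in> sets M" using C Q by auto
  qed
  show "finite (cell Q ` space M)" using 1 Q(1) by (meson finite_subset image_subsetI)
qed

text \<open>The members of \<open>join_part\<close> are the cylinders, but as a set: words with the
  same cylinder are counted once. \<open>n > 0\<close> confines the intersections to the
  space.\<close>

lemma part_entropy_join_part:
  assumes pmp: "pmp M T" and sp: "space M = {0..1}" and Q: "finite_meas_partition M Q" and n: "n > 0"
  shows "part_entropy M (join_part T Q n) = pmp.word_entropy M T (cell Q) n"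
proof -
  interpret pmp M T by fact
  note cl = finite_meas_partition_cell[OF Q]
  define Z where "Z w = {x \<in> space M. itin T (cell Q) n x = w}" for w
  have Zw: "(\<Inter>j<n. (T ^^ j) -` (w ! j) \<inter> space M) = Z w" if w: "w \<in> words Q n" for w
  proof -
    have wj: "w ! j \<in> Q" if "j < n" for j using w that by (auto simp: words_def)
    have "x \<in> (\<Inter>j<n. (T ^^ j) -` (w ! j) \<inter> space M) \<longleftrightarrow> x \<in> Z w" for x
    proof -
      have "x \<in> (\<Inter>j<n. (T ^^ j) -` (w ! j) \<inter> space M) \<longleftrightarrow> x \<in> space M \<and> (\<forall>j<n. (T ^^ j) x \<in> w ! j)"
        using n by auto
      also have "\<dots> \<longleftrightarrow> x \<in> space M \<and> (\<forall>j<n. cell Q ((T ^^ j) x) = w ! j)"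
        using cl(4)[OF Tn_space wj] by blast
      also have "\<dots> \<longleftrightarrow> x \<in> Z w"
        using w by (auto simp: Z_def list_eq_iff_nth_eq nth_itin words_def)
      finally show ?thesis .
    qed
    then show ?thesis by blast
  qed
  have "{(\<Inter>j<n. (T ^^ j) -` (f j) \<inter> space M) | f. \<forall>j<n. f j \<in> Q} = Z ` words Q n"
  proof (intro set_eqI iffI)
    fix C assume "C \<in> {(\<Inter>j<n. (T ^^ j) -` (f j) \<inter> space M) | f. \<forall>j<n. f j \<in> Q}"
    then obtain f where f: "C = (\<Inter>j<n. (T ^^ j) -` (f j) \<inter> space M)" "\<forall>j<n. f j \<in> Q" by blast
    have w: "map f [0..<n] \<in> words Q n" using f(2) by (auto simp: words_def)
    have "C = Z (map f [0..<n])" unfolding f(1) Zw[OF w, symmetric] by (intro INF_cong) auto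
    then show "C \<in> Z ` words Q n" using w by blast
  next
    fix C assume "C \<in> Z ` words Q n"
    then obtain w where w: "w \<in> words Q n" "C = Z w" by blast
    then have "\<forall>j<n. w ! j \<in> Q" by (auto simp: words_def)
    then show "C \<in> {(\<Inter>j<n. (T ^^ j) -` (f j) \<inter> space M) | f. \<forall>j<n. f j \<in> Q}"
      using Zw[OF w(1)] w(2) by blast
  qed
  \<comment> \<open>Different words share a cylinder only if it is empty, and an empty cylinder
    contributes 0.\<close>
  moreover have "(\<Sum>C\<in>Z ` words Q n. - prob C * ln (prob C)) = (\<Sum>w\<in>words Q n. - prob (Z w) * ln (prob (Z w)))"
  proof (subst sum.reindex_nontrivial)
    show "finite (words Q n)" using Q by (intro finite_words) (simp add: finite_meas_partition_def)
    fix v w assume "v \<noteq> w" "Z v = Z w"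
    then have "Z v = {}" by (auto simp: Z_def)
    then show "- prob (Z v) * ln (prob (Z v)) = 0" by simp
  qed simp
  \<comment> \<open>\<open>Q\<close> may contain the empty set, a letter that no point carries;
    words containing it have empty cylinders.\<close>
  moreover have "\<dots> = (\<Sum>w\<in>words (cell Q ` space M) n. - prob (Z w) * ln (prob (Z w)))"
  proof (rule sum.mono_neutral_right)
    show "finite (words Q n)" using Q by (intro finite_words) (simp add: finite_meas_partition_def)
    show "words (cell Q ` space M) n \<subseteq> words Q n" using cl(1) by (auto simp: words_def)
    have "Z w = {}" if "w \<notin> words (cell Q ` space M) n" for w
      using that itin_in_words by (auto simp: Z_def)
    then show "\<forall>w\<in>words Q n - words (cell Q ` space M) n. - prob (Z w) * ln (prob (Z w)) = 0" by simp
  qed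
  moreover have "\<dots> = word_entropy (cell Q) n"
    unfolding word_entropy_def by (intro sum.cong) (auto simp: Z_def wp_def words_def)
  ultimately show ?thesis unfolding part_entropy_def join_part_def preim_def sp by simp
qed

lemma finite_partition_rates:
  assumes mix: "mixing_pmp M T" and sp: "space M = {0..1}" and Q: "finite_meas_partition M Q"
  shows "entropy_part M T Q \<ge> 0"
    and "c > entropy_part M T Q \<Longrightarrow> pmp.upper_rate M T (cell Q) c"
    and "c < entropy_part M T Q \<Longrightarrow> pmp.lower_rate M T (cell Q) c"
proof -
  interpret mixing_pmp M T by fact
  note cl = finite_meas_partition_cell[OF Q]
  obtain h where h: "h \<ge> 0" "(\<lambda>n. word_entropy (cell Q) (Suc n) / real (Suc n)) \<longlonglongrightarrow> h"
    "\<And>c. c > h \<Longrightarrow> upper_rate (cell Q) c" "\<And>c. c < h \<Longrightarrow> lower_rate (cell Q) c"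
    using entropy_rates[OF cl(2,3)] by blast
  have "part_entropy M (join_part T Q (Suc n)) = word_entropy (cell Q) (Suc n)" for n
    by (rule part_entropy_join_part[OF pmp_axioms sp Q]) simp
  then have "entropy_part M T Q = h"
    unfolding entropy_part_def using h(2) by (simp add: limI)
  then show "entropy_part M T Q \<ge> 0" "c > entropy_part M T Q \<Longrightarrow> upper_rate (cell Q) c"
    "c < entropy_part M T Q \<Longrightarrow> lower_rate (cell Q) c"
    using h by auto
qed

section \<open>Interval maps\<close>

lemma space_borel01 [simp]: "space borel01 = {0..1}"
  by (simp add: borel01_def space_restrict_space)

lemma sets_borel01_iff: "S \<in> sets borel01 \<longleftrightarrow> S \<in> sets borel \<and> S \<subseteq> {0..1}"
  by (auto simp: borel01_def sets_restrict_space_iff)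

lemma measure_leb01: "S \<in> sets borel01 \<Longrightarrow> measure leb01 S = measure lborel S"
  by (auto simp: sets_borel01_iff leb01_def intro!: measure_restrict_space)

text \<open>The approximable sets form a sigma-algebra: a countable union is truncated at
  \<open>N\<close> and the errors of the finitely many pieces are added. It serves twice, for sets
  that are almost cylinder unions and for sets with few cuts.\<close>

lemma sigma_sets_approx:
  assumes fin: "finite_measure M" and G: "G \<subseteq> sets M"
    and compl: "\<And>A. A \<in> G \<Longrightarrow> space M - A \<in> G" and un: "\<And>A B. A \<in> G \<Longrightarrow> B \<in> G \<Longrightarrow> A \<union> B \<in> G"
    and empty: "{} \<in> G" and S: "S \<in> sigma_sets (space M) G"
  shows "S \<in> sets M \<and> (\<forall>\<epsilon>>0. \<exists>A\<in>G. measure M ((S - A) \<union> (A - S)) < \<epsilon>)"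
  using S
proof (induction rule: sigma_sets.induct)
  case (Basic a)
  then show ?case using G by (auto intro!: bexI[of _ a])
next
  case Empty
  then show ?case using empty by (auto intro!: bexI[of _ "{}"])
next
  case (Compl a)
  have "\<exists>A\<in>G. measure M ((space M - a - A) \<union> (A - (space M - a))) < \<epsilon>" if \<epsilon>: "\<epsilon> > 0" for \<epsilon>
  proof -
    obtain A where A: "A \<in> G" "measure M ((a - A) \<union> (A - a)) < \<epsilon>" using Compl.IH \<epsilon> by blast
    have "(space M - a - (space M - A)) \<union> (space M - A - (space M - a)) = (a - A) \<union> (A - a)"
      using A(1) G Compl.IH sets.sets_into_space by blast
    then show ?thesis using A compl[OF A(1)] by (intro bexI[of _ "space M - A"]) auto
  qed
  then show ?case using Compl by auto
next
  case (Union a)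
  interpret finite_measure M by fact
  have a: "a n \<in> sets M" for n using Union by blast
  have "\<exists>A\<in>G. measure M (((\<Union>i. a i) - A) \<union> (A - (\<Union>i. a i))) < \<epsilon>" if \<epsilon>: "\<epsilon> > 0" for \<epsilon>
  proof -
    have "(\<lambda>n. measure M (\<Union>i<n. a i)) \<longlonglongrightarrow> measure M (\<Union>n. \<Union>i<n. a i)"
      using a by (intro finite_Lim_measure_incseq) (fastforce simp: incseq_def)+
    moreover have "(\<Union>n. \<Union>i<n. a i) = (\<Union>i. a i)" by auto
    ultimately have "(\<lambda>n. measure M (\<Union>i<n. a i)) \<longlonglongrightarrow> measure M (\<Union>i. a i)" by simp
    from LIMSEQ_D[OF this, of "\<epsilon> / 2"] \<epsilon> obtain N where
      N: "\<bar>measure M (\<Union>i<N. a i) - measure M (\<Union>i. a i)\<bar> < \<epsilon> / 2" by auto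
    have tail: "measure M ((\<Union>i. a i) - (\<Union>i<N. a i)) < \<epsilon> / 2"
      using N a by (subst finite_measure_Diff) (auto simp: abs_if split: if_splits)
    \<comment> \<open>\<open>Suc N\<close> instead of \<open>N\<close> avoids a division by zero
      when the truncated union is empty.\<close>
    define e where "e = \<epsilon> / (2 * real (Suc N))"
    have e: "e > 0" using \<epsilon> by (simp add: e_def)
    have "\<forall>i. \<exists>A\<in>G. measure M ((a i - A) \<union> (A - a i)) < e" using Union.IH e by blast
    then obtain A where A: "\<And>i. A i \<in> G" "\<And>i. measure M ((a i - A i) \<union> (A i - a i)) < e" by metis
    have AM: "A i \<in> sets M" for i using A(1) G by blast
    have UG: "(\<Union>i<n. A i) \<in> G" for n
      by (induction n) (use empty un A(1) in \<open>auto simp: lessThan_Suc\<close>)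
    have "measure M (((\<Union>i. a i) - (\<Union>i<N. A i)) \<union> ((\<Union>i<N. A i) - (\<Union>i. a i)))
        \<le> measure M (((\<Union>i. a i) - (\<Union>i<N. a i)) \<union> (\<Union>i<N. (a i - A i) \<union> (A i - a i)))"
      using a AM by (intro finite_measure_mono) auto
    also have "\<dots> \<le> measure M ((\<Union>i. a i) - (\<Union>i<N. a i)) + measure M (\<Union>i<N. (a i - A i) \<union> (A i - a i))"
      using a AM by (intro measure_Un_le) auto
    also have "measure M (\<Union>i<N. (a i - A i) \<union> (A i - a i)) \<le> (\<Sum>i<N. measure M ((a i - A i) \<union> (A i - a i)))"
      using a AM by (intro finite_measure_subadditive_finite) auto
    also have "\<dots> \<le> (\<Sum>i<N. e)" using A(2) by (intro sum_mono) (simp add: less_imp_le)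
    also have "\<dots> \<le> real (Suc N) * e" using e by simp
    also have "\<dots> = \<epsilon> / 2" by (simp add: e_def divide_simps)
    finally show ?thesis using tail UG[of N] by (intro bexI[of _ "\<Union>i<N. A i"]) auto
  qed
  then show ?case using a by auto
qed

text \<open>Members of \<open>P\<close> may overlap in endpoints, so only interiors give a
  well-defined label. All other points get the dummy label \<open>{}\<close>, which is not in
  \<open>P\<close> because its members have nonempty interior.\<close>

definition branch :: "real set set \<Rightarrow> real \<Rightarrow> real set" where
  "branch P x = (if \<exists>I\<in>P. x \<in> interior I then THE I. I \<in> P \<and> x \<in> interior I else {})"

locale class_T =
  fixes T :: "real \<Rightarrow> real" and \<mu> :: "real measure" and P :: "real set set"
  assumes in_class: "in_class_T T \<mu> P"
begin

lemma sets_mu: "sets \<mu> = sets borel01"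
  using in_class by (simp add: in_class_T_def prob01_def)

lemma space_mu [simp]: "space \<mu> = {0..1}"
  using sets_eq_imp_space_eq[OF sets_mu] by simp

sublocale pmp \<mu> T
proof -
  interpret prob_space \<mu> using in_class by (simp add: in_class_T_def prob01_def)
  show "pmp \<mu> T"
    by unfold_locales (use in_class in \<open>auto simp: in_class_T_def measure_preserving01_def\<close>)
qed

lemma T_01: "x \<in> {0..1} \<Longrightarrow> T x \<in> {0..1}"
  using measurable_space[OF T_meas] by simp

lemma mu_leb: "\<exists>c\<ge>1. \<forall>S\<in>sets \<mu>. prob S \<le> c * measure lborel S \<and> measure lborel S \<le> c * prob S"
proof -
  obtain c where c: "c \<ge> 1" "\<And>S. S \<in> sets borel01 \<Longrightarrow> prob S / c \<le> measure leb01 S \<and> measure leb01 S \<le> c * prob S"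
    using in_class unfolding in_class_T_def by blast
  show ?thesis
  proof (intro exI[of _ c] conjI ballI c(1))
    fix S assume "S \<in> sets \<mu>"
    then have "S \<in> sets borel01" by (simp add: sets_mu)
    then show "prob S \<le> c * measure lborel S" "measure lborel S \<le> c * prob S"
      using c(1) c(2)[of S] measure_leb01[of S] by (auto simp: divide_le_eq mult.commute)
  qed
qed

lemma mu_zero_iff: "S \<in> sets \<mu> \<Longrightarrow> prob S = 0 \<longleftrightarrow> measure lborel S = 0"
proof -
  assume S: "S \<in> sets \<mu>"
  obtain c where "c \<ge> 1" "prob S \<le> c * measure lborel S" "measure lborel S \<le> c * prob S"
    using mu_leb S by blast
  then show ?thesis
    using measure_nonneg[of \<mu> S] measure_nonneg[of lborel S] by (metis antisym mult_zero_right)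
qed

lemma P_count: "countable P"
  and P_interval: "I \<in> P \<Longrightarrow> is_interval I" and P_sub: "I \<in> P \<Longrightarrow> I \<subseteq> {0..1}"
  and P_int: "I \<in> P \<Longrightarrow> interior I \<noteq> {}"
  and P_disj: "I \<in> P \<Longrightarrow> J \<in> P \<Longrightarrow> I \<noteq> J \<Longrightarrow> interior I \<inter> interior J = {}"
  and P_cover: "emeasure lborel ({0..1} - \<Union>P) = 0"
  using in_class unfolding in_class_T_def interval_partition01_def by auto

lemma P_borel: "I \<in> P \<Longrightarrow> I \<in> sets \<mu>"
  using P_interval P_sub by (simp add: sets_mu sets_borel01_iff real_interval_borel_measurable)

lemma intI_sets: "I \<in> P \<Longrightarrow> interior I \<in> sets \<mu>"
  using P_sub interior_subset by (fastforce simp: sets_mu sets_borel01_iff)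

lemma interior_01: "I \<in> P \<Longrightarrow> x \<in> interior I \<Longrightarrow> x \<in> {0..1}"
  using P_sub interior_subset by blast

text \<open>A nondegenerate interval lies in the closure of its interior, so an open set that meets
  \<open>I\<close> also meets \<open>interior I\<close>.\<close>

lemma interior_meets:
  assumes "I \<in> P" "J \<in> P" "x \<in> I" "x \<in> interior J" shows "I = J"
proof (rule ccontr)
  assume "I \<noteq> J"
  have cv: "convex I" using P_interval[OF assms(1)] by (simp add: is_interval_convex_1)
  have "x \<in> closure (interior I)"
    using convex_closure_interior[OF cv P_int[OF assms(1)]] assms(3) closure_subset by blast
  then have "interior J \<inter> interior I \<noteq> {}"
    using assms(4) open_Int_closure_eq_empty[of "interior J" "interior I"] by blast
  then show False using P_disj[OF assms(1,2) \<open>I \<noteq> J\<close>] by blast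
qed

lemma branch_eq_iff:
  assumes "I \<in> P" shows "branch P x = I \<longleftrightarrow> x \<in> interior I"
proof
  assume x: "x \<in> interior I"
  have "(THE J. J \<in> P \<and> x \<in> interior J) = I"
    using assms x P_disj by (intro the_equality) blast+
  then show "branch P x = I" using assms x by (auto simp: branch_def)
next
  assume e: "branch P x = I"
  have "I \<noteq> {}" using P_int[OF assms] by auto
  then obtain J where J: "J \<in> P" "x \<in> interior J" using e unfolding branch_def by (meson)
  have "(THE J. J \<in> P \<and> x \<in> interior J) = J"
    using J P_disj by (intro the_equality) blast+
  then show "x \<in> interior I" using e J by (auto simp: branch_def)
qed

lemma branch_in: "branch P x \<in> insert {} P"
proof (cases "\<exists>I\<in>P. x \<in> interior I")
  case True
  then obtain I where "I \<in> P" "x \<in> interior I" by blast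
  then show ?thesis using branch_eq_iff[of I x] by simp
qed (simp add: branch_def)

lemma labelling_branch: "labelling \<mu> (branch P)"
proof (rule labellingI[of "insert {} P"])
  show "countable (insert {} P)" using P_count by simp
  show "branch P \<in> space \<mu> \<rightarrow> insert {} P" using branch_in by blast
  fix l assume "l \<in> insert {} P"
  then show "{x \<in> space \<mu>. branch P x = l} \<in> sets \<mu>"
  proof (cases "l \<in> P")
    case True
    have "{x \<in> space \<mu>. branch P x = l} = interior l"
      using branch_eq_iff[OF True] interior_01[OF True] by (auto simp del: atLeastAtMost_iff)
    then show ?thesis using intI_sets[OF True] by simp
  next
    case False
    then have l: "l = {}" using \<open>l \<in> insert {} P\<close> by simp
    have "{x \<in> space \<mu>. branch P x = l} = space \<mu> - (\<Union>I\<in>P. interior I)"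
    proof -
      have "branch P x = l \<longleftrightarrow> (\<forall>I\<in>P. x \<notin> interior I)" for x
        using branch_eq_iff[of "branch P x" x] branch_in[of x] branch_eq_iff False unfolding l
        by (metis insertE)
      then show ?thesis by auto
    qed
    moreover have "\<dots> \<in> sets \<mu>"
      using intI_sets P_count by (intro sets.Diff sets.top sets.countable_UN') auto
    ultimately show ?thesis by simp
  qed
qed

text \<open>A point without a branch is missed by \<open>\<Union>P\<close> or lies on the frontier
  of one of countably many intervals. Frontiers of convex sets are negligible, which is why the
  argument passes through the completion \<open>lebesgue\<close>.\<close>

lemma AE_branch: "AE x in \<mu>. branch P x \<in> P"
proof -
  let ?N = "{0..1} - (\<Union>I\<in>P. interior I)"
  have N: "?N \<in> sets \<mu>"
  proof -
    have "space \<mu> - (\<Union>I\<in>P. interior I) \<in> sets \<mu>"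
      using intI_sets P_count by (intro sets.Diff sets.top sets.countable_UN') auto
    then show ?thesis by simp
  qed
  have fr: "frontier I \<in> null_sets lebesgue" if "I \<in> P" for I
    using negligible_convex_frontier[of I] P_interval[OF that] by (simp add: is_interval_convex_1 negligible_iff_null_sets)
  have "{0..1} - \<Union>P \<in> null_sets lborel"
    using P_cover P_borel P_count
    by (intro null_setsI) (auto simp: sets_mu sets_borel01_iff intro!: sets.Diff sets.countable_Union)
  then have "{0..1} - \<Union>P \<in> null_sets lebesgue" by (rule null_sets_completionI)
  then have "({0..1} - \<Union>P) \<union> (\<Union>I\<in>P. frontier I) \<in> null_sets lebesgue"
    using fr P_count by (intro null_sets.Un null_sets_UN') auto
  moreover have "?N \<subseteq> ({0..1} - \<Union>P) \<union> (\<Union>I\<in>P. frontier I)"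
    using closure_subset by (fastforce simp: frontier_def)
  moreover have "?N \<in> sets lebesgue" using N by (auto simp: sets_mu sets_borel01_iff)
  ultimately have "?N \<in> null_sets lebesgue" using null_sets_subset by blast
  then have "measure lebesgue ?N = 0" by (simp add: measure_eq_0_null_sets)
  then have "measure lborel ?N = 0" using N by (simp add: sets_mu sets_borel01_iff)
  then have "prob ?N = 0" using mu_zero_iff[OF N] by simp
  then have "AE x in \<mu>. x \<notin> ?N" using prob_eq_0[OF N] by blast
  then show ?thesis using AE_space
  proof eventually_elim
    case (elim x)
    then obtain I where "I \<in> P" "x \<in> interior I" by auto
    then show ?case using branch_eq_iff[of I x] by simp
  qed
qed

text \<open>Translates between the intervals themselves, used by \<open>gen_sigma\<close> and
  \<open>join_part\<close>, and the labels, which only see interiors.\<close>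

lemma AE_branch_mem: "AE x in \<mu>. \<forall>I\<in>P. x \<in> I \<longleftrightarrow> branch P x = I"
  using AE_branch
proof eventually_elim
  case (elim x)
  then have "x \<in> interior (branch P x)" using branch_eq_iff by blast
  then show ?case using interior_meets[OF _ elim] interior_subset by blast
qed

section \<open>Cylinders of the interval partition\<close>

abbreviation "cyl n W \<equiv> {x \<in> space \<mu>. itin T (branch P) n x \<in> W}"

lemma cyl_sets: "cyl n W \<in> sets \<mu>"
  by (rule itin_sets[OF labelling_branch])

lemma AE_itin_words: "AE x in \<mu>. itin T (branch P) n x \<in> words P n"
  using AE_all_Tn[OF AE_branch] by eventually_elim (auto intro: itin_words)

text \<open>The generating property gives a set \<open>C\<close> equal to \<open>B\<close> up to a
  null set, and \<open>C\<close> is approximable because sets that almost coincide with unions of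
  cylinders of one finite length form an algebra containing the generators.\<close>

lemma approx_cyl:
  assumes B: "B \<in> sets \<mu>" and \<epsilon>: "\<epsilon> > 0"
  shows "\<exists>m W. prob ((B - cyl m W) \<union> (cyl m W - B)) < \<epsilon>"
proof -
  \<comment> \<open>Equality is asked for almost everywhere since a generator
    \<open>preim T j I\<close> may differ from the corresponding set of labels in endpoints. Unions
    stay in \<open>G\<close> after passing to the longer of the two lengths.\<close>
  define G where "G = {S \<in> sets \<mu>. \<exists>m W. AE x in \<mu>. x \<in> S \<longleftrightarrow> itin T (branch P) m x \<in> W}"
  obtain C where C: "C \<in> gen_sigma T P" "measure leb01 ((B - C) \<union> (C - B)) = 0"
    using in_class B sets_mu unfolding in_class_T_def by blast
  have gen: "preim T j I \<in> G" if I: "I \<in> P" for I j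
  proof -
    have "preim T j I \<in> sets \<mu>"
      unfolding preim_def using measurable_sets[OF Tn_meas P_borel[OF I], of j] by simp
    moreover have "AE x in \<mu>. x \<in> preim T j I \<longleftrightarrow> itin T (branch P) (Suc j) x \<in> {w. w ! j = I}"
      using AE_Tn[OF AE_branch_mem, of j] AE_space
      by eventually_elim (use I in \<open>auto simp: preim_def nth_itin simp del: itin.simps\<close>)
    ultimately show ?thesis unfolding G_def by blast
  qed
  have "C \<in> sigma_sets (space \<mu>) G"
    using C(1) gen unfolding gen_sigma_def space_mu
    by (rule_tac subsetD[OF sigma_sets_mono']) auto
  have compl: "space \<mu> - A \<in> G" if A: "A \<in> G" for A
  proof -
    obtain m W where "A \<in> sets \<mu>" and ae: "AE x in \<mu>. x \<in> A \<longleftrightarrow> itin T (branch P) m x \<in> W"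
      using A unfolding G_def by blast
    moreover have "AE x in \<mu>. x \<in> space \<mu> - A \<longleftrightarrow> itin T (branch P) m x \<in> - W"
      using ae AE_space by eventually_elim auto
    ultimately show ?thesis unfolding G_def by blast
  qed
  have un: "A \<union> A' \<in> G" if A: "A \<in> G" "A' \<in> G" for A A'
  proof -
    obtain m W where 1: "A \<in> sets \<mu>" "AE x in \<mu>. x \<in> A \<longleftrightarrow> itin T (branch P) m x \<in> W"
      using A unfolding G_def by blast
    obtain m' W' where 2: "A' \<in> sets \<mu>" "AE x in \<mu>. x \<in> A' \<longleftrightarrow> itin T (branch P) m' x \<in> W'"
      using A unfolding G_def by blast
    have "AE x in \<mu>. x \<in> A \<union> A' \<longleftrightarrow> itin T (branch P) (max m m') x \<in> {w. take m w \<in> W \<or> take m' w \<in> W'}"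
      using 1(2) 2(2) by eventually_elim (simp add: take_itin)
    then show ?thesis using 1(1) 2(1) unfolding G_def by blast
  qed
  have emp: "{} \<in> G" unfolding G_def by (auto intro!: exI[of _ "{}"])
  have CA: "C \<in> sets \<mu> \<and> (\<forall>\<epsilon>>0. \<exists>A\<in>G. prob ((C - A) \<union> (A - C)) < \<epsilon>)"
    by (rule sigma_sets_approx[OF finite_measure_axioms _ compl un emp \<open>C \<in> sigma_sets (space \<mu>) G\<close>])
       (auto simp: G_def)
  obtain A where A: "A \<in> G" "prob ((C - A) \<union> (A - C)) < \<epsilon>" using CA \<epsilon> by blast
  obtain m W where ae: "A \<in> sets \<mu>" "AE x in \<mu>. x \<in> A \<longleftrightarrow> itin T (branch P) m x \<in> W"
    using A(1) unfolding G_def by blast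
  have D: "(B - C) \<union> (C - B) \<in> sets \<mu>" using B CA by auto
  then have "prob ((B - C) \<union> (C - B)) = 0"
    using C(2) mu_zero_iff[OF D] measure_leb01[of "(B - C) \<union> (C - B)"] by (simp add: sets_mu)
  then have aeC: "AE x in \<mu>. x \<notin> (B - C) \<union> (C - B)" using prob_eq_0[OF D] by blast
  have "prob ((B - cyl m W) \<union> (cyl m W - B)) \<le> prob ((C - A) \<union> (A - C))"
  proof (rule finite_measure_mono_AE)
    show "AE x in \<mu>. x \<in> (B - cyl m W) \<union> (cyl m W - B) \<longrightarrow> x \<in> (C - A) \<union> (A - C)"
      using ae(2) aeC AE_space by eventually_elim auto
    show "(C - A) \<union> (A - C) \<in> sets \<mu>" using CA ae(1) by auto
  qed
  then show ?thesis using A(2) by (intro exI[of _ m] exI[of _ W]) simp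
qed

text \<open>A monotone map on an open interval pulls intervals back to intervals, and the first
  letter places the cylinder in a single branch. Words are taken over \<open>P\<close> because the
  set of points with the dummy label need not be an interval.\<close>

lemma cyl_interval:
  assumes "w \<in> words P n" shows "is_interval {x \<in> space \<mu>. itin T (branch P) n x = w}"
  using assms
proof (induction n arbitrary: w)
  case 0
  have "{x \<in> space \<mu>. itin T (branch P) 0 x = w} = {0..1}" using 0 by (auto simp: words_def)
  then show ?case by (simp add: is_interval_cc)
next
  case (Suc n)
  then obtain I v where w: "w = I # v" "I \<in> P" "v \<in> words P n" by (auto simp: words_Suc)
  define C where "C = {x \<in> space \<mu>. itin T (branch P) n x = v}"
  have C: "is_interval C" unfolding C_def using Suc.IH w by blast
  have eq: "{x \<in> space \<mu>. itin T (branch P) (Suc n) x = w} = {x \<in> interior I. T x \<in> C}"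
    using T_01 branch_eq_iff[OF w(2)] interior_01[OF w(2)] unfolding C_def w(1)
    by (auto simp del: atLeastAtMost_iff)
  have mono: "strict_mono_on (interior I) T \<or> strict_antimono_on (interior I) T"
    using in_class w(2) unfolding in_class_T_def by blast
  have "is_interval (interior I)"
    using P_interval[OF w(2)] by (simp add: is_interval_convex_1 convex_interior)
  then have I: "y \<in> interior I" if "x \<in> interior I" "z \<in> interior I" "x \<le> y" "y \<le> z" for x y z
    using that unfolding is_interval_1 by blast
  show ?case unfolding eq is_interval_1
  proof (intro ballI allI impI)
    fix x z y assume x: "x \<in> {x \<in> interior I. T x \<in> C}" and z: "z \<in> {x \<in> interior I. T x \<in> C}"
      and y: "x \<le> y \<and> y \<le> z"
    have yI: "y \<in> interior I" using I x z y by blast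
    have "T x \<le> T y \<and> T y \<le> T z \<or> T z \<le> T y \<and> T y \<le> T x"
      using mono
    proof
      assume "strict_mono_on (interior I) T"
      then have "mono_on (interior I) T" by (rule strict_mono_on_imp_mono_on)
      then show ?thesis using x z y yI by (auto simp: mono_on_def)
    next
      assume m: "strict_antimono_on (interior I) T"
      have "T b \<le> T a" if "a \<in> interior I" "b \<in> interior I" "a \<le> b" for a b
        using that monotone_onD[OF m, of a b] by (cases "a = b") auto
      then show ?thesis using x z y yI by auto
    qed
    then have "T y \<in> C" using C x z unfolding is_interval_1 by blast
    then show "y \<in> {x \<in> interior I. T x \<in> C}" using yI by simp
  qed
qed

text \<open>Up to a null set a union of label cylinders is a union of members of
  \<open>join_part\<close>, and there are only countably many words over \<open>P\<close>, so it
  belongs to \<open>sigma_join\<close>. The rate does not depend on the length or on the set of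
  words.\<close>

lemma alpha_mixing_cyl:
  assumes "alpha_mixing T \<mu> P"
  obtains \<alpha> :: "nat \<Rightarrow> real" where "\<alpha> \<longlonglongrightarrow> 0"
    "\<And>l n W B. l \<ge> 1 \<Longrightarrow> B \<in> sets \<mu> \<Longrightarrow> \<bar>prob (cyl l W \<inter> preim T (n + l) B) - prob (cyl l W) * prob B\<bar> \<le> \<alpha> n"
proof -
  obtain \<alpha> where \<alpha>: "\<alpha> \<longlonglongrightarrow> 0" and mix: "\<And>l n A B. l \<ge> 1 \<Longrightarrow> A \<in> sigma_join T P l \<Longrightarrow> B \<in> sets borel01 \<Longrightarrow>
      \<bar>prob (A \<inter> preim T (n + l) B) - prob A * prob B\<bar> \<le> \<alpha> n"
    using assms unfolding alpha_mixing_def by blast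
  have "\<bar>prob (cyl l W \<inter> preim T (n + l) B) - prob (cyl l W) * prob B\<bar> \<le> \<alpha> n"
    if l: "l \<ge> 1" and B: "B \<in> sets \<mu>" for l n W B
  proof -
    define Z where "Z w = (\<Inter>j<l. preim T j (w ! j))" for w
    define A where "A = (\<Union>w\<in>W \<inter> words P l. Z w)"
    have Zj: "Z w \<in> join_part T P l" if "w \<in> words P l" for w
    proof -
      have "\<forall>j<l. w ! j \<in> P" using that by (auto simp: words_def)
      then show ?thesis unfolding join_part_def Z_def by blast
    qed
    have Zs: "Z w \<in> sets \<mu>" if "w \<in> words P l" for w
    proof -
      have "preim T j (w ! j) \<in> sets \<mu>" if "j < l" for j
      proof -
        have "w ! j \<in> P" using that \<open>w \<in> words P l\<close> by (auto simp: words_def)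
        then show ?thesis unfolding preim_def using measurable_sets[OF Tn_meas P_borel, of "w ! j" j] by simp
      qed
      then show ?thesis unfolding Z_def using l by (intro sets.finite_INT) (auto simp: lessThan_empty_iff)
    qed
    have "words P l \<subseteq> lists P" by (auto simp: words_def lists_eq_set)
    then have cw: "countable (W \<inter> words P l)"
      using P_count by (meson countable_lists countable_subset inf_le2 order_trans)
    have sub: "join_part T P l \<subseteq> Pow {0..1}"
      using l by (auto simp: join_part_def preim_def lessThan_empty_iff)
    have As: "A \<in> sigma_join T P l"
      unfolding A_def sigma_join_def
      by (rule sigma_sets_UNION) (use cw Zj sub in \<open>auto intro: sigma_sets.Basic\<close>)
    have Am: "A \<in> sets \<mu>" unfolding A_def using cw Zs by (intro sets.countable_UN') auto
    have ae: "AE x in \<mu>. x \<in> A \<longleftrightarrow> x \<in> cyl l W"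
      using AE_all_Tn[OF AE_branch_mem] AE_itin_words[of l] AE_space
    proof eventually_elim
      case (elim x)
      have "x \<in> Z w \<longleftrightarrow> itin T (branch P) l x = w" if "w \<in> words P l" for w
      proof -
        have "w ! j \<in> P" if "j < l" for j using that \<open>w \<in> words P l\<close> by (auto simp: words_def)
        then have "x \<in> Z w \<longleftrightarrow> (\<forall>j<l. branch P ((T ^^ j) x) = w ! j)"
          unfolding Z_def preim_def using elim(1,3) l by auto
        then show ?thesis using that by (auto simp: list_eq_iff_nth_eq nth_itin words_def)
      qed
      then show ?case using elim(2,3) by (auto simp: A_def)
    qed
    have pB: "preim T (n + l) B \<in> sets \<mu>"
      unfolding preim_def using measurable_sets[OF Tn_meas B, of "n + l"] by simp
    have "prob A = prob (cyl l W)" using ae Am cyl_sets by (intro finite_measure_eq_AE) auto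
    moreover have "prob (A \<inter> preim T (n + l) B) = prob (cyl l W \<inter> preim T (n + l) B)"
    proof (rule finite_measure_eq_AE)
      show "AE x in \<mu>. x \<in> A \<inter> preim T (n + l) B \<longleftrightarrow> x \<in> cyl l W \<inter> preim T (n + l) B"
        using ae by eventually_elim auto
    qed (use Am pB cyl_sets in auto)
    ultimately show ?thesis using mix[OF l As, of B n] B sets_mu by simp
  qed
  then show ?thesis using that \<alpha> by blast
qed

lemma prob_diff_le:
  assumes "A \<in> sets \<mu>" "B \<in> sets \<mu>" "C \<in> sets \<mu>"
  shows "\<bar>prob (A \<inter> C) - prob (B \<inter> C)\<bar> \<le> prob ((A - B) \<union> (B - A))"
proof -
  have "prob (A \<inter> C) \<le> prob (B \<inter> C) + prob ((A - B) \<union> (B - A))" if "A \<in> sets \<mu>" "B \<in> sets \<mu>" for A B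
  proof -
    have "prob (A \<inter> C) \<le> prob ((B \<inter> C) \<union> ((A - B) \<union> (B - A)))"
      using that assms by (intro finite_measure_mono) auto
    also have "\<dots> \<le> prob (B \<inter> C) + prob ((A - B) \<union> (B - A))"
      using that assms by (intro measure_Un_le) auto
    finally show ?thesis .
  qed
  from this[of A B] this[of B A] assms show ?thesis by (simp add: Un_commute abs_le_iff)
qed

text \<open>Only the first set has to be approximated by cylinders, because \<alpha>-mixing already
  allows an arbitrary second set.\<close>

lemma alpha_mixing_imp_mixing:
  assumes "alpha_mixing T \<mu> P" shows "mixing_pmp \<mu> T"
proof unfold_locales
  fix A B assume A: "A \<in> sets \<mu>" and B: "B \<in> sets \<mu>"
  obtain \<alpha> :: "nat \<Rightarrow> real" where \<alpha>: "\<alpha> \<longlonglongrightarrow> 0"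
    "\<And>l n W B. l \<ge> 1 \<Longrightarrow> B \<in> sets \<mu> \<Longrightarrow> \<bar>prob (cyl l W \<inter> preim T (n + l) B) - prob (cyl l W) * prob B\<bar> \<le> \<alpha> n"
    using alpha_mixing_cyl[OF assms] by blast
  have pB: "preim T n B \<in> sets \<mu>" for n
    unfolding preim_def using measurable_sets[OF Tn_meas B, of n] by simp
  have "(\<lambda>n. prob (A \<inter> preim T n B)) \<longlonglongrightarrow> prob A * prob B"
  proof (rule LIMSEQ_I)
    fix e :: real assume e: "e > 0"
    obtain m W where mW: "prob ((A - cyl m W) \<union> (cyl m W - A)) < e / 4"
      using approx_cyl[OF A, of "e / 4"] e by auto
    \<comment> \<open>The approximating length may be 0, whereas \<alpha>-mixing speaks of lengths
      of at least 1; one irrelevant letter is appended.\<close>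
    define W' where "W' = {w. take m w \<in> W}"
    have cy: "cyl m W = cyl (Suc m) W'" using take_itin[of m "Suc m" T "branch P"] by (auto simp: W'_def simp del: itin.simps)
    obtain N where N: "\<And>n. n \<ge> N \<Longrightarrow> \<bar>\<alpha> n\<bar> < e / 4"
      using LIMSEQ_D[OF \<alpha>(1), of "e / 4"] e by auto
    have "norm (prob (A \<inter> preim T n B) - prob A * prob B) < e" if n: "n \<ge> N + Suc m" for n
    proof -
      define k where "k = n - Suc m"
      have k: "n = k + Suc m" "k \<ge> N" using n by (auto simp: k_def)
      have "\<bar>prob (cyl m W \<inter> preim T n B) - prob (cyl m W) * prob B\<bar> \<le> \<alpha> k"
        unfolding cy k(1) by (rule \<alpha>(2)) (use B in auto)
      moreover have "\<bar>prob (A \<inter> preim T n B) - prob (cyl m W \<inter> preim T n B)\<bar> < e / 4"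
        using prob_diff_le[OF A cyl_sets pB] mW by (rule le_less_trans)
      moreover have "\<bar>prob A * prob B - prob (cyl m W) * prob B\<bar> < e / 4"
      proof -
        have "\<bar>prob (A \<inter> space \<mu>) - prob (cyl m W \<inter> space \<mu>)\<bar> < e / 4"
          using prob_diff_le[OF A cyl_sets sets.top] mW by (rule le_less_trans)
        then have "\<bar>prob A - prob (cyl m W)\<bar> < e / 4"
          using A cyl_sets by (simp only: sets.Int_space_eq2)
        moreover have "\<bar>prob A * prob B - prob (cyl m W) * prob B\<bar> = \<bar>prob A - prob (cyl m W)\<bar> * prob B"
          by (simp add: abs_mult left_diff_distrib[symmetric])
        moreover have "\<dots> \<le> \<bar>prob A - prob (cyl m W)\<bar> * 1" by (intro mult_left_mono) auto
        ultimately show ?thesis by simp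
      qed
      ultimately show ?thesis using N[OF k(2)] e unfolding real_norm_def by linarith
    qed
    then show "\<exists>no. \<forall>n\<ge>no. norm (prob (A \<inter> preim T n B) - prob A * prob B) < e" by blast
  qed
  then show "(\<lambda>n. prob (A \<inter> ((T ^^ n) -` B \<inter> space \<mu>))) \<longlonglongrightarrow> prob A * prob B"
    by (simp add: preim_def)
qed

end

section \<open>Rates of the interval partition\<close>

lemma summable_on_tail:
  fixes \<phi> :: "'b \<Rightarrow> real"
  assumes "\<phi> summable_on A" "\<eta> > 0"
  obtains F where "finite F" "F \<subseteq> A" "infsum \<phi> (A - F) < \<eta>"
proof -
  have "(sum \<phi> \<longlongrightarrow> infsum \<phi> A) (finite_subsets_at_top A)"
    using has_sum_infsum[OF assms(1)] by (simp add: has_sum_def)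
  then have "\<forall>\<^sub>F F in finite_subsets_at_top A. infsum \<phi> A - \<eta> < sum \<phi> F"
    using assms(2) by (intro order_tendstoD(1)[where a = "infsum \<phi> A - \<eta>"]) auto
  then obtain F where F: "finite F" "F \<subseteq> A" "infsum \<phi> A - \<eta> < sum \<phi> F"
    unfolding eventually_finite_subsets_at_top by blast
  have "infsum \<phi> (A - F) = infsum \<phi> A - infsum \<phi> F"
    using assms(1) F by (intro infsum_Diff) auto
  then show ?thesis using that F by auto
qed

context class_T begin

lemma prob_interior: "I \<in> P \<Longrightarrow> prob (interior I) = prob I"
  using AE_branch_mem branch_eq_iff intI_sets P_borel
  by (intro finite_measure_eq_AE) (auto elim!: eventually_mono)

text \<open>Keep finitely many intervals and lump everything else into one cell. Once the cell is
  known, information about the branch is missing only in the lumped cell, and coding it there by its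
  unconditional probability costs on average a tail of the entropy series.\<close>

lemma upper_rate_branch:
  assumes mix: "mixing_pmp \<mu> T" and c: "ks_entropy \<mu> T < ereal c"
  shows "upper_rate (branch P) c"
proof -
  obtain c1 where c1: "ks_entropy \<mu> T < ereal c1" "c1 < c"
    using ereal_dense2[OF c] by auto
  have "\<exists>(R :: real \<Rightarrow> real set) w. labelling \<mu> R \<and> upper_rate R c1 \<and> cond_code R (branch P) w \<eta>" if \<eta>: "\<eta> > 0" for \<eta>
  proof -
    define \<phi> where "\<phi> I = - prob I * ln (prob I)" for I
    have \<phi>: "\<phi> summable_on P" using in_class unfolding in_class_T_def \<phi>_def by blast
    have \<phi>0: "\<phi> I \<ge> 0" for I
      unfolding \<phi>_def by (cases "prob I = 0") (auto intro!: mult_nonneg_nonpos simp: ln_le_zero_iff less_le)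
    obtain F where F: "finite F" "F \<subseteq> P" "infsum \<phi> (P - F) < \<eta>"
      using summable_on_tail[OF \<phi> \<eta>] by blast
    define rest where "rest = {0..1} - (\<Union>I\<in>F. interior I)"
    define Q where "Q = insert rest (interior ` F)"
    have rest_sets: "rest \<in> sets \<mu>"
    proof -
      have "space \<mu> - (\<Union>I\<in>F. interior I) \<in> sets \<mu>"
        using intI_sets F by (intro sets.Diff sets.top sets.finite_UN) auto
      then show ?thesis by (simp add: rest_def)
    qed
    have Q: "finite_meas_partition \<mu> Q"
      unfolding finite_meas_partition_def
    proof (intro conjI)
      show "finite Q" using F by (simp add: Q_def)
      show "Q \<subseteq> sets \<mu>" using rest_sets intI_sets F by (auto simp: Q_def)
      show "disjoint Q" using F P_disj unfolding disjoint_def Q_def rest_def by blast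
      show "\<Union>Q = space \<mu>"
        using F interior_01 by (auto simp: Q_def rest_def simp del: atLeastAtMost_iff)
    qed
    note cl = finite_meas_partition_cell[OF Q]
    have "ereal (entropy_part \<mu> T Q) \<le> ks_entropy \<mu> T"
      unfolding ks_entropy_def using Q by (intro SUP_upper) simp
    then have "entropy_part \<mu> T Q < c1" using c1(1) by (metis ereal_less_eq(3) le_less_trans less_ereal.simps(1))
    then have up: "upper_rate (cell Q) c1"
      by (rule finite_partition_rates(2)[OF mix space_mu Q])
    have rest_ne: "interior I \<noteq> rest" if "I \<in> F" for I
      using P_int F that by (auto simp: rest_def)
    have R_rest: "cell Q x = rest \<longleftrightarrow> x \<in> rest" if "x \<in> {0..1}" for x
      using cl(4)[of x rest] that by (simp add: Q_def)
    have R_F: "cell Q x = interior I" if "x \<in> interior I" "I \<in> F" for x I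
      using cl(4)[of x "interior I"] that interior_01[of I x] F by (auto simp: Q_def)
    \<comment> \<open>On \<open>rest\<close> the code ignores its condition and uses the probability
      of the interval; elsewhere the cell determines the branch. The weights of the dummy label are
      0, which is harmless because almost no point carries it.\<close>
    define w where "w r s = (if s \<in> P then if r = rest then prob (interior s) else if r = interior s then 1 else 0 else 0)" for r s
    have w0: "w r s \<ge> 0" for r s by (simp add: w_def)
    have w1: "(\<Sum>s\<in>V. w r s) \<le> 1" if V: "finite V" for r V
    proof (cases "r = rest")
      case True
      have "(\<Sum>s\<in>V. w r s) = (\<Sum>s\<in>V. if s \<in> P then prob (interior s) else 0)"
        by (intro sum.cong refl) (simp add: w_def True)
      also have "\<dots> = (\<Sum>s\<in>V \<inter> P. prob (interior s))" by (rule sum.inter_restrict[OF V, symmetric])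
      also have "\<dots> = prob (\<Union>s\<in>V \<inter> P. interior s)"
        using V intI_sets P_disj
        by (intro finite_measure_finite_Union[symmetric]) (auto simp: disjoint_family_on_def)
      finally show ?thesis by simp
    next
      case False
      show ?thesis
      proof (cases "\<exists>s0\<in>P. r = interior s0")
        case True
        then obtain s0 where s0: "s0 \<in> P" "r = interior s0" by blast
        have "w r s = (if s = s0 then 1 else 0)" for s
          using False s0 P_disj[of s s0] P_int[of s0] unfolding w_def by auto
        then have "(\<Sum>s\<in>V. w r s) = (if s0 \<in> V then 1 else 0)" using V by simp
        then show ?thesis by simp
      next
        case none: False
        then have "w r s = 0" for s using False by (auto simp: w_def)
        then show ?thesis by simp
      qed
    qed
    define g where "g = (\<lambda>x. - ln (w (cell Q x) (branch P x)))"
    have g_alt: "g = (\<lambda>x. (\<lambda>(r, s). - ln (w r s)) (cell Q x, branch P x))" by (simp add: g_def)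
    have g_meas: "g \<in> borel_measurable \<mu>"
      unfolding g_alt by (rule labelling_borel[OF labelling_pair[OF cl(2) labelling_branch]])
    have w_le1: "w r s \<le> 1" for r s using w1[of "{s}" r] by simp
    have g0: "g x \<ge> 0" for x
      using w0[of "cell Q x" "branch P x"] w_le1[of "cell Q x" "branch P x"] unfolding g_def
      by (cases "w (cell Q x) (branch P x) = 0") (auto simp: ln_le_zero_iff less_le)
    have w_val: "w (cell Q x) (branch P x) = (if branch P x \<in> F then 1 else prob (branch P x))"
      if x: "x \<in> {0..1}" "branch P x \<in> P" for x
    proof (cases "branch P x \<in> F")
      case True
      then have "cell Q x = interior (branch P x)" using R_F x branch_eq_iff by blast
      then show ?thesis using True x rest_ne by (auto simp: w_def)
    next
      case False
      have xb: "x \<in> interior (branch P x)" using x branch_eq_iff by blast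
      have "x \<notin> interior I" if "I \<in> F" for I
        using branch_eq_iff[of I x] that F False by auto
      then have "x \<in> rest" using x by (auto simp: rest_def)
      then show ?thesis using False x R_rest by (simp add: w_def prob_interior)
    qed
    have ae0: "AE x in \<mu>. \<forall>I\<in>P. prob I = 0 \<longrightarrow> x \<notin> I"
    proof (rule AE_ball_countable[THEN iffD2, OF P_count], rule ballI)
      fix I assume I: "I \<in> P"
      show "AE x in \<mu>. prob I = 0 \<longrightarrow> x \<notin> I"
        using prob_eq_0[OF P_borel[OF I]] by (cases "prob I = 0") auto
    qed
    have pos: "AE x in \<mu>. w (cell Q x) (branch P x) > 0"
      using ae0 AE_branch AE_space
    proof eventually_elim
      case (elim x)
      then have "x \<in> branch P x" using branch_eq_iff interior_subset by blast
      then have "prob (branch P x) \<noteq> 0" using elim by blast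
      then show ?case using w_val[of x] elim by (simp add: less_le)
    qed
    let ?D = "P - F"
    \<comment> \<open>Points with a branch in \<open>F\<close> contribute nothing. Splitting the
      others by their branch and exchanging integral and sum identifies the mean cost with the tail
      sum; doing so for nonnegative integrals also proves integrability.\<close>
    have "(\<integral>\<^sup>+x. ennreal (g x) \<partial>\<mu>)
        = (\<integral>\<^sup>+x. \<integral>\<^sup>+I. ennreal (- ln (prob I)) * indicator {y \<in> space \<mu>. branch P y = I} x \<partial>count_space ?D \<partial>\<mu>)"
    proof (rule nn_integral_cong_AE)
      show "AE x in \<mu>. ennreal (g x) = (\<integral>\<^sup>+I. ennreal (- ln (prob I)) * indicator {y \<in> space \<mu>. branch P y = I} x \<partial>count_space ?D)"
        using AE_branch AE_space
      proof eventually_elim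
        case (elim x)
        let ?J = "branch P x"
        have "(\<integral>\<^sup>+I. ennreal (- ln (prob I)) * indicator {y \<in> space \<mu>. branch P y = I} x \<partial>count_space ?D)
            = (\<integral>\<^sup>+I. ennreal (- ln (prob ?J)) * indicator (?D \<inter> {?J}) I \<partial>count_space ?D)"
          using elim by (intro nn_integral_cong) (auto simp: indicator_def)
        also have "\<dots> = ennreal (- ln (prob ?J)) * emeasure (count_space ?D) (?D \<inter> {?J})"
          by (subst nn_integral_cmult_indicator) auto
        also have "\<dots> = ennreal (g x)"
          unfolding g_def using elim w_val[of x] by (cases "?J \<in> F") auto
        finally show ?case by simp
      qed
    qed
    also have "\<dots> = (\<integral>\<^sup>+I. \<integral>\<^sup>+x. ennreal (- ln (prob I)) * indicator {y \<in> space \<mu>. branch P y = I} x \<partial>\<mu> \<partial>count_space ?D)"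
    proof (rule nn_integral_count_space_nn_integral)
      show "countable ?D" using P_count by (rule countable_subset[rotated]) auto
      fix I assume "I \<in> ?D"
      show "(\<lambda>x. ennreal (- ln (prob I)) * indicator {y \<in> space \<mu>. branch P y = I} x) \<in> borel_measurable \<mu>"
        using labelling_sets[OF labelling_branch, of "{I}"]
        by (intro borel_measurable_times_ennreal borel_measurable_const borel_measurable_indicator) simp
    qed
    also have "\<dots> = (\<integral>\<^sup>+I. ennreal (\<phi> I) \<partial>count_space ?D)"
    proof (rule nn_integral_cong)
      fix I assume "I \<in> space (count_space ?D)"
      then have I: "I \<in> P" by simp
      have eq: "{y \<in> space \<mu>. branch P y = I} = interior I"
        using branch_eq_iff[OF I] interior_01[OF I] by (auto simp del: atLeastAtMost_iff)
      have "0 \<le> - ln (prob I)" by (cases "prob I = 0") (auto simp: ln_le_zero_iff less_le)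
      then show "(\<integral>\<^sup>+x. ennreal (- ln (prob I)) * indicator {y \<in> space \<mu>. branch P y = I} x \<partial>\<mu>) = ennreal (\<phi> I)"
        unfolding eq using intI_sets[OF I]
        by (subst nn_integral_cmult_indicator)
           (auto simp: emeasure_eq_measure prob_interior[OF I] \<phi>_def ennreal_mult''[symmetric] mult.commute)
    qed
    also have "\<dots> = ennreal (infsum \<phi> ?D)"
    proof -
      have "\<phi> summable_on ?D" using \<phi> by (rule summable_on_subset_banach) auto
      then have "Infinite_Set_Sum.abs_summable_on \<phi> ?D"
        using summable_on_iff_abs_summable_on_real abs_summable_equivalent by blast
      then show ?thesis using \<phi>0 by (simp add: nn_integral_conv_infsetsum infsetsum_infsum)
    qed
    finally have nn: "(\<integral>\<^sup>+x. ennreal (g x) \<partial>\<mu>) = ennreal (infsum \<phi> ?D)" .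
    have gi: "integrable \<mu> g"
      using g_meas g0 nn by (intro integrableI_nonneg) auto
    have "expectation g = enn2real (ennreal (infsum \<phi> ?D))"
      unfolding nn[symmetric] using g_meas g0 by (intro integral_eq_nn_integral) auto
    then have Eg: "expectation g \<le> \<eta>" using F(3) infsum_nonneg[of ?D \<phi>] \<phi>0 by simp
    have "cond_code (cell Q) (branch P) w \<eta>"
      unfolding cond_code_def
    proof (intro conjI allI impI)
      show "0 \<le> w r s" for r s by (rule w0)
      show "sum (w r) V \<le> 1" if "finite V" for r V using w1[OF that] .
    qed (fact pos, fact gi[unfolded g_def], fact Eg[unfolded g_def])
    then show ?thesis using cl(2) up by blast
  qed
  then show ?thesis by (rule upper_rate_refine[OF labelling_branch c1(2)])
qed

text \<open>Some finite partition has entropy above \<open>c\<close>. Its cells are approximated by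
  cylinders, so a long enough block of branches names the cell with small error probability, and a
  label with few errors is a cheap code.\<close>

lemma lower_rate_branch:
  assumes mix: "mixing_pmp \<mu> T" and c: "ereal c < ks_entropy \<mu> T"
  shows "lower_rate (branch P) c"
proof -
  obtain Q where Q: "finite_meas_partition \<mu> Q" "c < entropy_part \<mu> T Q"
    using c unfolding ks_entropy_def less_SUP_iff by auto
  obtain c1 where c1: "c < c1" "c1 < entropy_part \<mu> T Q" using dense[OF Q(2)] by blast
  note cl = finite_meas_partition_cell[OF Q(1)]
  have low: "lower_rate (cell Q) c1"
    by (rule finite_partition_rates(3)[OF mix space_mu Q(1) c1(2)])
  have "\<exists>m (\<psi> :: real set list \<Rightarrow> real set) w. cond_code (\<lambda>x. \<psi> (itin T (branch P) m x)) (cell Q) w \<eta>"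
    if \<eta>: "\<eta> > 0" for \<eta>
  proof -
    obtain \<epsilon> where \<epsilon>: "\<epsilon> > 0" "\<And>R. labelling \<mu> R \<Longrightarrow> prob {x \<in> space \<mu>. R x \<noteq> cell Q x} < \<epsilon> \<Longrightarrow> \<exists>w. cond_code R (cell Q) w \<eta>"
      using cond_code_of_error[OF cl(2,3) \<eta>] by blast
    have finQ: "finite Q" and Qs: "Q \<subseteq> sets \<mu>" using Q(1) by (auto simp: finite_meas_partition_def)
    define e where "e = \<epsilon> / (2 * real (Suc (card Q)))"
    have e: "e > 0" using \<epsilon>(1) by (simp add: e_def)
    have "\<forall>C\<in>Q. \<exists>v. prob ((C - cyl (fst v) (snd v)) \<union> (cyl (fst v) (snd v) - C)) < e"
    proof
      fix C assume "C \<in> Q"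
      then obtain m W where "prob ((C - cyl m W) \<union> (cyl m W - C)) < e"
        using approx_cyl[of C e] Qs e by blast
      then show "\<exists>v. prob ((C - cyl (fst v) (snd v)) \<union> (cyl (fst v) (snd v) - C)) < e"
        by (intro exI[of _ "(m, W)"]) simp
    qed
    from bchoice[OF this] obtain v where
      v: "\<forall>C\<in>Q. prob ((C - cyl (fst (v C)) (snd (v C))) \<union> (cyl (fst (v C)) (snd (v C)) - C)) < e" ..
    define m where "m C = fst (v C)" for C
    define W where "W C = snd (v C)" for C
    have mW: "prob ((C - cyl (m C) (W C)) \<union> (cyl (m C) (W C) - C)) < e" if "C \<in> Q" for C
      using v that by (simp only: m_def W_def)
    define n where "n = (\<Sum>C\<in>Q. m C)"
    have mn: "m C \<le> n" if "C \<in> Q" for C unfolding n_def using that finQ by (intro member_le_sum) auto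
    \<comment> \<open>Off the bad set the block passes the test of exactly one cell, the true one;
      the value elsewhere does not matter.\<close>
    define \<psi> where "\<psi> v = (THE C. C \<in> Q \<and> take (m C) v \<in> W C)" for v
    let ?bad = "\<Union>C\<in>Q. (C - cyl (m C) (W C)) \<union> (cyl (m C) (W C) - C)"
    have bad: "?bad \<in> sets \<mu>" using finQ Qs cyl_sets by (intro sets.finite_UN) auto
    have "{x \<in> space \<mu>. \<psi> (itin T (branch P) n x) \<noteq> cell Q x} \<subseteq> ?bad"
    proof (rule ccontr)
      assume "\<not> ?thesis"
      then obtain x where x: "x \<in> space \<mu>" "\<psi> (itin T (branch P) n x) \<noteq> cell Q x" "x \<notin> ?bad" by blast
      have iff: "take (m C) (itin T (branch P) n x) \<in> W C \<longleftrightarrow> cell Q x = C" if C: "C \<in> Q" for C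
        using x(1,3) C cl(4)[OF x(1) C] by (auto simp: take_itin[OF mn[OF C]])
      have "\<psi> (itin T (branch P) n x) = cell Q x"
        unfolding \<psi>_def using iff cl(1)[OF x(1)] by (intro the_equality) auto
      then show False using x(2) by simp
    qed
    then have "prob {x \<in> space \<mu>. \<psi> (itin T (branch P) n x) \<noteq> cell Q x} \<le> prob ?bad"
      using bad by (intro finite_measure_mono) auto
    also have "\<dots> \<le> (\<Sum>C\<in>Q. prob ((C - cyl (m C) (W C)) \<union> (cyl (m C) (W C) - C)))"
      using finQ Qs cyl_sets by (intro finite_measure_subadditive_finite) auto
    also have "\<dots> \<le> (\<Sum>C\<in>Q. e)" using mW by (intro sum_mono less_imp_le)
    also have "\<dots> \<le> real (Suc (card Q)) * e" using e by simp
    also have "\<dots> = \<epsilon> / 2" by (simp add: e_def divide_simps)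
    also have "\<dots> < \<epsilon>" using \<epsilon> by simp
    finally have "\<exists>w. cond_code (\<lambda>x. \<psi> (itin T (branch P) n x)) (cell Q) w \<eta>"
      by (intro \<epsilon>(2) labelling_comp[OF labelling_itin[OF labelling_branch]])
    then show ?thesis by blast
  qed
  then show ?thesis by (rule lower_rate_refine[OF cl(2) labelling_branch c1(1) low])
qed

text \<open>Together with finiteness this makes \<open>real_of_ereal\<close> faithful; the sign
  itself is needed to compare growth with and without the term of the map with index 0.\<close>

lemma ks_entropy_nonneg:
  assumes mix: "mixing_pmp \<mu> T" shows "ks_entropy \<mu> T \<ge> 0"
proof -
  have Q: "finite_meas_partition \<mu> {space \<mu>}"
    unfolding finite_meas_partition_def by (auto simp: disjoint_def simp del: space_mu)
  have "0 \<le> ereal (entropy_part \<mu> T {space \<mu>})"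
    using finite_partition_rates(1)[OF mix space_mu Q] by simp
  also have "\<dots> \<le> ks_entropy \<mu> T"
    unfolding ks_entropy_def using Q by (intro SUP_upper) simp
  finally show ?thesis .
qed

end

section \<open>Sets cutting few intervals\<close>

text \<open>A substitute for counting endpoints that is stable under complements and additive under unions,
  so that sets need not be decomposed into intervals.\<close>
definition few_cuts :: "real set \<Rightarrow> real \<Rightarrow> bool" where
  "few_cuts S K \<longleftrightarrow> (\<forall>\<C>. finite \<C> \<and> disjoint \<C> \<and> (\<forall>C\<in>\<C>. is_interval C) \<longrightarrow>
     real (card {C\<in>\<C>. C \<inter> S \<noteq> {} \<and> \<not> C \<subseteq> S}) \<le> K)"

lemma few_cutsD:
  "few_cuts S K \<Longrightarrow> finite \<C> \<Longrightarrow> disjoint \<C> \<Longrightarrow> (\<And>C. C \<in> \<C> \<Longrightarrow> is_interval C) \<Longrightarrow>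
     real (card {C\<in>\<C>. C \<inter> S \<noteq> {} \<and> \<not> C \<subseteq> S}) \<le> K"
  unfolding few_cuts_def by blast

lemma few_cuts_mono: "few_cuts S K \<Longrightarrow> K \<le> K' \<Longrightarrow> few_cuts S K'"
  unfolding few_cuts_def by (meson order_trans)

lemma few_cuts_compl: "few_cuts S K \<Longrightarrow> few_cuts (- S) K"
proof -
  have "{C\<in>\<C>. C \<inter> - S \<noteq> {} \<and> \<not> C \<subseteq> - S} = {C\<in>\<C>. C \<inter> S \<noteq> {} \<and> \<not> C \<subseteq> S}" for \<C> :: "real set set"
    by auto
  then show "few_cuts S K \<Longrightarrow> few_cuts (- S) K" unfolding few_cuts_def by simp
qed

text \<open>An interval that meets the union without lying inside it meets one of the two sets, and
  does not lie inside that one either.\<close>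

lemma few_cuts_Un:
  assumes "few_cuts S K" "few_cuts S' K'" shows "few_cuts (S \<union> S') (K + K')"
  unfolding few_cuts_def
proof (intro allI impI)
  fix \<C> :: "real set set" assume C: "finite \<C> \<and> disjoint \<C> \<and> (\<forall>C\<in>\<C>. is_interval C)"
  let ?X = "\<lambda>S. {C\<in>\<C>. C \<inter> S \<noteq> {} \<and> \<not> C \<subseteq> S}"
  have "card (?X (S \<union> S')) \<le> card (?X S \<union> ?X S')" using C by (intro card_mono) auto
  also have "\<dots> \<le> card (?X S) + card (?X S')" by (rule card_Un_le)
  finally have "real (card (?X (S \<union> S'))) \<le> real (card (?X S)) + real (card (?X S'))" by linarith
  also have "\<dots> \<le> K + K'" using C by (intro add_mono few_cutsD[OF assms(1)] few_cutsD[OF assms(2)]) auto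
  finally show "real (card (?X (S \<union> S'))) \<le> K + K'" .
qed

lemma few_cuts_Int:
  assumes "few_cuts S K" "few_cuts S' K'" shows "few_cuts (S \<inter> S') (K + K')"
  using few_cuts_compl[OF few_cuts_Un[OF few_cuts_compl[OF assms(1)] few_cuts_compl[OF assms(2)]]] by simp

lemma few_cuts_empty: "few_cuts {} 0"
  by (simp add: few_cuts_def)

lemma few_cuts_UN:
  assumes "finite X" "\<And>x. x \<in> X \<Longrightarrow> few_cuts (S x) (K x)"
  shows "few_cuts (\<Union>x\<in>X. S x) (\<Sum>x\<in>X. K x)"
  using assms by (induction X rule: finite_induct) (auto simp: few_cuts_empty intro: few_cuts_Un)

lemma few_cuts_INT:
  assumes "finite X" "\<And>x. x \<in> X \<Longrightarrow> few_cuts (S x) (K x)"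
  shows "few_cuts (\<Inter>x\<in>X. S x) (\<Sum>x\<in>X. K x)"
  using few_cuts_compl[OF few_cuts_UN[of X "\<lambda>x. - S x" K]] assms few_cuts_compl by simp

text \<open>An interval cut by \<open>J\<close> sticks out of it on the left or on the right, and
  two intervals sticking out on the same side have a common point, so disjointness leaves one for
  each side.\<close>

lemma few_cuts_interval:
  assumes J: "is_interval (J :: real set)" shows "few_cuts J 2"
  unfolding few_cuts_def
proof (intro allI impI)
  fix \<C> :: "real set set" assume C: "finite \<C> \<and> disjoint \<C> \<and> (\<forall>C\<in>\<C>. is_interval C)"
  have iv: "y \<in> C" if "C \<in> insert J \<C>" "x \<in> C" "z \<in> C" "x \<le> y" "y \<le> z" for C x y z
    using C J that unfolding is_interval_1 by blast
  have dj: "C = C'" if "C \<in> \<C>" "C' \<in> \<C>" "x \<in> C" "x \<in> C'" for C C' x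
    using C that unfolding disjoint_def by blast
  define L where "L = {C\<in>\<C>. \<exists>c\<in>C. \<exists>j\<in>C \<inter> J. c \<notin> J \<and> c < j}"
  define R where "R = {C\<in>\<C>. \<exists>c\<in>C. \<exists>j\<in>C \<inter> J. c \<notin> J \<and> j < c}"
  have "C = C'" if CL: "C \<in> L" "C' \<in> L" for C C'
  proof -
    obtain c j where 1: "C \<in> \<C>" "c \<in> C" "j \<in> C" "j \<in> J" "c \<notin> J" "c < j" using CL by (auto simp: L_def)
    obtain c' j' where 2: "C' \<in> \<C>" "c' \<in> C'" "j' \<in> C'" "j' \<in> J" "c' \<notin> J" "c' < j'" using CL by (auto simp: L_def)
    \<comment> \<open>If, say, \<open>j \<le> c'\<close>, then \<open>c'\<close> would lie between
      two points of \<open>J\<close>. It follows that the smaller of \<open>j\<close> and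
      \<open>j'\<close> belongs to both intervals.\<close>
    have lt: "c' < j" "c < j'"
      using iv[of J j j' c'] iv[of J j' j c] 1 2 by force+
    show ?thesis
    proof (cases "j \<le> j'")
      case True
      then have "j \<in> C'" using iv[of C' c' j' j] 2 lt by auto
      then show ?thesis using dj 1 2 by blast
    next
      case False
      then have "j' \<in> C" using iv[of C c j j'] 1 lt by auto
      then show ?thesis using dj 1 2 by blast
    qed
  qed
  then have L: "card L \<le> 1" using C by (subst One_nat_def, subst card_le_Suc0_iff_eq) (auto simp: L_def)
  have "C = C'" if CR: "C \<in> R" "C' \<in> R" for C C'
  proof -
    obtain c j where 1: "C \<in> \<C>" "c \<in> C" "j \<in> C" "j \<in> J" "c \<notin> J" "j < c" using CR by (auto simp: R_def)
    obtain c' j' where 2: "C' \<in> \<C>" "c' \<in> C'" "j' \<in> C'" "j' \<in> J" "c' \<notin> J" "j' < c'" using CR by (auto simp: R_def)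
    have lt: "j < c'" "j' < c"
      using iv[of J j' j c'] iv[of J j j' c] 1 2 by force+
    show ?thesis
    proof (cases "j \<le> j'")
      case True
      then have "j' \<in> C" using iv[of C j c j'] 1 lt by auto
      then show ?thesis using dj 1 2 by blast
    next
      case False
      then have "j \<in> C'" using iv[of C' j' c' j] 2 lt by auto
      then show ?thesis using dj 1 2 by blast
    qed
  qed
  then have R: "card R \<le> 1" using C by (subst One_nat_def, subst card_le_Suc0_iff_eq) (auto simp: R_def)
  have "{C\<in>\<C>. C \<inter> J \<noteq> {} \<and> \<not> C \<subseteq> J} \<subseteq> L \<union> R"
  proof
    fix D assume "D \<in> {C\<in>\<C>. C \<inter> J \<noteq> {} \<and> \<not> C \<subseteq> J}"
    then obtain c j where "D \<in> \<C>" "c \<in> D" "c \<notin> J" "j \<in> D \<inter> J" by blast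
    moreover have "c < j \<or> j < c" using calculation by (metis IntD2 linorder_neqE)
    ultimately show "D \<in> L \<union> R" by (auto simp: L_def R_def)
  qed
  then have "card {C\<in>\<C>. C \<inter> J \<noteq> {} \<and> \<not> C \<subseteq> J} \<le> card (L \<union> R)" using C by (intro card_mono) (auto simp: L_def R_def)
  also have "\<dots> \<le> 2" using card_Un_le[of L R] L R by linarith
  finally show "real (card {C\<in>\<C>. C \<inter> J \<noteq> {} \<and> \<not> C \<subseteq> J}) \<le> 2" by simp
qed

text \<open>Traces of half-lines are intervals and generate the Borel sets, and the sets with some
  finite bound on their cuts form an algebra.\<close>

lemma approx_few_cuts:
  assumes M: "finite_measure M" "sets M = sets borel01" and B: "B \<in> sets M" and \<epsilon>: "\<epsilon> > 0"
  shows "\<exists>S\<in>sets M. \<exists>K. few_cuts S K \<and> measure M ((B - S) \<union> (S - B)) < \<epsilon>"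
proof -
  have sp: "space M = {0..1}" using sets_eq_imp_space_eq[OF M(2)] by simp
  define G where "G = {S \<in> sets M. \<exists>K. few_cuts S K}"
  have "B \<in> (\<inter>) {0..1} ` sigma_sets UNIV (range (\<lambda>a::real. {..a}))"
  proof -
    obtain B' where "B' \<in> sets borel" "B = {0..1} \<inter> B'"
      using B unfolding M(2) borel01_def sets_restrict_space by auto
    moreover have "sets borel = sigma_sets UNIV (range (\<lambda>a::real. {..a}))"
      by (subst borel_eq_atMost) simp
    ultimately show ?thesis by blast
  qed
  also have "\<dots> = sigma_sets {0..1} ((\<inter>) {0..1} ` range (\<lambda>a::real. {..a}))"
  proof (rule sigma_sets_Int)
    have "{0..1::real} \<in> sets borel" by simp
    then show "{0..1::real} \<in> sigma_sets UNIV (range atMost)" by (subst (asm) borel_eq_atMost) simp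
  qed simp
  also have "\<dots> \<subseteq> sigma_sets (space M) G"
    unfolding sp
  proof (rule sigma_sets_mono', rule image_subsetI, clarify)
    fix a :: real
    have "is_interval ({0..1} \<inter> {..a})" by (intro is_interval_Int) (auto simp: is_interval_cc is_interval_ic)
    then have "few_cuts ({0..1} \<inter> {..a}) 2" by (rule few_cuts_interval)
    moreover have "{0..1} \<inter> {..a} \<in> sets M" by (simp add: M(2) sets_borel01_iff)
    ultimately show "{0..1} \<inter> {..a} \<in> G" unfolding G_def by blast
  qed
  finally have S: "B \<in> sigma_sets (space M) G" .
  have compl: "space M - A \<in> G" if "A \<in> G" for A
  proof -
    obtain K where A: "A \<in> sets M" "few_cuts A K" using \<open>A \<in> G\<close> unfolding G_def by blast
    have "few_cuts ({0..1} \<inter> - A) (2 + K)"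
      by (intro few_cuts_Int few_cuts_interval few_cuts_compl A) (simp add: is_interval_cc)
    then show ?thesis using A unfolding G_def sp by (auto simp: Diff_eq[symmetric] sp[symmetric])
  qed
  have "B \<in> sets M \<and> (\<forall>\<epsilon>>0. \<exists>A\<in>G. measure M ((B - A) \<union> (A - B)) < \<epsilon>)"
    by (rule sigma_sets_approx[OF M(1) _ compl _ _ S]) (auto simp: G_def intro: few_cuts_Un few_cuts_empty)
  then show ?thesis using \<epsilon> unfolding G_def by blast
qed

section \<open>Preimages with few cuts, and cut cylinders\<close>

context class_T begin

text \<open>If \<open>A\<close> is nearly a union of cylinders of length \<open>m\<close>, then its
  preimage is nearly a union of cylinders of length \<open>n + m\<close>. Keeping only the typical
  ones leaves at most \<open>exp ((n + m) * c)\<close> intervals, each with two cuts, and by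
  invariance the first error does not grow with \<open>n\<close>.\<close>

lemma preim_few_cuts:
  assumes up: "upper_rate (branch P) c" and A: "A \<in> sets \<mu>" and \<delta>: "\<delta> > 0"
  obtains m where "\<forall>\<^sub>F n in sequentially. \<exists>U\<in>sets \<mu>. few_cuts U (2 * exp (real (n + m) * c)) \<and>
     prob ((preim T n A - U) \<union> (U - preim T n A)) \<le> \<delta>"
proof -
  obtain m W where mW: "prob ((A - cyl m W) \<union> (cyl m W - A)) < \<delta> / 2"
    using approx_cyl[OF A, of "\<delta> / 2"] \<delta> by auto
  have "\<forall>\<^sub>F n in sequentially. \<exists>V. finite V \<and> real (card V) \<le> exp (real n * c) \<and>
     prob {x \<in> space \<mu>. itin T (branch P) n x \<notin> V} \<le> \<delta> / 2"
    using up[unfolded upper_rate_def, rule_format, of "\<delta> / 2"] \<delta> by simp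
  then have "\<forall>\<^sub>F n in sequentially. \<exists>V. finite V \<and> real (card V) \<le> exp (real (n + m) * c) \<and>
     prob {x \<in> space \<mu>. itin T (branch P) (n + m) x \<notin> V} \<le> \<delta> / 2"
    by (subst eventually_sequentially_seg)
  then have "\<forall>\<^sub>F n in sequentially. \<exists>U\<in>sets \<mu>. few_cuts U (2 * exp (real (n + m) * c)) \<and>
     prob ((preim T n A - U) \<union> (U - preim T n A)) \<le> \<delta>"
  proof eventually_elim
    case (elim n)
    then obtain V where V: "finite V" "real (card V) \<le> exp (real (n + m) * c)"
      "prob {x \<in> space \<mu>. itin T (branch P) (n + m) x \<notin> V} \<le> \<delta> / 2" by blast
    \<comment> \<open>Only words over \<open>P\<close> are kept, since their cylinders are
      intervals; the others carry no mass.\<close>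
    define V' where "V' = {w \<in> V \<inter> words P (n + m). drop n w \<in> W}"
    define U where "U = (\<Union>w\<in>V'. {x \<in> space \<mu>. itin T (branch P) (n + m) x = w})"
    have U_eq: "U = cyl (n + m) V'" by (auto simp: U_def)
    have "few_cuts U (\<Sum>w\<in>V'. 2)"
      unfolding U_def by (intro few_cuts_UN few_cuts_interval cyl_interval) (auto simp: V'_def V)
    moreover have "(\<Sum>w\<in>V'. 2) \<le> 2 * exp (real (n + m) * c)"
    proof -
      have "card V' \<le> card V" using V by (intro card_mono) (auto simp: V'_def)
      then show ?thesis using V(2) by simp
    qed
    ultimately have fc: "few_cuts U (2 * exp (real (n + m) * c))" by (rule few_cuts_mono)
    let ?D = "(A - cyl m W) \<union> (cyl m W - A)"
    have D: "?D \<in> sets \<mu>" using A cyl_sets by auto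
    have tD: "preim T n ?D \<in> sets \<mu>" using measurable_sets[OF Tn_meas D, of n] by (simp add: preim_def)
    have bV: "{x \<in> space \<mu>. itin T (branch P) (n + m) x \<notin> V} \<in> sets \<mu>"
      using cyl_sets[of "n + m" "- V"] by simp
    have "prob ((preim T n A - U) \<union> (U - preim T n A))
        \<le> prob (preim T n ?D \<union> {x \<in> space \<mu>. itin T (branch P) (n + m) x \<notin> V})"
    proof (rule finite_measure_mono_AE)
      show "AE x in \<mu>. x \<in> (preim T n A - U) \<union> (U - preim T n A) \<longrightarrow>
          x \<in> preim T n ?D \<union> {x \<in> space \<mu>. itin T (branch P) (n + m) x \<notin> V}"
        using AE_itin_words[of "n + m"] AE_space
      proof eventually_elim
        case (elim x)
        have "(T ^^ n) x \<in> cyl m W \<longleftrightarrow> drop n (itin T (branch P) (n + m) x) \<in> W"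
          using Tn_space[OF elim(2), of n] by (simp add: drop_itin)
        then show ?case using elim unfolding U_eq V'_def preim_def
          by (auto simp del: atLeastAtMost_iff)
      qed
    qed (use tD bV in auto)
    also have "\<dots> \<le> prob (preim T n ?D) + prob {x \<in> space \<mu>. itin T (branch P) (n + m) x \<notin> V}"
      using tD bV by (intro measure_Un_le)
    also have "prob (preim T n ?D) = prob ?D" using prob_Tn[OF D, of n] by (simp add: preim_def)
    also have "\<dots> + prob {x \<in> space \<mu>. itin T (branch P) (n + m) x \<notin> V} \<le> \<delta>" using mW V(3) by simp
    finally show ?case using fc cyl_sets unfolding U_eq by blast
  qed
  then show ?thesis using that by blast
qed

text \<open>At most \<open>K\<close> cylinders of length \<open>l\<close> are cut by
  \<open>E\<close>, and so few have total mass at most \<delta>. All others lie inside or outside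
  \<open>E\<close>, hence \<open>E\<close> is a union of cylinders up to \<delta>. This error enters
  twice, with \<open>X\<close> and with the factor \<open>p\<close>.\<close>

lemma decouple:
  assumes E: "E \<in> sets \<mu>" "few_cuts E K" and K: "K \<le> exp (real l * c)"
    and low: "\<And>W. finite W \<Longrightarrow> real (card W) \<le> exp (real l * c) \<Longrightarrow> prob (cyl l W) \<le> \<delta>"
    and X: "X \<in> sets \<mu>" and \<alpha>: "\<And>W. \<bar>prob (cyl l W \<inter> X) - prob (cyl l W) * p\<bar> \<le> \<alpha>"
    and p: "0 \<le> p" "p \<le> 1"
  shows "\<bar>prob (E \<inter> X) - prob E * p\<bar> \<le> 2 * \<delta> + \<alpha>"
proof -
  define cw where "cw w = {x \<in> space \<mu>. itin T (branch P) l x = w}" for w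
  define S where "S = {w \<in> words P l. cw w \<inter> E \<noteq> {} \<and> \<not> cw w \<subseteq> E}"
  \<comment> \<open>\<open>few_cuts\<close> speaks of finite families, whereas there may be
    infinitely many cylinders; finiteness of \<open>S\<close> is deduced from the bound on its
    finite subsets.\<close>
  have cardS: "real (card F) \<le> exp (real l * c)" if F: "finite F" "F \<subseteq> S" for F
  proof -
    have inj: "inj_on cw F"
    proof (rule inj_onI)
      fix v w assume "v \<in> F" "w \<in> F" and e: "cw v = cw w"
      then obtain x where "x \<in> cw v" using F by (auto simp: S_def)
      then show "v = w" using e by (auto simp: cw_def)
    qed
    have "real (card {C\<in>cw ` F. C \<inter> E \<noteq> {} \<and> \<not> C \<subseteq> E}) \<le> K"
    proof (rule few_cutsD[OF E(2)])
      show "disjoint (cw ` F)" by (auto simp: disjoint_def cw_def)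
      fix C assume "C \<in> cw ` F"
      then show "is_interval C" using F(2) cyl_interval by (auto simp: cw_def S_def)
    qed (use F in auto)
    also have "{C\<in>cw ` F. C \<inter> E \<noteq> {} \<and> \<not> C \<subseteq> E} = cw ` F" using F by (auto simp: S_def)
    finally show ?thesis using K by (simp add: card_image[OF inj])
  qed
  have finS: "finite S"
  proof (rule ccontr)
    assume "infinite S"
    then obtain F where F: "finite F" "F \<subseteq> S" "card F = Suc (nat \<lceil>exp (real l * c)\<rceil>)"
      using infinite_arbitrarily_large by metis
    then show False using cardS[OF F(1,2)] by linarith
  qed
  have pS: "prob (cyl l S) \<le> \<delta>" using finS cardS by (intro low) auto
  define W where "W = {w \<in> words P l. cw w \<noteq> {} \<and> cw w \<subseteq> E}"
  have d: "prob ((E - cyl l W) \<union> (cyl l W - E)) \<le> \<delta>"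
  proof (rule order_trans[OF _ pS], rule finite_measure_mono_AE)
    show "AE x in \<mu>. x \<in> (E - cyl l W) \<union> (cyl l W - E) \<longrightarrow> x \<in> cyl l S"
      using AE_itin_words[of l] AE_space
    proof eventually_elim
      case (elim x)
      have "x \<in> cw (itin T (branch P) l x)" using elim by (simp add: cw_def)
      then show ?case using elim unfolding W_def S_def by (auto simp del: space_mu)
    qed
  qed (rule cyl_sets)
  have 1: "\<bar>prob (E \<inter> X) - prob (cyl l W \<inter> X)\<bar> \<le> \<delta>"
    using prob_diff_le[OF E(1) cyl_sets X] d by (rule order_trans)
  have "\<bar>prob (E \<inter> space \<mu>) - prob (cyl l W \<inter> space \<mu>)\<bar> \<le> \<delta>"
    using prob_diff_le[OF E(1) cyl_sets sets.top] d by (rule order_trans)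
  then have "\<bar>prob E - prob (cyl l W)\<bar> \<le> \<delta>"
    using E(1) cyl_sets by (simp only: sets.Int_space_eq2)
  then have "\<bar>prob E - prob (cyl l W)\<bar> * p \<le> \<delta> * 1" using p by (intro mult_mono) auto
  then have 2: "\<bar>prob E * p - prob (cyl l W) * p\<bar> \<le> \<delta>"
    using p by (simp add: left_diff_distrib[symmetric] abs_mult)
  show ?thesis using 1 2 \<alpha>[of W] by linarith
qed

end

section \<open>Decoupling\<close>

text \<open>The hypothesis says that the indicators of \<open>F n\<close> converge weakly to the
  constant \<open>p\<close> when tested on indicators. They are bounded, so this extends to
  integrable test functions, in particular to the density of \<open>N\<close> restricted to
  \<open>B\<close>.\<close>

lemma abs_cont_transfer:
  assumes M: "prob_space M" and N: "prob_space N" "sets N = sets M"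
    and null: "\<And>S. S \<in> sets M \<Longrightarrow> measure M S = 0 \<Longrightarrow> measure N S = 0"
    and F: "\<And>n. F n \<in> sets M" and p: "0 \<le> p" "p \<le> 1"
    and lim: "\<And>B. B \<in> sets M \<Longrightarrow> (\<lambda>n. measure M (B \<inter> F n)) \<longlonglongrightarrow> measure M B * p"
    and B: "B \<in> sets M"
  shows "(\<lambda>n. measure N (B \<inter> F n)) \<longlonglongrightarrow> measure N B * p"
proof -
  interpret M: prob_space M by fact
  interpret N: prob_space N by fact
  have weak: "(\<lambda>n. \<integral>x. f x * indicator (F n) x \<partial>M) \<longlonglongrightarrow> (\<integral>x. f x \<partial>M) * p"
    if "integrable M f" for f :: "'a \<Rightarrow> real"
    using that
  proof (induct rule: integrable_induct)
    case (base A c)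
    have "(\<lambda>n. c * measure M (A \<inter> F n)) \<longlonglongrightarrow> c * (measure M A * p)"
      using base by (intro tendsto_mult_left lim)
    moreover have "(\<integral>x. (indicator A x *\<^sub>R c) * indicator (F n) x \<partial>M) = c * measure M (A \<inter> F n)" for n
    proof -
      have "(\<integral>x. (indicator A x *\<^sub>R c) * indicator (F n) x \<partial>M) = (\<integral>x. c * indicator (A \<inter> F n) x \<partial>M)"
        by (intro Bochner_Integration.integral_cong) (auto simp: indicator_def)
      then show ?thesis using base F[of n] by simp
    qed
    moreover have "(\<integral>x. indicator A x *\<^sub>R c \<partial>M) = c * measure M A"
      using base by simp
    moreover have "A \<inter> space M = A" using base by (simp add: sets.Int_space_eq2)
    ultimately show ?case by (simp only: mult.assoc)
  next
    case (add f g)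
    have int: "integrable M (\<lambda>x. h x * indicator (F n) x)" if "integrable M h" for h :: "'a \<Rightarrow> real" and n
      using that F[of n] by (rule integrable_real_mult_indicator[rotated])
    have "(\<integral>x. (f x + g x) * indicator (F n) x \<partial>M) = (\<integral>x. f x * indicator (F n) x \<partial>M) + (\<integral>x. g x * indicator (F n) x \<partial>M)" for n
      using int[OF add(1), of n] int[OF add(3), of n] by (simp add: distrib_right)
    then show ?case using tendsto_add[OF add(2) add(4)] add(1,3) by (simp add: distrib_right)
  next
    case (lim f s)
    have int: "integrable M (\<lambda>x. h x * indicator (F n) x)" if "integrable M h" for h :: "'a \<Rightarrow> real" and n
      using that F[of n] by (rule integrable_real_mult_indicator[rotated])
    have close: "(\<lambda>i. \<integral>x. \<bar>s i x - f x\<bar> \<partial>M) \<longlonglongrightarrow> (\<integral>x. 0 \<partial>M)"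
    \<comment> \<open>The simple approximations satisfy
      \<open>\<bar>s i x\<bar> \<le> 2 * \<bar>f x\<bar>\<close>, whence the factor 3.\<close>
    proof (rule integral_dominated_convergence[where w = "\<lambda>x. 3 * \<bar>f x\<bar>"])
      show "integrable M (\<lambda>x. 3 * \<bar>f x\<bar>)" using lim(5) by simp
      show "(\<lambda>x. \<bar>s i x - f x\<bar>) \<in> borel_measurable M" for i
        using lim(1)[of i] lim(5) by measurable
      show "AE x in M. (\<lambda>i. \<bar>s i x - f x\<bar>) \<longlonglongrightarrow> 0"
        using lim(3) by (intro AE_I2 tendsto_rabs_zero) (simp add: LIM_zero)
      show "AE x in M. norm \<bar>s i x - f x\<bar> \<le> 3 * \<bar>f x\<bar>" for i
      proof (rule AE_I2)
        fix x assume "x \<in> space M"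
        from lim(4)[OF this, of i] show "norm \<bar>s i x - f x\<bar> \<le> 3 * \<bar>f x\<bar>" by simp
      qed
    qed simp
    have d1: "\<bar>(\<integral>x. f x * indicator (F n) x \<partial>M) - (\<integral>x. s i x * indicator (F n) x \<partial>M)\<bar> \<le> (\<integral>x. \<bar>s i x - f x\<bar> \<partial>M)" for i n
    proof -
      have "(\<integral>x. f x * indicator (F n) x \<partial>M) - (\<integral>x. s i x * indicator (F n) x \<partial>M)
          = (\<integral>x. f x * indicator (F n) x - s i x * indicator (F n) x \<partial>M)"
        using int[OF lim(5), of n] int[OF lim(1), of i n] by simp
      also have "\<bar>\<dots>\<bar> \<le> (\<integral>x. \<bar>f x * indicator (F n) x - s i x * indicator (F n) x\<bar> \<partial>M)"
        by (rule integral_abs_bound)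
      also have "\<dots> \<le> (\<integral>x. \<bar>s i x - f x\<bar> \<partial>M)"
        using lim(1)[of i] lim(5) int[OF lim(5), of n] int[OF lim(1), of i n]
        by (intro integral_mono) (auto simp: indicator_def abs_minus_commute)
      finally show ?thesis .
    qed
    have d2: "\<bar>(\<integral>x. f x \<partial>M) - (\<integral>x. s i x \<partial>M)\<bar> \<le> (\<integral>x. \<bar>s i x - f x\<bar> \<partial>M)" for i
    proof -
      have "(\<integral>x. f x \<partial>M) - (\<integral>x. s i x \<partial>M) = (\<integral>x. f x - s i x \<partial>M)" using lim(1,5) by simp
      also have "\<bar>\<dots>\<bar> \<le> (\<integral>x. \<bar>f x - s i x\<bar> \<partial>M)" by (rule integral_abs_bound)
      finally show ?thesis by (simp add: abs_minus_commute)
    qed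
    show ?case
    proof (rule LIMSEQ_I)
      fix e :: real assume e: "e > 0"
      obtain i where i: "(\<integral>x. \<bar>s i x - f x\<bar> \<partial>M) < e / 4"
        using LIMSEQ_D[OF close, of "e / 4"] e by fastforce
      obtain no where no: "\<And>n. n \<ge> no \<Longrightarrow> \<bar>(\<integral>x. s i x * indicator (F n) x \<partial>M) - (\<integral>x. s i x \<partial>M) * p\<bar> < e / 4"
        using LIMSEQ_D[OF lim(2)[of i], of "e / 4"] e by auto
      have "\<bar>(\<integral>x. f x \<partial>M) - (\<integral>x. s i x \<partial>M)\<bar> * p \<le> (e / 4) * 1"
        using d2[of i] i p by (intro mult_mono) auto
      then have "\<bar>(\<integral>x. f x \<partial>M) * p - (\<integral>x. s i x \<partial>M) * p\<bar> \<le> e / 4"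
        using p by (simp add: left_diff_distrib[symmetric] abs_mult)
      then have "norm ((\<integral>x. f x * indicator (F n) x \<partial>M) - (\<integral>x. f x \<partial>M) * p) < e" if "n \<ge> no" for n
        using no[OF that] d1[of n i] i unfolding real_norm_def by linarith
      then show "\<exists>no. \<forall>n\<ge>no. norm ((\<integral>x. f x * indicator (F n) x \<partial>M) - (\<integral>x. f x \<partial>M) * p) < e" by blast
    qed
  qed
  have ac: "absolutely_continuous M N"
    unfolding absolutely_continuous_def
  proof
    fix S assume "S \<in> null_sets M"
    then have "S \<in> sets M" "measure M S = 0" by (auto simp: measure_def null_sets_def)
    then show "S \<in> null_sets N" using null N(2) by (auto simp: null_sets_def N.emeasure_eq_measure)
  qed
  obtain D where D: "D \<in> borel_measurable M" "AE x in M. RN_deriv M N x = ennreal (D x)" "\<And>x. 0 \<le> D x"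
    using M.real_RN_deriv[OF N.finite_measure_axioms ac N(2)] by metis
  have "density M (RN_deriv M N) = N" by (rule M.density_RN_deriv[OF ac N(2)])
  moreover have "density M (RN_deriv M N) = density M (\<lambda>x. ennreal (D x))"
    using D by (intro density_cong) auto
  ultimately have ND: "N = density M (\<lambda>x. ennreal (D x))" by simp
  have nn: "(\<integral>\<^sup>+x. ennreal (D x) \<partial>M) = 1"
  proof -
    have "emeasure N (space M) = (\<integral>\<^sup>+x. ennreal (D x) * indicator (space M) x \<partial>M)"
      unfolding ND using D by (intro emeasure_density) auto
    also have "\<dots> = (\<integral>\<^sup>+x. ennreal (D x) \<partial>M)" by (intro nn_integral_cong) auto
    finally show ?thesis using N.emeasure_space_1 sets_eq_imp_space_eq[OF N(2)] by simp
  qed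
  have Di: "integrable M D" using D nn by (intro integrableI_nonneg) auto
  have mN: "measure N S = (\<integral>x. D x * indicator S x \<partial>M)" if S: "S \<in> sets M" for S
  proof -
    have "measure N S = (\<integral>x. indicator S x \<partial>N)" using S N(2) by simp
    also have "\<dots> = (\<integral>x. D x *\<^sub>R indicator S x \<partial>M)"
      using S D by (subst ND, intro integral_density) auto
    finally show ?thesis by simp
  qed
  have "integrable M (\<lambda>x. D x * indicator B x)"
    using Di B by (rule integrable_real_mult_indicator[rotated])
  from weak[OF this] show ?thesis
    using B F by (simp add: mN indicator_inter_arith mult.assoc)
qed

text \<open>The sum of the gaps from \<open>y j\<close> to \<open>x i\<close> and from
  \<open>y i\<close> to \<open>x (Suc i)\<close> is at most the gap from \<open>y j\<close> to
  \<open>x (Suc i)\<close>, because \<open>x i \<le> y i\<close>. So the assumption on neighbouring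
  maps controls all earlier ones.\<close>

lemma growth_chain:
  fixes x y :: "nat \<Rightarrow> nat \<Rightarrow> real"
  assumes step: "\<And>i. i < k \<Longrightarrow> filterlim (\<lambda>n. x (Suc i) n - y i n) at_top sequentially"
    and le: "\<And>i n. i \<le> k \<Longrightarrow> x i n \<le> y i n"
  shows "j < i \<Longrightarrow> i \<le> k \<Longrightarrow> filterlim (\<lambda>n. x i n - y j n) at_top sequentially"
proof (induction i)
  case (Suc i)
  show ?case
  proof (cases "j = i")
    case True
    then show ?thesis using step Suc by simp
  next
    case False
    then have "filterlim (\<lambda>n. x i n - y j n) at_top sequentially" using Suc by simp
    moreover have "filterlim (\<lambda>n. x (Suc i) n - y i n) at_top sequentially" using step Suc by simp
    ultimately have "filterlim (\<lambda>n. (x i n - y j n) + (x (Suc i) n - y i n)) at_top sequentially"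
      by (rule filterlim_at_top_add_at_top)
    then show ?thesis
      by (rule filterlim_at_top_mono) (use le[of i] Suc.prems in \<open>auto intro!: always_eventually\<close>)
  qed
qed simp

lemma filterlim_minus_nat_at_top:
  assumes "filterlim (a :: nat \<Rightarrow> nat) at_top sequentially"
  shows "filterlim (\<lambda>n. a n - g) at_top sequentially"
  unfolding filterlim_at_top
proof
  fix Z :: nat
  have "\<forall>\<^sub>F n in sequentially. Z + g \<le> a n" using assms by (simp add: filterlim_at_top)
  then show "\<forall>\<^sub>F n in sequentially. Z \<le> a n - g" by eventually_elim simp
qed

lemma exp_minus_tendsto_0:
  assumes "filterlim f at_top F" shows "((\<lambda>n. exp (- f n :: real)) \<longlongrightarrow> 0) F"
  using assms by (intro filterlim_compose[OF exp_at_bot]) (simp add: filterlim_uminus_at_bot)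

text \<open>The lengths \<open>m j\<close> and the gap \<open>g\<close> are fixed, so they only
  contribute constant factors, which the divergence of the exponents outweighs.\<close>

lemma eventually_cuts_small:
  fixes a :: "nat \<Rightarrow> nat \<Rightarrow> nat" and c :: "nat \<Rightarrow> real"
  assumes ak: "filterlim (a k) at_top sequentially"
    and gr: "\<And>j. j < k \<Longrightarrow> filterlim (\<lambda>n. real (a k n) * d - real (a j n) * c j) at_top sequentially"
    and gr0: "filterlim (\<lambda>n. real (a k n) * d) at_top sequentially"
  shows "\<forall>\<^sub>F n in sequentially. K + (\<Sum>j<k. 2 * exp (real (a j n + m j) * c j)) \<le> exp (real (a k n - g) * d)"
proof -
  \<comment> \<open>The quotient of the two sides of the claim, for \<open>n\<close> with
    \<open>g \<le> a k n\<close>.\<close>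
  define G where "G n = K * exp (g * d) * exp (- (real (a k n) * d))
     + (\<Sum>j<k. 2 * exp (m j * c j + g * d) * exp (- (real (a k n) * d - real (a j n) * c j)))" for n
  have "G \<longlonglongrightarrow> K * exp (g * d) * 0 + (\<Sum>j<k. 2 * exp (m j * c j + g * d) * 0)"
    unfolding G_def by (intro tendsto_add tendsto_mult_left tendsto_sum exp_minus_tendsto_0 gr0 gr) auto
  then have "\<forall>\<^sub>F n in sequentially. G n < 1" by (intro order_tendstoD(2)) auto
  moreover have "\<forall>\<^sub>F n in sequentially. g \<le> a k n" using ak by (simp add: filterlim_at_top)
  ultimately show ?thesis
  proof eventually_elim
    case (elim n)
    let ?X = "exp (real (a k n - g) * d)"
    have X: "?X = exp (real (a k n) * d) * exp (- (g * d))"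
      using elim(2) by (simp add: of_nat_diff exp_add[symmetric] algebra_simps)
    have 1: "K * exp (g * d) * exp (- (real (a k n) * d)) * ?X = K"
      unfolding X by (simp add: exp_add[symmetric] mult.assoc)
    have 2: "2 * exp (m j * c j + g * d) * exp (- (real (a k n) * d - real (a j n) * c j)) * ?X
        = 2 * exp (real (a j n + m j) * c j)" for j
      unfolding X by (simp add: exp_add[symmetric] algebra_simps flip: mult.assoc)
    have "K + (\<Sum>j<k. 2 * exp (real (a j n + m j) * c j)) = G n * ?X"
      unfolding G_def distrib_right sum_distrib_right 1 2 ..
    also have "\<dots> \<le> 1 * ?X" using elim(1) by (intro mult_right_mono) auto
    finally show ?case by simp
  qed
qed

text \<open>\<open>B\<close> and the earlier preimages are replaced by sets with few cuts, whose
  total number is eventually below the count at which cylinders of \<open>T k\<close> of length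
  \<open>a k n - g\<close> can carry much mass. \<open>decouple\<close> then separates the last
  factor.\<close>

lemma decouple_last:
  fixes k :: nat and a :: "nat \<Rightarrow> nat \<Rightarrow> nat"
  assumes cls: "\<And>j. j \<le> k \<Longrightarrow> class_T (T j) (\<mu> j) (P j)"
    and amix: "alpha_mixing (T k) (\<mu> k) (P k)"
    and up: "\<And>j. j < k \<Longrightarrow> pmp.upper_rate (\<mu> j) (T j) (branch (P j)) (c j)"
    and low: "pmp.lower_rate (\<mu> k) (T k) (branch (P k)) d"
    and a: "\<And>j. j \<le> k \<Longrightarrow> filterlim (a j) at_top sequentially"
    and gr: "\<And>j. j < k \<Longrightarrow> filterlim (\<lambda>n. real (a k n) * d - real (a j n) * c j) at_top sequentially"
    and gr0: "filterlim (\<lambda>n. real (a k n) * d) at_top sequentially"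
    and B: "B \<in> sets borel01" and A: "\<And>j. j \<le> k \<Longrightarrow> A j \<in> sets borel01"
  shows "(\<lambda>n. measure (\<mu> k) (B \<inter> (\<Inter>j<k. preim (T j) (a j n) (A j)) \<inter> preim (T k) (a k n) (A k))
     - measure (\<mu> k) (B \<inter> (\<Inter>j<k. preim (T j) (a j n) (A j))) * measure (\<mu> k) (A k)) \<longlonglongrightarrow> 0"
proof (rule LIMSEQ_I)
  fix e :: real assume e: "e > 0"
  \<comment> \<open>The final error is below \<open>7 * \<delta>\<close>: replacing
    \<open>E0\<close> by \<open>E\<close> costs \<open>2 * \<delta>\<close> in each of the two
    terms, and decoupling \<open>E\<close> costs less than \<open>3 * \<delta>\<close>.\<close>
  define \<delta> where "\<delta> = e / 8"
  have \<delta>: "\<delta> > 0" using e by (simp add: \<delta>_def)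
  interpret K: class_T "T k" "\<mu> k" "P k" by (rule cls) simp
  have sets_eq: "sets (\<mu> j) = sets (\<mu> k)" if "j \<le> k" for j
    using class_T.sets_mu[OF cls[OF that]] K.sets_mu by simp
  have As: "A j \<in> sets (\<mu> k)" if "j \<le> k" for j using A[OF that] K.sets_mu by simp
  have Bs: "B \<in> sets (\<mu> k)" using B K.sets_mu by simp
  have pre: "preim (T j) n (A j) \<in> sets (\<mu> k)" if j: "j \<le> k" for j n
  proof -
    interpret J: class_T "T j" "\<mu> j" "P j" by (rule cls[OF j])
    show ?thesis
      using measurable_sets[OF J.Tn_meas, of "A j" n] As[OF j] sets_eq[OF j] by (simp add: preim_def)
  qed
  obtain B' KB where B': "B' \<in> sets (\<mu> k)" "few_cuts B' KB" "K.prob ((B - B') \<union> (B' - B)) < \<delta>"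
    using approx_few_cuts[OF K.finite_measure_axioms K.sets_mu Bs \<delta>] by blast
  define \<delta>' where "\<delta>' = \<delta> / real (Suc k)"
  have \<delta>': "\<delta>' > 0" using \<delta> by (simp add: \<delta>'_def)
  have "\<exists>m. \<forall>\<^sub>F n in sequentially. \<exists>U\<in>sets (\<mu> k). few_cuts U (2 * exp (real (n + m) * c j)) \<and>
      K.prob ((preim (T j) n (A j) - U) \<union> (U - preim (T j) n (A j))) \<le> \<delta>'" if j: "j < k" for j
  proof -
    have jk: "j \<le> k" using j by simp
    interpret J: class_T "T j" "\<mu> j" "P j" by (rule cls[OF jk])
    obtain c1 where c1: "c1 \<ge> 1" "\<And>S. S \<in> sets (\<mu> k) \<Longrightarrow> K.prob S \<le> c1 * measure lborel S"
      using K.mu_leb by blast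
    obtain c2 where c2: "c2 \<ge> 1" "\<And>S. S \<in> sets (\<mu> j) \<Longrightarrow> measure lborel S \<le> c2 * J.prob S"
      using J.mu_leb by blast
    \<comment> \<open>The approximation of the preimage under \<open>T j\<close> is only available
      in \<open>\<mu> j\<close>; Lebesgue measure mediates the comparison with
      \<open>\<mu> k\<close>.\<close>
    have cmp: "K.prob S \<le> c1 * c2 * J.prob S" if S: "S \<in> sets (\<mu> k)" for S
    proof -
      have "K.prob S \<le> c1 * measure lborel S" by (rule c1(2)[OF S])
      also have "\<dots> \<le> c1 * (c2 * J.prob S)"
        using c1(1) c2(2)[of S] S sets_eq[OF jk] by (intro mult_left_mono) auto
      finally show ?thesis by (simp add: mult.assoc)
    qed
    have c12: "c1 * c2 > 0" using c1(1) c2(1) by simp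
    obtain m where m: "\<forall>\<^sub>F n in sequentially. \<exists>U\<in>sets (\<mu> j). few_cuts U (2 * exp (real (n + m) * c j)) \<and>
       J.prob ((preim (T j) n (A j) - U) \<union> (U - preim (T j) n (A j))) \<le> \<delta>' / (c1 * c2)"
      using J.preim_few_cuts[OF up[OF j], of "A j" "\<delta>' / (c1 * c2)"] As[OF jk] sets_eq[OF jk] \<delta>' c12 by auto
    show ?thesis
    proof (intro exI[of _ m], use m in eventually_elim)
      case (elim n)
      then obtain U where U: "U \<in> sets (\<mu> j)" "few_cuts U (2 * exp (real (n + m) * c j))"
        "J.prob ((preim (T j) n (A j) - U) \<union> (U - preim (T j) n (A j))) \<le> \<delta>' / (c1 * c2)" by blast
      have Uk: "U \<in> sets (\<mu> k)" using U(1) sets_eq[OF jk] by simp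
      have "K.prob ((preim (T j) n (A j) - U) \<union> (U - preim (T j) n (A j)))
          \<le> c1 * c2 * J.prob ((preim (T j) n (A j) - U) \<union> (U - preim (T j) n (A j)))"
        using Uk pre[OF jk] by (intro cmp) auto
      also have "\<dots> \<le> c1 * c2 * (\<delta>' / (c1 * c2))" using U(3) c12 by (intro mult_left_mono) auto
      also have "\<dots> = \<delta>'" using c1(1) c2(1) by simp
      finally show ?case using U(2) Uk by blast
    qed
  qed
  then have "\<forall>j\<in>{..<k}. \<exists>m. \<forall>\<^sub>F n in sequentially. \<exists>U\<in>sets (\<mu> k). few_cuts U (2 * exp (real (n + m) * c j)) \<and>
      K.prob ((preim (T j) n (A j) - U) \<union> (U - preim (T j) n (A j))) \<le> \<delta>'" by blast
  from bchoice[OF this] obtain m where m: "\<And>j. j < k \<Longrightarrow> \<forall>\<^sub>F n in sequentially. \<exists>U\<in>sets (\<mu> k).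
      few_cuts U (2 * exp (real (n + m j) * c j)) \<and> K.prob ((preim (T j) n (A j) - U) \<union> (U - preim (T j) n (A j))) \<le> \<delta>'"
    by blast
  have ev1: "\<forall>\<^sub>F n in sequentially. \<forall>j\<in>{..<k}. \<exists>U. U \<in> sets (\<mu> k) \<and> few_cuts U (2 * exp (real (a j n + m j) * c j)) \<and>
      K.prob ((preim (T j) (a j n) (A j) - U) \<union> (U - preim (T j) (a j n) (A j))) \<le> \<delta>'"
  proof (rule eventually_ball_finite, simp, rule ballI)
    fix j assume "j \<in> {..<k}"
    then have j: "j < k" "j \<le> k" by auto
    show "\<forall>\<^sub>F n in sequentially. \<exists>U. U \<in> sets (\<mu> k) \<and> few_cuts U (2 * exp (real (a j n + m j) * c j)) \<and>
      K.prob ((preim (T j) (a j n) (A j) - U) \<union> (U - preim (T j) (a j n) (A j))) \<le> \<delta>'"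
      using eventually_compose_filterlim[OF m[OF j(1)] a[OF j(2)]] by (rule eventually_mono) blast
  qed
  obtain \<alpha> :: "nat \<Rightarrow> real" where \<alpha>: "\<alpha> \<longlonglongrightarrow> 0"
    "\<And>l n W X. l \<ge> 1 \<Longrightarrow> X \<in> sets (\<mu> k) \<Longrightarrow>
       \<bar>K.prob (K.cyl l W \<inter> preim (T k) (n + l) X) - K.prob (K.cyl l W) * K.prob X\<bar> \<le> \<alpha> n"
    using K.alpha_mixing_cyl[OF amix] by blast
  \<comment> \<open>The gap is chosen once, independently of \<open>n\<close>, so that the rate at
    \<open>g\<close> is already small.\<close>
  obtain g where g: "\<bar>\<alpha> g\<bar> < \<delta>" using LIMSEQ_D[OF \<alpha>(1) \<delta>] by auto
  have ak: "filterlim (a k) at_top sequentially" using a by simp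
  have "\<forall>\<^sub>F l in sequentially. \<forall>W. finite W \<and> real (card W) \<le> exp (real l * d) \<longrightarrow> K.prob (K.cyl l W) \<le> \<delta>"
    using low \<delta> unfolding K.lower_rate_def by blast
  then have ev2: "\<forall>\<^sub>F n in sequentially. \<forall>W. finite W \<and> real (card W) \<le> exp (real (a k n - g) * d) \<longrightarrow> K.prob (K.cyl (a k n - g) W) \<le> \<delta>"
    by (rule eventually_compose_filterlim[OF _ filterlim_minus_nat_at_top[OF ak]])
  have ev3: "\<forall>\<^sub>F n in sequentially. KB + (\<Sum>j<k. 2 * exp (real (a j n + m j) * c j)) \<le> exp (real (a k n - g) * d)"
    by (rule eventually_cuts_small[where a = a and k = k, OF ak gr gr0])
  have ev4: "\<forall>\<^sub>F n in sequentially. Suc g \<le> a k n" using ak by (simp add: filterlim_at_top)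
  have "\<forall>\<^sub>F n in sequentially. \<bar>K.prob (B \<inter> (\<Inter>j<k. preim (T j) (a j n) (A j)) \<inter> preim (T k) (a k n) (A k))
     - K.prob (B \<inter> (\<Inter>j<k. preim (T j) (a j n) (A j))) * K.prob (A k)\<bar> < e"
    using ev1 ev2 ev3 ev4
  proof eventually_elim
    case (elim n)
    define X where "X j = preim (T j) (a j n) (A j)" for j
    have Xs: "X j \<in> sets (\<mu> k)" if "j \<le> k" for j unfolding X_def using pre[OF that] .
    from bchoice[OF elim(1)] obtain U where U: "\<And>j. j < k \<Longrightarrow> U j \<in> sets (\<mu> k)"
      "\<And>j. j < k \<Longrightarrow> few_cuts (U j) (2 * exp (real (a j n + m j) * c j))"
      "\<And>j. j < k \<Longrightarrow> K.prob ((X j - U j) \<union> (U j - X j)) \<le> \<delta>'"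
      unfolding X_def by blast
    define E0 where "E0 = B \<inter> (\<Inter>j<k. X j)"
    define E where "E = B' \<inter> (\<Inter>j<k. U j)"
    \<comment> \<open>For \<open>k = 0\<close> the intersection over the empty family is the whole
      real line, which is not a set of the measure space; only its intersection with
      \<open>C\<close> is.\<close>
    have Int_sets: "C \<inter> (\<Inter>j<k. Y j) \<in> sets (\<mu> k)"
      if "C \<in> sets (\<mu> k)" "\<And>j. j < k \<Longrightarrow> Y j \<in> sets (\<mu> k)" for C and Y :: "nat \<Rightarrow> real set"
      using that by (cases "k = 0") (auto intro!: sets.Int sets.finite_INT)
    have E0s: "E0 \<in> sets (\<mu> k)" unfolding E0_def using Bs Xs by (intro Int_sets) auto
    have Es: "E \<in> sets (\<mu> k)" unfolding E_def using B' U by (intro Int_sets) auto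
    have dE: "K.prob ((E0 - E) \<union> (E - E0)) \<le> 2 * \<delta>"
    proof -
      let ?Dj = "\<lambda>j. (X j - U j) \<union> (U j - X j)"
      have Dj: "?Dj j \<in> sets (\<mu> k)" if "j < k" for j using that Xs[of j] U by auto
      have UD: "(\<Union>j<k. ?Dj j) \<in> sets (\<mu> k)" using Dj by (intro sets.finite_UN) auto
      have "K.prob ((E0 - E) \<union> (E - E0)) \<le> K.prob (((B - B') \<union> (B' - B)) \<union> (\<Union>j<k. ?Dj j))"
        using Bs B' UD by (intro K.finite_measure_mono) (auto simp: E0_def E_def)
      also have "\<dots> \<le> K.prob ((B - B') \<union> (B' - B)) + K.prob (\<Union>j<k. ?Dj j)"
        using Bs B' UD by (intro measure_Un_le) auto
      also have "K.prob (\<Union>j<k. ?Dj j) \<le> (\<Sum>j<k. K.prob (?Dj j))"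
        using Dj by (intro K.finite_measure_subadditive_finite) auto
      also have "\<dots> \<le> (\<Sum>j<k. \<delta>')" using U(3) by (intro sum_mono) auto
      also have "\<dots> \<le> real (Suc k) * \<delta>'" using \<delta>' by simp
      also have "\<dots> = \<delta>" by (simp add: \<delta>'_def)
      finally show ?thesis using B'(3) by simp
    qed
    define l where "l = a k n - g"
    have l: "a k n = g + l" "l \<ge> 1" using elim(4) by (auto simp: l_def)
    have fc: "few_cuts E (KB + (\<Sum>j<k. 2 * exp (real (a j n + m j) * c j)))"
      unfolding E_def by (intro few_cuts_Int B' few_cuts_INT U) auto
    have dec: "\<bar>K.prob (E \<inter> X k) - K.prob E * K.prob (A k)\<bar> \<le> 2 * \<delta> + \<alpha> g"
    proof (rule K.decouple[OF Es fc elim(3)])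
      show "K.prob (K.cyl (a k n - g) W) \<le> \<delta>" if "finite W" "real (card W) \<le> exp (real (a k n - g) * d)" for W
        using elim(2) that by blast
      show "X k \<in> sets (\<mu> k)" using Xs by simp
      show "\<bar>K.prob (K.cyl (a k n - g) W \<inter> X k) - K.prob (K.cyl (a k n - g) W) * K.prob (A k)\<bar> \<le> \<alpha> g" for W
        using \<alpha>(2)[OF l(2) As[of k], of W g] unfolding X_def l(1) by simp
    qed auto
    have 1: "\<bar>K.prob (E0 \<inter> X k) - K.prob (E \<inter> X k)\<bar> \<le> 2 * \<delta>"
      using K.prob_diff_le[OF E0s Es Xs[of k]] dE by simp
    have "\<bar>K.prob (E0 \<inter> space (\<mu> k)) - K.prob (E \<inter> space (\<mu> k))\<bar> \<le> 2 * \<delta>"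
      using K.prob_diff_le[OF E0s Es sets.top] dE by (rule order_trans)
    then have "\<bar>K.prob E0 - K.prob E\<bar> \<le> 2 * \<delta>" using E0s Es by (simp only: sets.Int_space_eq2)
    then have "\<bar>K.prob E0 - K.prob E\<bar> * K.prob (A k) \<le> (2 * \<delta>) * 1" by (intro mult_mono) auto
    then have 2: "\<bar>K.prob E0 * K.prob (A k) - K.prob E * K.prob (A k)\<bar> \<le> 2 * \<delta>"
      by (simp add: left_diff_distrib[symmetric] abs_mult)
    have "\<bar>K.prob (E0 \<inter> X k) - K.prob E0 * K.prob (A k)\<bar> < e"
      using 1 2 dec g \<delta> unfolding \<delta>_def by linarith
    then show ?case by (simp only: E0_def X_def)
  qed
  then show "\<exists>no. \<forall>n\<ge>no. norm (K.prob (B \<inter> (\<Inter>j<k. preim (T j) (a j n) (A j)) \<inter> preim (T k) (a k n) (A k))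
     - K.prob (B \<inter> (\<Inter>j<k. preim (T j) (a j n) (A j))) * K.prob (A k) - 0) < e"
    by (simp add: eventually_sequentially)
qed

section \<open>Induction over the maps\<close>

theorem theorem9p2:
  fixes k :: nat
    and \<mu> :: "nat \<Rightarrow> real measure"
    and T :: "nat \<Rightarrow> real \<Rightarrow> real"
    and P :: "nat \<Rightarrow> real set set"
    and a :: "nat \<Rightarrow> nat \<Rightarrow> nat"
    and \<nu> :: "real measure"
    and B :: "real set"
    and A :: "nat \<Rightarrow> real set"
  assumes classT: "\<And>i. i \<le> k \<Longrightarrow> in_class_T (T i) (\<mu> i) (P i)"
    and amix: "\<And>i. 1 \<le> i \<Longrightarrow> i \<le> k \<Longrightarrow> alpha_mixing (T i) (\<mu> i) (P i)"
    and hfin: "\<And>i. i \<le> k \<Longrightarrow> ks_entropy (\<mu> i) (T i) < \<infinity>"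
    and incr: "\<And>i. i \<le> k \<Longrightarrow> strict_mono (a i)"
    and growth: "\<exists>\<epsilon>0 > 0. \<forall>i < k.
        filterlim (\<lambda>n. real (a (Suc i) n) * (real_of_ereal (ks_entropy (\<mu> (Suc i)) (T (Suc i))) - \<epsilon>0)
                     - real (a i n) * (real_of_ereal (ks_entropy (\<mu> i) (T i)) + \<epsilon>0))
          at_top sequentially"
    and smix: "strongly_mixing01 (\<mu> 0) (T 0)"
    and nu: "prob01 \<nu>" "equiv_lebesgue01 \<nu>"
    and BA: "B \<in> sets borel01" "\<And>i. i \<le> k \<Longrightarrow> A i \<in> sets borel01"
  shows "(\<lambda>n. measure \<nu> (B \<inter> (\<Inter>i\<in>{0..k}. preim (T i) (a i n) (A i))))
           \<longlonglongrightarrow> measure \<nu> B * (\<Prod>i\<in>{0..k}. measure (\<mu> i) (A i))"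
proof -
  have cls: "class_T (T i) (\<mu> i) (P i)" if "i \<le> k" for i
    by unfold_locales (rule classT[OF that])
  have sets_mu: "sets (\<mu> i) = sets borel01" if "i \<le> k" for i
    by (rule class_T.sets_mu[OF cls[OF that]])
  have prob_mu: "prob_space (\<mu> i)" if "i \<le> k" for i
    using classT[OF that] by (simp add: in_class_T_def prob01_def)
  \<comment> \<open>Strong mixing of \<open>T 0\<close> is used here for its entropy rates and again
    as the base case of the induction.\<close>
  have mixing: "mixing_pmp (\<mu> i) (T i)" if i: "i \<le> k" for i
  proof (cases "i = 0")
    case True
    interpret C: class_T "T 0" "\<mu> 0" "P 0" using cls[of 0] by simp
    show ?thesis unfolding True
      by unfold_locales (use smix in \<open>auto simp: strongly_mixing01_def preim_def\<close>)
  next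
    case False
    then show ?thesis using class_T.alpha_mixing_imp_mixing[OF cls[OF i]] amix[of i] i by simp
  qed
  define h where "h i = real_of_ereal (ks_entropy (\<mu> i) (T i))" for i
  have h: "ks_entropy (\<mu> i) (T i) = ereal (h i)" "h i \<ge> 0" if i: "i \<le> k" for i
  proof -
    have "0 \<le> ks_entropy (\<mu> i) (T i)" by (rule class_T.ks_entropy_nonneg[OF cls[OF i] mixing[OF i]])
    then show "ks_entropy (\<mu> i) (T i) = ereal (h i)" "h i \<ge> 0"
      using hfin[OF i] unfolding h_def by (auto simp: real_of_ereal_pos ereal_real)
  qed
  obtain \<epsilon> where \<epsilon>: "\<epsilon> > 0" and gr: "\<And>i. i < k \<Longrightarrow>
      filterlim (\<lambda>n. real (a (Suc i) n) * (h (Suc i) - \<epsilon>) - real (a i n) * (h i + \<epsilon>)) at_top sequentially"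
    using growth unfolding h_def by blast
  have chain: "filterlim (\<lambda>n. real (a i n) * (h i - \<epsilon>) - real (a j n) * (h j + \<epsilon>)) at_top sequentially"
    if "j < i" "i \<le> k" for i j
    by (rule growth_chain[of k "\<lambda>i n. real (a i n) * (h i - \<epsilon>)" "\<lambda>i n. real (a i n) * (h i + \<epsilon>)", OF gr _ that])
       (use \<epsilon> in \<open>auto intro!: mult_left_mono\<close>)
  have a_lim: "filterlim (a i) at_top sequentially" if "i \<le> k" for i
    using incr[OF that] by (rule filterlim_subseq)
  define F where "F i n = (\<Inter>j\<in>{0..i}. preim (T j) (a j n) (A j))" for i n
  have pre: "preim (T j) n (A j) \<in> sets borel01" if j: "j \<le> k" for j n
  proof -
    interpret J: class_T "T j" "\<mu> j" "P j" by (rule cls[OF j])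
    show ?thesis using measurable_sets[OF J.Tn_meas, of "A j" n] BA(2)[OF j] J.sets_mu by (simp add: preim_def)
  qed
  have F_sets: "F i n \<in> sets borel01" if "i \<le> k" for i n
    unfolding F_def using pre that by (intro sets.finite_INT) auto
  define p where "p i = (\<Prod>j\<in>{0..i}. measure (\<mu> j) (A j))" for i
  have p: "0 \<le> p i" "p i \<le> 1" if "i \<le> k" for i
    unfolding p_def using prob_space.prob_le_1[OF prob_mu] that
    by (auto intro!: prod_nonneg prod_le_1)
  \<comment> \<open>It is enough to prove the limit for \<open>\<mu> i\<close>, where invariance or
    \<alpha>-mixing is at hand; every equivalent measure follows.\<close>
  have transfer: "(\<lambda>n. measure N (B \<inter> F i n)) \<longlonglongrightarrow> measure N B * p i"
    if i: "i \<le> k" and N: "prob01 N" "equiv_lebesgue01 N" and B: "B \<in> sets borel01"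
      and lim: "\<And>B. B \<in> sets borel01 \<Longrightarrow> (\<lambda>n. measure (\<mu> i) (B \<inter> F i n)) \<longlonglongrightarrow> measure (\<mu> i) B * p i"
    for i N B
  proof (rule abs_cont_transfer[OF prob_mu[OF i]])
    show "prob_space N" "sets N = sets (\<mu> i)" using N sets_mu[OF i] by (auto simp: prob01_def)
    fix S assume "S \<in> sets (\<mu> i)" "measure (\<mu> i) S = 0"
    then show "measure N S = 0"
      using class_T.mu_zero_iff[OF cls[OF i], of S] N(2) measure_leb01[of S] sets_mu[OF i]
      by (simp add: equiv_lebesgue01_def)
  qed (use F_sets[OF i] sets_mu[OF i] p[OF i] lim B in auto)
  have equiv_mu: "prob01 (\<mu> i)" "equiv_lebesgue01 (\<mu> i)" if i: "i \<le> k" for i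
    using classT[OF i] class_T.mu_zero_iff[OF cls[OF i]] sets_mu[OF i] measure_leb01
    by (auto simp: in_class_T_def equiv_lebesgue01_def)
  \<comment> \<open>The measure \<open>N\<close> is generalised because the step to
    \<open>Suc i\<close> needs the limit for the first \<open>i + 1\<close> preimages in the measure
    \<open>\<mu> (Suc i)\<close>.\<close>
  have main: "(\<lambda>n. measure N (B \<inter> F i n)) \<longlonglongrightarrow> measure N B * p i"
    if "i \<le> k" "prob01 N" "equiv_lebesgue01 N" "B \<in> sets borel01" for i N B
    using that
  proof (induction i arbitrary: N B)
    case 0
    show ?case
    proof (rule transfer[OF 0])
      fix B assume B: "B \<in> sets borel01"
      have "(\<lambda>n. measure (\<mu> 0) (B \<inter> preim (T 0) n (A 0))) \<longlonglongrightarrow> measure (\<mu> 0) B * measure (\<mu> 0) (A 0)"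
        using smix B BA(2)[of 0] sets_mu[of 0] by (simp add: strongly_mixing01_def)
      from filterlim_compose[OF this a_lim[of 0]]
      show "(\<lambda>n. measure (\<mu> 0) (B \<inter> F 0 n)) \<longlonglongrightarrow> measure (\<mu> 0) B * p 0"
        by (simp add: F_def p_def)
    qed
  next
    case (Suc i)
    let ?k = "Suc i"
    have ik: "i \<le> k" using Suc.prems by simp
    show ?case
    proof (rule transfer[OF Suc.prems])
      fix B assume B: "B \<in> sets borel01"
      have "(\<lambda>n. measure (\<mu> ?k) (B \<inter> (\<Inter>j<?k. preim (T j) (a j n) (A j)) \<inter> preim (T ?k) (a ?k n) (A ?k))
         - measure (\<mu> ?k) (B \<inter> (\<Inter>j<?k. preim (T j) (a j n) (A j))) * measure (\<mu> ?k) (A ?k)) \<longlonglongrightarrow> 0"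
      \<comment> \<open>The slack \<epsilon> of the growth condition is spent on both sides: earlier
        maps get a rate above their entropy, the last map a rate below its own.\<close>
      proof (rule decouple_last[where P = P and c = "\<lambda>j. h j + \<epsilon>" and d = "h ?k - \<epsilon>"])
        show "alpha_mixing (T ?k) (\<mu> ?k) (P ?k)" using amix Suc.prems by simp
        show "pmp.upper_rate (\<mu> j) (T j) (branch (P j)) (h j + \<epsilon>)" if "j < ?k" for j
        proof -
          have j: "j \<le> k" using that Suc.prems by simp
          show ?thesis
            using \<epsilon> h(1)[OF j] by (intro class_T.upper_rate_branch[OF cls[OF j] mixing[OF j]]) simp
        qed
        show "pmp.lower_rate (\<mu> ?k) (T ?k) (branch (P ?k)) (h ?k - \<epsilon>)"
          using \<epsilon> h(1)[OF Suc.prems(1)]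
          by (intro class_T.lower_rate_branch[OF cls[OF Suc.prems(1)] mixing[OF Suc.prems(1)]]) simp
        \<comment> \<open>The bounded number of cuts of the set approximating \<open>B\<close> has
          to be outgrown as well; this follows from the chain with index 0 by dropping a nonnegative
          subtrahend.\<close>
        show "filterlim (\<lambda>n. real (a ?k n) * (h ?k - \<epsilon>)) at_top sequentially"
          by (rule filterlim_at_top_mono[OF chain[of 0 ?k]])
             (use Suc.prems h(2)[of 0] \<epsilon> in \<open>auto intro!: always_eventually\<close>)
      qed (use cls a_lim chain B BA(2) Suc.prems in auto)
      moreover have "(\<Inter>j<?k. preim (T j) (a j n) (A j)) = F i n" for n
        unfolding F_def by (intro INF_cong) auto
      moreover have "B \<inter> F i n \<inter> preim (T ?k) (a ?k n) (A ?k) = B \<inter> F ?k n" for n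
        unfolding F_def by (auto simp: atLeast0_atMost_Suc)
      ultimately have 1: "(\<lambda>n. measure (\<mu> ?k) (B \<inter> F ?k n) - measure (\<mu> ?k) (B \<inter> F i n) * measure (\<mu> ?k) (A ?k)) \<longlonglongrightarrow> 0"
        by simp
      have 2: "(\<lambda>n. measure (\<mu> ?k) (B \<inter> F i n) * measure (\<mu> ?k) (A ?k)) \<longlonglongrightarrow> measure (\<mu> ?k) B * p i * measure (\<mu> ?k) (A ?k)"
        using Suc.prems B by (intro tendsto_mult_right Suc.IH ik equiv_mu) auto
      show "(\<lambda>n. measure (\<mu> ?k) (B \<inter> F ?k n)) \<longlonglongrightarrow> measure (\<mu> ?k) B * p ?k"
        using tendsto_add[OF 1 2] by (simp add: p_def mult.assoc)
    qed
  qed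
  show ?thesis
    using main[OF order_refl nu BA(1)] unfolding F_def p_def .
qed

end
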